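(* Let $\mathbb F$ be a nonabelian free group of finite rank and let $g$ be a positive integer. If $N(H_g,P_g)$ is a solid bound for $(H_g,P_g)$ (defined in the context), then $$N(H_g,P_g)\ \ge\ f_{\mathbb F}(g)\ \ge\ f'_{\mathbb F}(g)\ \ge\ 2^g.$$
   Context: Commutators are $[a,b]=aba^{-1}b^{-1}$ and $i_z$ denotes conjugation by $z$. Let $H_g=\langle a_1,b_1,\dots,a_g,b_g\rangle$ be the free group of rank $2g$ on the indicated basis, $\partial_g=[a_1,b_1]\cdots[a_g,b_g]\in H_g$, and $P_g=\langle\partial_g\rangle$. For $x\in\mathbb F$, a genus $g$ representation of $x$ is a homomorphism $h:H_g\to\mathbb F$ with $h(\partial_g)=x$; equivalently, an extension to $H_g$ of the homomorphism $P_g\to\mathbb F$, $\partial_g\mapsto x$. Fractional Dehn twists. Two genus $g$ representations $h,h'$ of $x$ are related by a fractional Dehn twist if one of the following holds. (i) $H_g=A*_CB$ with $C$ cyclic and $\partial_g\in A$, and there is $z\in\mathbb F$ centralizing $h(C)$ such that $h'|_A=h|_A$ and $h'|_B=i_z\circ(h|_B)$. (ii) $H_g=\langle A,t\mid t^{-1}ct=\phi(c),\ c\in C\rangle$ is an HNN extension, where $\phi:C\to C'$ is an isomorphism between cyclic subgroups of $A$, $\partial_g\in A$, and there is $z\in\mathbb F$ centralizing $h(C)$ such that $h'|_A=h|_A$ and $h'(t)=z\,h(t)$. The equivalence relation $\sim$ on genus $g$ representations of $x$ is the one generated by being related by a fractional Dehn twist. A genus $g$ representation $h$ of $x$ is $\sim$-injective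 if every genus $g$ representation of $x$ equivalent to $h$ (including $h$) is injective. Let $\mathrm{num}_g(x)$ be the number of $\sim$-equivalence classes of $\sim$-injective genus $g$ representations of $x$, and $f_{\mathbb F}(g)=\sup\{\mathrm{num}_g(x)\mid x\in\mathbb F\}$. A subgroup $S\le G$ is primitive if $t\in G$, $n\ge1$, $t^n\in S$ imply $t\in S$. A genus $g$ representation $h$ is admissible if $h$ is injective and $h(H_g)$ is primitive in $\mathbb F$. Let $\mathrm{num}'_g(x)$ be the number of distinct subgroups $h(H_g)\le\mathbb F$, with $h$ ranging over admissible genus $g$ representations of $x$, and $f'_{\mathbb F}(g)=\sup\{\mathrm{num}'_g(x)\mid x\in\mathbb F\}$. Solid bound. A number $N(H_g,P_g)$ is a solid bound for $(H_g,P_g)$ if there is a finite set $\mathcal F=\{q_i:H_g\to L_i\}$ of proper quotients of $H_g$ (surjective, non-injective homomorphisms) such that every homomorphism $P_g\to\mathbb F$ has at most $N(H_g,P_g)$ $\sim$-equivalence classes of extensions $h:H_g\to\mathbb F$ with the property that no element of the equivalence class of $h$ factors through an element of $\mathcal F$. (That such a number exists is a theorem of Sela.) *)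

theory Defs
  imports "HOL-Algebra.Algebra" "HOL-Library.Extended_Nat"
begin

section \<open>Free groups\<close>

text \<open>
  The free group on a set S is modelled by reduced words: the letter (x, True) stands for the
  generator x and (x, False) for its inverse.  The product is concatenation followed by free
  reduction, performed letter by letter.
\<close>

type_synonym 'x word = "('x \<times> bool) list"

definition reduced :: "'x word \<Rightarrow> bool" where
  "reduced w \<longleftrightarrow> successively (\<lambda>p q. \<not> (fst p = fst q \<and> snd p \<noteq> snd q)) w"

fun push :: "'x \<times> bool \<Rightarrow> 'x word \<Rightarrow> 'x word" where
  "push p [] = [p]"
| "push p (q # w) = (if fst p = fst q \<and> snd p \<noteq> snd q then w else p # q # w)"

definition free_group :: "'x set \<Rightarrow> 'x word monoid" where
  "free_group S =
     \<lparr>carrier = {w. fst ` set w \<subseteq> S \<and> reduced w}, monoid.mult = (\<lambda>u v. foldr push u v), one = []\<rparr>"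

definition free_gen :: "'x \<Rightarrow> 'x word" where
  "free_gen x = [(x, True)]"

lemma reduced_Nil [simp]: "reduced []"
  by (simp add: reduced_def)

lemma reduced_ConsD: "reduced (p # w) \<Longrightarrow> reduced w"
  by (cases w) (auto simp: reduced_def)

lemma reduced_push: "reduced w \<Longrightarrow> reduced (push p w)"
  by (cases w) (auto simp: reduced_def successively_Cons)

lemma set_push: "set (push p w) \<subseteq> insert p (set w)"
  by (cases w) auto

lemma push_reduced_Cons: "reduced (p # w) \<Longrightarrow> push p w = p # w"
  by (cases w) (auto simp: reduced_def)

lemma push_push_inverse:
  assumes "reduced w"
  shows "push (x, s) (push (x, \<not> s) w) = w"
proof (cases w)
  case (Cons q v)
  obtain y t where q: "q = (y, t)" by (cases q)
  show ?thesis
  proof (cases "y = x \<and> t = s")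
    case True
    then have w: "w = (x, s) # v" using Cons q by simp
    have "push (x, \<not> s) ((x, s) # v) = v" by simp
    then show ?thesis using push_reduced_Cons[of "(x, s)" v] assms unfolding w by metis
  next
    case False
    then have "push (x, \<not> s) ((y, t) # v) = (x, \<not> s) # (y, t) # v"
      by (cases s; cases t) simp_all
    moreover have "push (x, s) ((x, \<not> s) # (y, t) # v) = (y, t) # v" by simp
    ultimately show ?thesis unfolding Cons q by metis
  qed
qed simp

lemma reduced_foldr_push: "reduced w \<Longrightarrow> reduced (foldr push u w)"
  by (induction u) (auto simp: reduced_push)

lemma set_foldr_push: "set (foldr push u w) \<subseteq> set u \<union> set w"
proof (induction u)
  case (Cons p u)
  then show ?case using set_push[of p "foldr push u w"] by auto
qed auto

lemma foldr_push_push: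
  assumes "reduced w"
  shows "foldr push (push p v) w = push p (foldr push v w)"
proof (cases v)
  case (Cons q u)
  show ?thesis
  proof (cases "fst p = fst q \<and> snd p \<noteq> snd q")
    case True
    then obtain x t where pq: "p = (x, t)" "q = (x, \<not> t)" by (cases p; cases q) auto
    have "push p (push q (foldr push u w)) = foldr push u w"
      unfolding pq by (rule push_push_inverse[OF reduced_foldr_push[OF assms]])
    then show ?thesis using Cons True by simp
  qed (use Cons in auto)
qed auto

lemma foldr_push_assoc:
  assumes "reduced w"
  shows "foldr push (foldr push u v) w = foldr push u (foldr push v w)"
  by (induction u) (auto simp: foldr_push_push[OF assms])

lemma foldr_push_Nil: "reduced w \<Longrightarrow> foldr push w [] = w"
proof (induction w)
  case (Cons p w)
  then have "foldr push w [] = w" by (blast dest: reduced_ConsD)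
  with push_reduced_Cons[OF Cons.prems] show ?case by simp
qed auto

lemma foldr_push_inverse:
  assumes "reduced w"
  shows "foldr push (rev (map (\<lambda>p. (fst p, \<not> snd p)) u)) (foldr push u w) = w"
proof (induction u)
  case (Cons p u)
  have "push (fst p, \<not> snd p) (push p (foldr push u w)) = foldr push u w"
    using push_push_inverse[OF reduced_foldr_push[OF assms, of u], of "fst p" "\<not> snd p"] by simp
  with Cons show ?case by simp
qed (use assms in auto)

lemma group_free_group: "group (free_group S)"
proof (rule groupI)
  show "\<one>\<^bsub>free_group S\<^esub> \<in> carrier (free_group S)"
    by (simp add: free_group_def)
next
  fix u v assume "u \<in> carrier (free_group S)" "v \<in> carrier (free_group S)"
  then show "u \<otimes>\<^bsub>free_group S\<^esub> v \<in> carrier (free_group S)"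
    using image_mono[OF set_foldr_push[of u v], of fst]
    by (simp add: free_group_def reduced_foldr_push image_Un) blast
next
  fix u v w assume "w \<in> carrier (free_group S)"
  then show "u \<otimes>\<^bsub>free_group S\<^esub> v \<otimes>\<^bsub>free_group S\<^esub> w
      = u \<otimes>\<^bsub>free_group S\<^esub> (v \<otimes>\<^bsub>free_group S\<^esub> w)"
    by (simp add: free_group_def foldr_push_assoc)
next
  fix u show "\<one>\<^bsub>free_group S\<^esub> \<otimes>\<^bsub>free_group S\<^esub> u = u"
    by (simp add: free_group_def)
next
  fix u assume u: "u \<in> carrier (free_group S)"
  let ?v = "foldr push (rev (map (\<lambda>p. (fst p, \<not> snd p)) u)) []"
  have "set ?v \<subseteq> (\<lambda>p. (fst p, \<not> snd p)) ` set u"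
    using set_foldr_push[of "rev (map (\<lambda>p. (fst p, \<not> snd p)) u)" "[]"] by auto
  then have "fst ` set ?v \<subseteq> fst ` set u"
    by force
  moreover have "reduced ?v"
    by (rule reduced_foldr_push) simp
  ultimately have "?v \<in> carrier (free_group S)"
    using u unfolding free_group_def by auto
  moreover have "?v \<otimes>\<^bsub>free_group S\<^esub> u = \<one>\<^bsub>free_group S\<^esub>"
    using u foldr_push_inverse[of "[]" u]
    by (simp add: free_group_def foldr_push_assoc foldr_push_Nil)
  ultimately show "\<exists>v\<in>carrier (free_group S). v \<otimes>\<^bsub>free_group S\<^esub> u = \<one>\<^bsub>free_group S\<^esub>"
    by blast
qed

definition commutator :: "('a, 'm) monoid_scheme \<Rightarrow> 'a \<Rightarrow> 'a \<Rightarrow> 'a" where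
  "commutator G a b = a \<otimes>\<^bsub>G\<^esub> b \<otimes>\<^bsub>G\<^esub> inv\<^bsub>G\<^esub> a \<otimes>\<^bsub>G\<^esub> inv\<^bsub>G\<^esub> b"


section \<open>The pair of a free group and its boundary subgroup\<close>

datatype sgen = Agen nat | Bgen nat

definition Hgrp :: "nat \<Rightarrow> sgen word monoid" where
  "Hgrp g = free_group (Agen ` {1..g} \<union> Bgen ` {1..g})"

definition bdry :: "nat \<Rightarrow> sgen word" where
  "bdry g = foldr (\<lambda>i w. commutator (Hgrp g) (free_gen (Agen i)) (free_gen (Bgen i)) \<otimes>\<^bsub>Hgrp g\<^esub> w)
                  [1..<Suc g] \<one>\<^bsub>Hgrp g\<^esub>"

definition Pgrp :: "nat \<Rightarrow> sgen word set" where
  "Pgrp g = generate (Hgrp g) {bdry g}"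

lemma group_Hgrp: "group (Hgrp g)"
  by (simp add: Hgrp_def group_free_group)

text \<open>
  Homomorphisms out of the group are required to be extensional, that is, to take the fixed value
  undefined outside the carrier, so that equality and counting of homomorphisms have their
  usual meaning.
\<close>

definition ext_hom :: "('a, 'm) monoid_scheme \<Rightarrow> ('b, 'n) monoid_scheme \<Rightarrow> ('a \<Rightarrow> 'b) set" where
  "ext_hom G K = hom G K \<inter> extensional (carrier G)"

definition genus_reps :: "('f, 'm) monoid_scheme \<Rightarrow> nat \<Rightarrow> 'f \<Rightarrow> (sgen word \<Rightarrow> 'f) set" where
  "genus_reps F g x = {h \<in> ext_hom (Hgrp g) F. h (bdry g) = x}"


section \<open>Splittings\<close>

text \<open>
  Internal amalgamated products and HNN extensions, given by their universal properties.
  The test groups K range over the groups on the element type of G.  If this type is infinite,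
  as it is for the words used below, then it can carry the amalgamated product (HNN extension)
  built from the given subgroups of G, so the property determines that group.
\<close>

definition is_amalgam :: "'a monoid \<Rightarrow> 'a set \<Rightarrow> 'a set \<Rightarrow> 'a set \<Rightarrow> bool" where
  "is_amalgam G A B C \<longleftrightarrow>
     subgroup A G \<and> subgroup B G \<and> subgroup C G \<and> C \<subseteq> A \<inter> B \<and>
     (\<forall>(K :: 'a monoid) f1 f2.
        group K \<and> f1 \<in> hom (G\<lparr>carrier := A\<rparr>) K \<and> f2 \<in> hom (G\<lparr>carrier := B\<rparr>) K \<and>
        (\<forall>c\<in>C. f1 c = f2 c) \<longrightarrow>
        (\<exists>!k. k \<in> ext_hom G K \<and> (\<forall>a\<in>A. k a = f1 a) \<and> (\<forall>b\<in>B. k b = f2 b)))"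

definition is_HNN ::
  "'a monoid \<Rightarrow> 'a set \<Rightarrow> 'a \<Rightarrow> 'a set \<Rightarrow> 'a set \<Rightarrow> ('a \<Rightarrow> 'a) \<Rightarrow> bool" where
  "is_HNN G A t C C' \<phi> \<longleftrightarrow>
     subgroup A G \<and> t \<in> carrier G \<and> subgroup C G \<and> C \<subseteq> A \<and> subgroup C' G \<and> C' \<subseteq> A \<and>
     \<phi> \<in> iso (G\<lparr>carrier := C\<rparr>) (G\<lparr>carrier := C'\<rparr>) \<and>
     (\<forall>c\<in>C. inv\<^bsub>G\<^esub> t \<otimes>\<^bsub>G\<^esub> c \<otimes>\<^bsub>G\<^esub> t = \<phi> c) \<and>
     (\<forall>(K :: 'a monoid) f s.
        group K \<and> f \<in> hom (G\<lparr>carrier := A\<rparr>) K \<and> s \<in> carrier K \<and>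
        (\<forall>c\<in>C. inv\<^bsub>K\<^esub> s \<otimes>\<^bsub>K\<^esub> f c \<otimes>\<^bsub>K\<^esub> s = f (\<phi> c)) \<longrightarrow>
        (\<exists>!k. k \<in> ext_hom G K \<and> (\<forall>a\<in>A. k a = f a) \<and> k t = s))"


section \<open>Fractional Dehn twists\<close>

definition centralizes :: "('f, 'm) monoid_scheme \<Rightarrow> 'f \<Rightarrow> 'f set \<Rightarrow> bool" where
  "centralizes F z S \<longleftrightarrow> z \<in> carrier F \<and> (\<forall>s\<in>S. z \<otimes>\<^bsub>F\<^esub> s = s \<otimes>\<^bsub>F\<^esub> z)"

definition amalgam_twist ::
  "('f, 'm) monoid_scheme \<Rightarrow> nat \<Rightarrow> (sgen word \<Rightarrow> 'f) \<Rightarrow> (sgen word \<Rightarrow> 'f) \<Rightarrow> bool" where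
  "amalgam_twist F g h h' \<longleftrightarrow>
     (\<exists>A B C z. is_amalgam (Hgrp g) A B C \<and> cyclic_group (Hgrp g\<lparr>carrier := C\<rparr>) \<and> bdry g \<in> A \<and>
        centralizes F z (h ` C) \<and>
        (\<forall>a\<in>A. h' a = h a) \<and> (\<forall>b\<in>B. h' b = z \<otimes>\<^bsub>F\<^esub> h b \<otimes>\<^bsub>F\<^esub> inv\<^bsub>F\<^esub> z))"

definition HNN_twist ::
  "('f, 'm) monoid_scheme \<Rightarrow> nat \<Rightarrow> (sgen word \<Rightarrow> 'f) \<Rightarrow> (sgen word \<Rightarrow> 'f) \<Rightarrow> bool" where
  "HNN_twist F g h h' \<longleftrightarrow>
     (\<exists>A t C C' \<phi> z. is_HNN (Hgrp g) A t C C' \<phi> \<and>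
        cyclic_group (Hgrp g\<lparr>carrier := C\<rparr>) \<and> cyclic_group (Hgrp g\<lparr>carrier := C'\<rparr>) \<and>
        bdry g \<in> A \<and> centralizes F z (h ` C) \<and>
        (\<forall>a\<in>A. h' a = h a) \<and> h' t = z \<otimes>\<^bsub>F\<^esub> h t)"

definition dehn_related ::
  "('f, 'm) monoid_scheme \<Rightarrow> nat \<Rightarrow> 'f \<Rightarrow> (sgen word \<Rightarrow> 'f) \<Rightarrow> (sgen word \<Rightarrow> 'f) \<Rightarrow> bool" where
  "dehn_related F g x h h' \<longleftrightarrow>
     h \<in> genus_reps F g x \<and> h' \<in> genus_reps F g x \<and> (amalgam_twist F g h h' \<or> HNN_twist F g h h')"

definition dehn_equiv ::
  "('f, 'm) monoid_scheme \<Rightarrow> nat \<Rightarrow> 'f \<Rightarrow> ((sgen word \<Rightarrow> 'f) \<times> (sgen word \<Rightarrow> 'f)) set" where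
  "dehn_equiv F g x =
     {(h, h'). h \<in> genus_reps F g x \<and> h' \<in> genus_reps F g x \<and> equivclp (dehn_related F g x) h h'}"


section \<open>Counting genus representations\<close>

definition ecount :: "'a set \<Rightarrow> enat" where
  "ecount S = (if finite S then enat (card S) else \<infinity>)"

definition sim_injective_reps ::
  "('f, 'm) monoid_scheme \<Rightarrow> nat \<Rightarrow> 'f \<Rightarrow> (sgen word \<Rightarrow> 'f) set" where
  "sim_injective_reps F g x =
     {h \<in> genus_reps F g x. \<forall>h'. (h, h') \<in> dehn_equiv F g x \<longrightarrow> inj_on h' (carrier (Hgrp g))}"

definition num :: "('f, 'm) monoid_scheme \<Rightarrow> nat \<Rightarrow> 'f \<Rightarrow> enat" where
  "num F g x = ecount (sim_injective_reps F g x // dehn_equiv F g x)"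

definition fF :: "('f, 'm) monoid_scheme \<Rightarrow> nat \<Rightarrow> enat" where
  "fF F g = (SUP x\<in>carrier F. num F g x)"

definition primitive_subgroup :: "'a set \<Rightarrow> ('a, 'm) monoid_scheme \<Rightarrow> bool" where
  "primitive_subgroup S G \<longleftrightarrow>
     subgroup S G \<and> (\<forall>t\<in>carrier G. \<forall>n::nat. n \<ge> 1 \<and> t [^]\<^bsub>G\<^esub> n \<in> S \<longrightarrow> t \<in> S)"

definition admissible_reps ::
  "('f, 'm) monoid_scheme \<Rightarrow> nat \<Rightarrow> 'f \<Rightarrow> (sgen word \<Rightarrow> 'f) set" where
  "admissible_reps F g x =
     {h \<in> genus_reps F g x. inj_on h (carrier (Hgrp g)) \<and>
        primitive_subgroup (h ` carrier (Hgrp g)) F}"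

definition num' :: "('f, 'm) monoid_scheme \<Rightarrow> nat \<Rightarrow> 'f \<Rightarrow> enat" where
  "num' F g x = ecount ((\<lambda>h. h ` carrier (Hgrp g)) ` admissible_reps F g x)"

definition fF' :: "('f, 'm) monoid_scheme \<Rightarrow> nat \<Rightarrow> enat" where
  "fF' F g = (SUP x\<in>carrier F. num' F g x)"


section \<open>Solid bounds\<close>

text \<open>
  A quotient is a pair (L, q).  Fixing the element type of L to sets of words loses no generality,
  since the quotient of Hgrp g by the kernel of q is a group on this type.
\<close>

type_synonym squot = "sgen word set monoid \<times> (sgen word \<Rightarrow> sgen word set)"

definition proper_quotient :: "nat \<Rightarrow> squot \<Rightarrow> bool" where
  "proper_quotient g Q \<longleftrightarrow>
     group (fst Q) \<and> snd Q \<in> epi (Hgrp g) (fst Q) \<and> \<not> inj_on (snd Q) (carrier (Hgrp g))"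

definition factors_through ::
  "('f, 'm) monoid_scheme \<Rightarrow> nat \<Rightarrow> (sgen word \<Rightarrow> 'f) \<Rightarrow> squot \<Rightarrow> bool" where
  "factors_through F g h Q \<longleftrightarrow>
     (\<exists>k\<in>hom (fst Q) F. \<forall>w\<in>carrier (Hgrp g). h w = k (snd Q w))"

definition extensions ::
  "('f, 'm) monoid_scheme \<Rightarrow> nat \<Rightarrow> (sgen word \<Rightarrow> 'f) \<Rightarrow> (sgen word \<Rightarrow> 'f) set" where
  "extensions F g p = {h \<in> ext_hom (Hgrp g) F. \<forall>w\<in>Pgrp g. h w = p w}"

definition solid_bound :: "('f, 'm) monoid_scheme \<Rightarrow> nat \<Rightarrow> nat \<Rightarrow> bool" where
  "solid_bound F g N \<longleftrightarrow>
     (\<exists>\<Q> :: squot set. finite \<Q> \<and> (\<forall>Q\<in>\<Q>. proper_quotient g Q) \<and>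
        (\<forall>p\<in>hom (Hgrp g\<lparr>carrier := Pgrp g\<rparr>) F.
           ecount ({h \<in> extensions F g p.
                      \<forall>h'. (h, h') \<in> dehn_equiv F g (p (bdry g)) \<longrightarrow>
                        (\<forall>Q\<in>\<Q>. \<not> factors_through F g h' Q)}
                   // dehn_equiv F g (p (bdry g))) \<le> enat N))"

end

theory Submission
  imports Defs
begin

text \<open>
  A \<open>\<sim>\<close>-injective representation is never equivalent to one that factors through a proper quotient,
  which gives the first inequality.  For the second, let \<open>h\<close> be admissible.  The boundary word lies
  in no proper free factor of \<open>H\<^sub>g\<close>, so a splitting over the trivial group allows no nontrivial
  twist.  If the edge group is nontrivial, the twisting element \<open>z\<close> commutes with a nontrivial
  \<open>h(c)\<close>, hence has a power in \<open>\<langle>h(c)\<rangle>\<close>, so \<open>z = h(y)\<close> by primitivity, and the twist is precomposition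
  with an automorphism of \<open>H\<^sub>g\<close>: it changes neither the image nor the injectivity.

  For the third inequality, put \<open>c = y\<^sup>-\<^sup>1 x y\<^sup>2\<close> in \<open>F(x, y)\<close>.  Then \<open>[x, c x y\<^sup>-\<^sup>1] = [x c y, c]\<close>, and
  the involution \<open>x \<mapsto> c\<close>, \<open>y \<mapsto> y\<^sup>-\<^sup>1\<close> exchanges the subgroups generated by the two pairs; they
  differ since only the first one lies in the normal closure of \<open>x\<close>.  Choosing one of the two pairs in
  each of \<open>g\<close> free factors \<open>F(x\<^sub>i, y\<^sub>i)\<close> gives \<open>2\<^sup>g\<close> subgroups of \<open>F\<^sub>2\<^sub>g\<close> with the same product of
  commutators.  Up to these involutions they are all the same subgroup, a free factor of the normal
  closure of the \<open>x\<^sub>i\<close>, so they are primitive; and \<open>F\<^sub>2\<^sub>g\<close> is in turn a primitive subgroup of \<open>F\<close>.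
\<close>

section \<open>Homomorphisms out of free groups\<close>

text \<open>The identity of the two commutators reduces to [x, y^-1] = [y, c], which says that c
  conjugates y^-1 to y^-1 (x y^-1 x^-1) y. All elements c = y^-1 x y^k satisfy it, and each of them
  gives an involution; k = 2 is the value for which c x y^-1 has exponent sum 0 in y, so that the
  first pair lies in the normal closure of x. In the twisting argument the obstacle is that the
  element y with z = h(y) need not lie in the edge group: only a power of it does. The twists by y
  and y^-1 are mutually inverse because they fix y, and they fix y because roots in free groups are
  unique. Unique roots also make every retract of a free group primitive. They come from the Magnus
  action on noncommutative power series, which moreover gives a nonzero additive map on every
  nontrivial subgroup of a free group, finitely generated or not. Such a map on a complementary free
  factor is what shows that the boundary word lies in no proper free factor.\<close>

lemma carrier_free_group: "w \<in> carrier (free_group S) \<longleftrightarrow> fst ` set w \<subseteq> S \<and> reduced w"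
  by (simp add: free_group_def)

lemma mult_free_group: "u \<otimes>\<^bsub>free_group S\<^esub> v = foldr push u v"
  by (simp add: free_group_def)

lemma one_free_group: "\<one>\<^bsub>free_group S\<^esub> = []"
  by (simp add: free_group_def)

lemma free_gen_closed: "x \<in> S \<Longrightarrow> free_gen x \<in> carrier (free_group S)"
  by (simp add: carrier_free_group free_gen_def reduced_def)

lemma singleton_free_group_closed: "fst p \<in> S \<Longrightarrow> [p] \<in> carrier (free_group S)"
  by (simp add: carrier_free_group reduced_def)

lemma Cons_free_group_closedD:
  assumes "p # w \<in> carrier (free_group S)"
  shows "fst p \<in> S" and "w \<in> carrier (free_group S)"
    and "p # w = [p] \<otimes>\<^bsub>free_group S\<^esub> w"
  using assms by (auto simp: carrier_free_group mult_free_group push_reduced_Cons dest: reduced_ConsD)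

lemma inv_free_gen:
  assumes "x \<in> S"
  shows "inv\<^bsub>free_group S\<^esub> (free_gen x) = [(x, False)]"
proof -
  interpret group "free_group S" by (rule group_free_group)
  show ?thesis
    by (rule inv_equality)
      (use assms in \<open>auto simp: mult_free_group one_free_group free_gen_def
         intro!: singleton_free_group_closed\<close>)
qed

lemma free_group_hom_eqI:
  assumes "group K" and "h \<in> hom (free_group S) K" and "k \<in> hom (free_group S) K"
    and gen: "\<And>x. x \<in> S \<Longrightarrow> h (free_gen x) = k (free_gen x)"
    and "w \<in> carrier (free_group S)"
  shows "h w = k w"
proof -
  interpret F: group "free_group S" by (rule group_free_group)
  interpret h: group_hom "free_group S" K h
    using assms by (simp add: group_hom_def group_hom_axioms_def group_free_group)
  interpret k: group_hom "free_group S" K k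
    using assms by (simp add: group_hom_def group_hom_axioms_def group_free_group)
  have lett: "h [(x, s)] = k [(x, s)]" if "x \<in> S" for x s
  proof (cases s)
    case True
    then show ?thesis using gen[OF that] by (simp add: free_gen_def)
  next
    case False
    then show ?thesis
      using gen[OF that] h.hom_inv[OF free_gen_closed[OF that]] k.hom_inv[OF free_gen_closed[OF that]]
      by (simp add: inv_free_gen[OF that])
  qed
  show ?thesis using \<open>w \<in> carrier (free_group S)\<close>
  proof (induction w)
    case Nil
    then show ?case using h.hom_one k.hom_one by (simp add: one_free_group)
  next
    case (Cons p w)
    note C = Cons_free_group_closedD[OF Cons.prems]
    have "h ([p] \<otimes>\<^bsub>free_group S\<^esub> w) = k ([p] \<otimes>\<^bsub>free_group S\<^esub> w)"
      using C(1,2) lett[of "fst p" "snd p"] Cons.IH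
      by (simp add: singleton_free_group_closed)
    then show ?case using C(3) by simp
  qed
qed

definition free_ext :: "('b, 'm) monoid_scheme \<Rightarrow> ('x \<Rightarrow> 'b) \<Rightarrow> 'x word \<Rightarrow> 'b" where
  "free_ext K f w =
     foldr (\<lambda>p a. (if snd p then f (fst p) else inv\<^bsub>K\<^esub> (f (fst p))) \<otimes>\<^bsub>K\<^esub> a) w \<one>\<^bsub>K\<^esub>"

context group
begin

lemma free_ext_closed:
  "f \<in> S \<rightarrow> carrier G \<Longrightarrow> fst ` set w \<subseteq> S \<Longrightarrow> free_ext G f w \<in> carrier G"
  by (induction w) (auto simp: free_ext_def)

text \<open>A letter that cancels against the head of \<open>w\<close> contributes a value times its
  inverse, so evaluation does not see free reduction.\<close>

lemma free_ext_push:
  assumes "f \<in> S \<rightarrow> carrier G" "fst ` set w \<subseteq> S" "fst p \<in> S"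
  shows "free_ext G f (push p w) = free_ext G f (p # w)"
proof (cases w)
  case Nil
  then show ?thesis by simp
next
  case (Cons q v)
  have "f (fst q) \<in> carrier G" "free_ext G f v \<in> carrier G"
    using assms Cons free_ext_closed[OF assms(1), of v] by auto
  then show ?thesis
    using Cons by (auto simp: free_ext_def m_assoc[symmetric])
qed

lemma free_ext_mult:
  assumes "f \<in> S \<rightarrow> carrier G" "fst ` set u \<subseteq> S" "fst ` set v \<subseteq> S"
  shows "free_ext G f (foldr push u v) = free_ext G f u \<otimes> free_ext G f v"
  using assms(2)
proof (induction u)
  case Nil
  then show ?case using free_ext_closed[OF assms(1,3)] by (simp add: free_ext_def)
next
  case (Cons p u)
  have c: "f (fst p) \<in> carrier G" "free_ext G f u \<in> carrier G" "free_ext G f v \<in> carrier G"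
    using assms Cons free_ext_closed[OF assms(1)] by auto
  have "fst ` set (foldr push u v) \<subseteq> S"
    using set_foldr_push[of u v] Cons.prems assms(3) by fastforce
  then have "free_ext G f (foldr push (p # u) v) = free_ext G f (p # foldr push u v)"
    using free_ext_push[OF assms(1), of "foldr push u v" p] Cons.prems by simp
  with Cons c show ?case
    by (auto simp: free_ext_def m_assoc)
qed

lemma free_ext_hom:
  "f \<in> S \<rightarrow> carrier G \<Longrightarrow> free_ext G f \<in> hom (free_group S) G"
  by (intro homI)
    (auto simp: free_ext_closed free_ext_mult carrier_free_group mult_free_group)

lemma free_ext_free_gen: "f x \<in> carrier G \<Longrightarrow> free_ext G f (free_gen x) = f x"
  by (simp add: free_ext_def free_gen_def)

end

section \<open>The Magnus representation\<close>

text \<open>A function on lists is a power series with integer coefficients in noncommuting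
  variables, given by its coefficients at the monomials. A positive letter acts as left
  multiplication by 1 + X, with X its variable; for a negative letter the result g is the solution
  of (1 + X) g = f, computed from shorter monomials. With an action in place of an expansion,
  products of series do not have to be defined.\<close>

fun magnus_letter :: "'x \<times> bool \<Rightarrow> ('x list \<Rightarrow> int) \<Rightarrow> 'x list \<Rightarrow> int" where
  "magnus_letter p f [] = f []"
| "magnus_letter p f (y # m) =
     (if y \<noteq> fst p then f (y # m)
      else if snd p then f (y # m) + f m
      else f (y # m) - magnus_letter p f m)"

definition magnus :: "'x word \<Rightarrow> ('x list \<Rightarrow> int) \<Rightarrow> 'x list \<Rightarrow> int" where
  "magnus w = foldr magnus_letter w"

lemma magnus_Nil [simp]: "magnus [] f = f"
  and magnus_Cons: "magnus (p # w) f = magnus_letter p (magnus w f)"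
  by (simp_all add: magnus_def)

lemma magnus_append: "magnus (u @ v) f = magnus u (magnus v f)"
  by (simp add: magnus_def)

lemma magnus_letter_inverse: "magnus_letter (x, s) (magnus_letter (x, \<not> s) f) = f"
proof
  fix m show "magnus_letter (x, s) (magnus_letter (x, \<not> s) f) m = f m"
    by (induction m) auto
qed

lemma magnus_push: "magnus (push p w) f = magnus_letter p (magnus w f)"
proof (cases w)
  case (Cons q v)
  then show ?thesis
    using magnus_letter_inverse[of "fst p" "snd p" "magnus v f"]
    by (cases p; cases q) (auto simp: magnus_Cons)
qed (simp add: magnus_Cons)

lemma magnus_foldr_push: "magnus (foldr push u v) f = magnus u (magnus v f)"
  by (induction u) (simp_all add: magnus_push magnus_Cons)

lemma magnus_letter_diff:
  "magnus_letter p (\<lambda>m. f m - g m) m = magnus_letter p f m - magnus_letter p g m"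
  by (induction m) auto

lemma magnus_diff: "magnus w (\<lambda>m. f m - g m) = (\<lambda>m. magnus w f m - magnus w g m)"
  by (induction w) (auto simp: magnus_Cons magnus_letter_diff)

section \<open>Filtration of the power series by order\<close>

definition order_ge :: "nat \<Rightarrow> ('x list \<Rightarrow> int) \<Rightarrow> bool" where
  "order_ge k f \<longleftrightarrow> (\<forall>m. length m < k \<longrightarrow> f m = 0)"

lemma order_ge_letter: "order_ge k f \<Longrightarrow> order_ge k (magnus_letter p f)"
  unfolding order_ge_def
proof (intro allI)
  fix m assume "\<forall>m. length m < k \<longrightarrow> f m = 0"
  then show "length m < k \<longrightarrow> magnus_letter p f m = 0"
    by (induction m) auto
qed

lemma order_ge_magnus: "order_ge k f \<Longrightarrow> order_ge k (magnus w f)"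
  by (induction w) (auto simp: magnus_Cons order_ge_letter)

lemma order_ge_letter_diff:
  assumes "order_ge k f"
  shows "order_ge (Suc k) (\<lambda>m. magnus_letter p f m - f m)"
  unfolding order_ge_def
proof (intro allI)
  fix m :: "'a list"
  show "length m < Suc k \<longrightarrow> magnus_letter p f m - f m = 0"
    using assms order_ge_letter[OF assms, of p] by (cases m) (auto simp: order_ge_def)
qed

text \<open>Each letter acts as 1 plus terms of positive degree, so the group acts trivially on the
  successive quotients of the filtration. Unique roots and additive maps both rest on this
  unipotence.\<close>

lemma order_ge_magnus_diff:
  assumes "order_ge k f"
  shows "order_ge (Suc k) (\<lambda>m. magnus w f m - f m)"
proof (induction w)
  case (Cons p w)
  then show ?case
    using order_ge_letter_diff[OF order_ge_magnus[OF assms, of w], of p]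
    by (simp add: magnus_Cons order_ge_def)
qed (simp add: order_ge_def)

section \<open>Coefficients at monomials without equal neighbours\<close>

lemma magnus_letter_distinct_adj:
  assumes "distinct_adj (y # m)"
  shows "magnus_letter (x, s) f (y # m) =
    f (y # m) + (if y = x then (if s then f m else - f m) else 0)"
  using assms by (cases m) auto

text \<open>Only the constant and the linear term of (1 + X)^k or (1 + X)^-k can contribute: a
  higher power of X would put two equal letters next to each other in the monomial.\<close>

lemma magnus_replicate:
  assumes "distinct_adj (y # m)"
  shows "magnus (replicate k (x, s)) f (y # m) =
    f (y # m) + (if y = x then (if s then int k else - int k) * f m else 0)"
proof (induction k)
  case (Suc k)
  have *: "magnus (replicate k (x, s)) f m = f m" if "y = x" for k
  proof (induction k)
    case (Suc k)
    then show ?case using that assms by (cases m) (auto simp: magnus_Cons)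
  qed simp
  show ?case
    unfolding replicate_Suc magnus_Cons magnus_letter_distinct_adj[OF assms] Suc
    using * by (auto simp: algebra_simps)
qed simp

definition unit_series :: "'x list \<Rightarrow> int" where
  "unit_series m = (if m = [] then 1 else 0)"

lemma reduced_syllable:
  assumes "reduced (p # w)"
  obtains k v where "p # w = replicate (Suc k) p @ v" "reduced v" "v = [] \<or> fst (hd v) \<noteq> fst p"
  using assms
proof (induction w arbitrary: thesis)
  case Nil
  show ?case by (rule Nil(1)[of 0 "[]"]) auto
next
  case (Cons q w)
  show ?case
  proof (cases "fst q = fst p")
    case False
    then show ?thesis using Cons(2)[of 0 "q # w"] Cons(3) by (auto dest: reduced_ConsD)
  next
    case True
    then have "q = p" using Cons(3) by (auto simp: reduced_def prod_eq_iff)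
    moreover obtain k v where "p # w = replicate (Suc k) p @ v" "reduced v"
        "v = [] \<or> fst (hd v) \<noteq> fst p"
      using Cons(1) Cons(3) \<open>q = p\<close> by (blast dest: reduced_ConsD)
    ultimately show ?thesis using Cons(2)[of "Suc k" v] by auto
  qed
qed

text \<open>
  The monomial is the word with its syllables stripped of their exponents; the coefficient there
  is the product of the exponents.
\<close>
lemma magnus_coeff_nonzero:
  assumes "reduced w"
  shows "\<exists>m. distinct_adj m \<and> magnus w unit_series m \<noteq> 0 \<and>
    (\<forall>n. distinct_adj n \<and> length m < length n \<longrightarrow> magnus w unit_series n = 0) \<and>
    (w = [] \<longleftrightarrow> m = []) \<and> (w \<noteq> [] \<longrightarrow> hd m = fst (hd w))"
  using assms
proof (induction "length w" arbitrary: w rule: less_induct)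
  case less
  show ?case
  proof (cases w)
    case Nil
    then show ?thesis by (auto simp: unit_series_def intro!: exI[of _ "[]"])
  next
    case (Cons p w')
    obtain k v where w: "w = replicate (Suc k) p @ v" and v: "reduced v"
        "v = [] \<or> fst (hd v) \<noteq> fst p"
      using less.prems Cons reduced_syllable by metis
    have "length v < length w" using w by simp
    from less.hyps[OF this v(1)] obtain m where m: "distinct_adj m"
        "magnus v unit_series m \<noteq> 0"
        "\<And>n. distinct_adj n \<Longrightarrow> length m < length n \<Longrightarrow> magnus v unit_series n = 0"
        "v = [] \<longleftrightarrow> m = []" "v \<noteq> [] \<Longrightarrow> hd m = fst (hd v)"
      by blast
    obtain x s where p: "p = (x, s)" by (cases p)
    let ?m = "x # m"
    \<comment> \<open>The clause on \<open>hd m\<close> in the induction serves here: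
      \<open>m\<close> begins with the generator of the first syllable of \<open>v\<close>, which
      differs from \<open>x\<close>.\<close>
    have d: "distinct_adj ?m"
      using m(1,4,5) v(2) p by (cases m) auto
    have eq: "magnus w unit_series (y # n) = magnus v unit_series (y # n) +
        (if y = x then (if s then int (Suc k) else - int (Suc k)) * magnus v unit_series n else 0)"
      if "distinct_adj (y # n)" for y n
      unfolding w p magnus_append by (rule magnus_replicate[OF that])
    \<comment> \<open>The coefficient of \<open>v\<close> at \<open>x # m\<close> vanishes because
      this monomial is longer than \<open>m\<close>; the exponent times the coefficient at
      \<open>m\<close> is left.\<close>
    have "magnus w unit_series ?m \<noteq> 0"
      using eq[OF d] m(2) m(3)[OF d] by auto
    moreover have "magnus w unit_series n = 0" if n: "distinct_adj n" "length ?m < length n" for n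
    proof (cases n)
      case (Cons y n')
      then have "distinct_adj n'" using n by (cases n') auto
      then show ?thesis using eq[of y n'] m(3)[of n] m(3)[of n'] n Cons by auto
    qed (use n in auto)
    ultimately show ?thesis
      using d w p by (intro exI[of _ ?m]) (auto simp del: replicate_Suc simp: replicate_Suc hd_append)
  qed
qed

lemma magnus_faithful:
  assumes "reduced w" "magnus w unit_series = unit_series"
  shows "w = []"
  using magnus_coeff_nonzero[OF assms(1)] assms(2) by (auto simp: unit_series_def split: if_splits)

lemma magnus_inj:
  assumes "a \<in> carrier (free_group S)" "b \<in> carrier (free_group S)"
    "magnus a = magnus b"
  shows "a = b"
proof -
  interpret group "free_group S" by (rule group_free_group)
  let ?c = "inv\<^bsub>free_group S\<^esub> a \<otimes>\<^bsub>free_group S\<^esub> b"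
  have "magnus ?c f = magnus (inv\<^bsub>free_group S\<^esub> a) (magnus b f)" for f
    by (simp add: mult_free_group magnus_foldr_push)
  also have "\<dots> f = magnus (inv\<^bsub>free_group S\<^esub> a \<otimes>\<^bsub>free_group S\<^esub> a) f" for f
    by (simp add: mult_free_group magnus_foldr_push assms(3))
  finally have "magnus ?c f = f" for f using assms by (simp add: one_free_group)
  moreover have "?c \<in> carrier (free_group S)" using assms by simp
  ultimately have "?c = \<one>\<^bsub>free_group S\<^esub>"
    using magnus_faithful[of ?c] by (simp add: carrier_free_group one_free_group)
  then show ?thesis using assms by (metis inv_equality inv_inv inv_closed)
qed

section \<open>Operators raising the order: unique roots and additive maps\<close>

definition raises_order :: "nat \<Rightarrow> (('x list \<Rightarrow> int) \<Rightarrow> 'x list \<Rightarrow> int) \<Rightarrow> bool" where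
  "raises_order d D \<longleftrightarrow> (\<forall>k f. order_ge k f \<longrightarrow> order_ge (k + d) (D f))"

text \<open>Every monomial has finite length, hence lies below the order that \<open>D f\<close>
  reaches for large \<open>d\<close>.\<close>

lemma raises_all_orders:
  assumes "\<And>d. raises_order d D"
  shows "D f m = 0"
proof -
  have "order_ge 0 f" by (simp add: order_ge_def)
  then have "order_ge (Suc (length m)) (D f)"
    using assms[of "Suc (length m)"] unfolding raises_order_def by fastforce
  then show ?thesis by (simp add: order_ge_def)
qed

lemma magnus_nat_pow: "magnus (a [^]\<^bsub>free_group S\<^esub> (n::nat)) f = (magnus a ^^ n) f"
proof (induction n arbitrary: f)
  case 0
  then show ?case by (simp add: one_free_group)
next
  case (Suc n)
  have "magnus (a [^]\<^bsub>free_group S\<^esub> Suc n) f = (magnus a ^^ n) (magnus a f)"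
    by (simp add: mult_free_group magnus_foldr_push Suc)
  then show ?case by (simp only: funpow_Suc_right o_apply)
qed

text \<open>
  If \<open>a\<close> and \<open>b\<close> act by \<open>T\<close> and \<open>U\<close> and \<open>T - U\<close> raises orders by \<open>d\<close>, then
  \<open>T\<^sup>n - U\<^sup>n\<close> agrees with \<open>n (T - U)\<close> up to terms of higher order.
\<close>
lemma free_group_unique_roots:
  assumes a: "a \<in> carrier (free_group S)" and b: "b \<in> carrier (free_group S)"
    and n: "n \<ge> 1" and pow: "a [^]\<^bsub>free_group S\<^esub> (n::nat) = b [^]\<^bsub>free_group S\<^esub> n"
  shows "a = b"
proof -
  define D where "D = (\<lambda>f m. magnus a f m - magnus b f m)"
  have "raises_order d D" for d
  proof (induction d)
    case 0
    have "order_ge k (D f)" if "order_ge k f" for k f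
      using order_ge_magnus[OF that, of a] order_ge_magnus[OF that, of b]
      by (simp add: D_def order_ge_def)
    then show ?case by (simp add: raises_order_def)
  next
    case (Suc d)
    show ?case
      unfolding raises_order_def
    proof (intro allI impI)
      fix k f assume f: "order_ge k (f :: 'a list \<Rightarrow> int)"
      have ob: "order_ge (k + j') ((magnus b ^^ j) g)" if "order_ge (k + j') g" for j j' g
        using that by (induction j) (auto simp: order_ge_magnus)
      have "order_ge (Suc (k + d)) (\<lambda>m. (magnus a ^^ j) f m - (magnus b ^^ j) f m - int j * D f m)" for j
      proof (induction j)
        case 0
        then show ?case by (simp add: order_ge_def)
      next
        case (Suc j)
        define A B where "A = (magnus a ^^ j) f" and "B = (magnus b ^^ j) f"
        have AB: "order_ge (k + d) (\<lambda>m. A m - B m)"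
        proof -
          have "order_ge (k + d) (D f)"
            using \<open>raises_order d D\<close> f by (simp add: raises_order_def)
          then show ?thesis
            using Suc by (auto simp: order_ge_def A_def B_def less_Suc_eq)
        qed
        have 1: "order_ge (Suc (k + d)) (\<lambda>m. magnus a (\<lambda>m. A m - B m) m - (A m - B m))"
          by (rule order_ge_magnus_diff[OF AB])
        have Bf: "order_ge (Suc k) (\<lambda>m. B m - f m)"
          unfolding B_def
        proof (induction j)
          case (Suc j)
          have "order_ge k ((magnus b ^^ j) f)" using ob[of 0 f j] f by simp
          from order_ge_magnus_diff[OF this, of b] Suc show ?case by (simp add: order_ge_def)
        qed (simp add: order_ge_def)
        have 2: "order_ge (Suc k + d) (D (\<lambda>m. B m - f m))"
          using \<open>raises_order d D\<close> Bf unfolding raises_order_def by blast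
        \<comment> \<open>With T the action of \<open>a\<close>, the difference of the next powers
          is T (A - B) + D B. Up to higher order, T does not change A - B, and D B equals D f
          because B - f has order above \<open>k\<close>.\<close>
        have "magnus a A m - magnus b B m - int (Suc j) * D f m =
           (magnus a (\<lambda>m. A m - B m) m - (A m - B m)) + D (\<lambda>m. B m - f m) m
             + (A m - B m - int j * D f m)" for m
          by (simp add: D_def magnus_diff algebra_simps)
        then show ?case
          using 1 2 Suc by (simp add: order_ge_def A_def[symmetric] B_def[symmetric])
      qed
      \<comment> \<open>At \<open>j = n\<close> the two powers agree, so \<open>n\<close> times
        \<open>D f\<close> has the higher order; the coefficients are integers and
        \<open>n \<ge> 1\<close>, so \<open>D f\<close> has it as well.\<close>
      from this[of n] show "order_ge (k + Suc d) (D f)"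
        using n pow magnus_nat_pow[of S a n f] magnus_nat_pow[of S b n f]
        by (simp add: order_ge_def)
    qed
  qed
  then have "magnus a = magnus b"
    using raises_all_orders[of D] by (auto simp: D_def fun_eq_iff)
  then show ?thesis using magnus_inj a b by blast
qed

text \<open>
  Choose \<open>d\<close> maximal such that all elements of \<open>B\<close> agree with \<open>1\<close> in degrees below \<open>d\<close>: products
  in \<open>B\<close> add up in degree \<open>d\<close>, so a nonvanishing coefficient there is the required map.
\<close>
lemma free_group_nonzero_additive:
  assumes B: "B \<subseteq> carrier (free_group S)"
    and mult: "\<And>b c. b \<in> B \<Longrightarrow> c \<in> B \<Longrightarrow> b \<otimes>\<^bsub>free_group S\<^esub> c \<in> B"
    and b0: "b0 \<in> B" "b0 \<noteq> \<one>\<^bsub>free_group S\<^esub>"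
  obtains \<beta> :: "'x word \<Rightarrow> int" and b where
    "\<And>b c. b \<in> B \<Longrightarrow> c \<in> B \<Longrightarrow> \<beta> (b \<otimes>\<^bsub>free_group S\<^esub> c) = \<beta> b + \<beta> c" "b \<in> B" "\<beta> b \<noteq> 0"
proof -
  define D where "D = (\<lambda>b f m. magnus b f m - f (m :: 'x list))"
  define P where "P = (\<lambda>d. \<forall>b\<in>B. raises_order d (D b))"
  have P1: "P (Suc 0)"
    using order_ge_magnus_diff unfolding P_def D_def raises_order_def by fastforce
  have P0: "P 0"
    using P1 by (auto simp: P_def raises_order_def order_ge_def)
  \<comment> \<open>Otherwise \<open>b0\<close> would agree with 1 in all degrees and be trivial by
    faithfulness.\<close>
  have "\<exists>d. P (Suc d) \<and> \<not> P (Suc (Suc d))"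
  proof (rule ccontr)
    assume "\<not> ?thesis"
    then have "P (Suc d)" for d by (induction d) (use P1 in auto)
    then have "P d" for d using P0 by (cases d) auto
    then have "raises_order d (D b0)" for d using b0(1) by (simp add: P_def)
    from raises_all_orders[OF this] have "magnus b0 f m = f m" for f m by (simp add: D_def)
    then have "magnus b0 unit_series = unit_series" by blast
    moreover have "reduced b0" using b0(1) B by (auto simp: carrier_free_group)
    ultimately show False using magnus_faithful b0(2) by (auto simp: one_free_group)
  qed
  then obtain d where d: "P (Suc d)" "\<not> P (Suc (Suc d))" by blast
  then obtain b k f where b: "b \<in> B" "order_ge k f" "\<not> order_ge (k + Suc (Suc d)) (D b f)"
    unfolding P_def raises_order_def by blast
  then obtain m where m: "length m < k + Suc (Suc d)" "D b f m \<noteq> 0"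
    by (auto simp: order_ge_def)
  show thesis
  proof (rule that[of "\<lambda>b. D b f m" b])
    fix b c assume bc: "b \<in> B" "c \<in> B"
    \<comment> \<open>As \<open>D b\<close> is the action of \<open>b\<close> minus 1, the operator
      of a product is \<open>D b\<close> plus \<open>D c\<close> plus their composite. The composite
      raises the order by \<open>2 * Suc d\<close>, which is beyond the degree of \<open>m\<close>;
      for this the level counts from 1.\<close>
    have "order_ge (k + Suc d) (D c f)"
      using d(1) bc(2) b(2) by (simp add: P_def raises_order_def)
    then have "order_ge (k + Suc d + Suc d) (D b (D c f))"
      using d(1) bc(1) unfolding P_def raises_order_def by blast
    then have "D b (D c f) m = 0" using m(1) by (simp add: order_ge_def)
    then show "D (b \<otimes>\<^bsub>free_group S\<^esub> c) f m = D b f m + D c f m"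
      by (simp add: D_def mult_free_group magnus_foldr_push magnus_diff)
  qed (use b m in auto)
qed

section \<open>Centralizers in free groups\<close>

definition inv_word :: "'x word \<Rightarrow> 'x word" where
  "inv_word u = rev (map (\<lambda>p. (fst p, \<not> snd p)) u)"

lemma inv_word_Nil [simp]: "inv_word [] = []"
  and inv_word_Cons: "inv_word (p # u) = inv_word u @ [(fst p, \<not> snd p)]"
  and length_inv_word [simp]: "length (inv_word u) = length u"
  by (simp_all add: inv_word_def)

lemma inv_word_append: "inv_word (u @ v) = inv_word v @ inv_word u"
  by (simp add: inv_word_def)

lemma reduced_append: "reduced (u @ v) \<longleftrightarrow> reduced u \<and> reduced v \<and>
    (u = [] \<or> v = [] \<or> hd v \<noteq> (fst (last u), \<not> snd (last u)))"
  by (auto simp: reduced_def successively_append_iff prod_eq_iff)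

lemma foldr_push_append: "reduced (u @ v) \<Longrightarrow> foldr push u v = u @ v"
proof (induction u)
  case (Cons p u)
  then have "reduced (u @ v)" by (auto dest: reduced_ConsD)
  then show ?case using Cons push_reduced_Cons[of p "u @ v"] by simp
qed simp

lemma foldr_push_cancellation:
  assumes "reduced u" "reduced v"
  obtains u' s v' where "u = u' @ s" "v = inv_word s @ v'" "foldr push u v = u' @ v'"
  using assms
proof (induction u arbitrary: thesis)
  case Nil
  show ?case by (rule Nil(1)[of "[]" "[]" v]) auto
next
  case (Cons p u)
  obtain u' s v' where IH: "u = u' @ s" "v = inv_word s @ v'" "foldr push u v = u' @ v'"
    using Cons.IH Cons.prems reduced_ConsD by metis
  show ?case
  proof (cases "u' = [] \<and> v' \<noteq> [] \<and> hd v' = (fst p, \<not> snd p)")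
    case True
    then show ?thesis
      using Cons.prems(1)[of "[]" "p # s" "tl v'"] IH by (cases v') (auto simp: inv_word_Cons)
  next
    case False
    have "push p (u' @ v') = p # u' @ v'"
    proof (cases u')
      case Nil
      then show ?thesis using False by (cases v') (auto simp: prod_eq_iff)
    next
      case (Cons q u'')
      then show ?thesis using Cons.prems(2) IH(1) by (auto simp: reduced_def)
    qed
    then show ?thesis using Cons.prems(1)[of "p # u'" s v'] IH by auto
  qed
qed

text \<open>Equal lengths of the two products mean that equally much cancels in y c and in c y. If
  nothing cancels, c is a prefix of y; if all of c cancels in y c, the product is shorter than y. In
  a partial cancellation the common value begins with the first letter of y and with that of c, so
  these coincide; but the cancellation in c y makes the first letter of y inverse to the last letter
  of c, against cyclic reducedness.\<close>

lemma shorten_commuting_word: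
  assumes y: "reduced y" and c: "reduced c" "c \<noteq> []" "hd c \<noteq> (fst (last c), \<not> snd (last c))"
    and le: "length c \<le> length y" and comm: "foldr push y c = foldr push c y"
  shows "length (foldr push y c) < length y \<or> (\<exists>y'. y = c @ y')"
proof -
  obtain y1 s c1 where 1: "y = y1 @ s" "c = inv_word s @ c1" "foldr push y c = y1 @ c1"
    using foldr_push_cancellation[OF y c(1)] .
  obtain c2 r y2 where 2: "c = c2 @ r" "y = inv_word r @ y2" "foldr push c y = c2 @ y2"
    using foldr_push_cancellation[OF c(1) y] .
  have eq: "y1 @ c1 = c2 @ y2" using 1 2 comm by simp
  have len: "length s = length r"
    using arg_cong[OF eq, of length] arg_cong[OF 1(1), of length] arg_cong[OF 1(2), of length]
      arg_cong[OF 2(1), of length] arg_cong[OF 2(2), of length] by simp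
  consider "s = []" | "s \<noteq> []" "c1 = []" | "s \<noteq> []" "c1 \<noteq> []" by blast
  then show ?thesis
  proof cases
    case 1
    then have "y @ c = c @ y" using \<open>y = y1 @ s\<close> \<open>c = inv_word s @ c1\<close> 2 eq len by simp
    then show ?thesis using le by (auto simp: append_eq_append_conv2)
  next
    case 2
    then show ?thesis using 1 by auto
  next
    case 3
    then have "length s < length c" using 1 by (metis length_inv_word length_append length_greater_0_conv less_add_same_cancel1)
    then have "y1 \<noteq> []" "c2 \<noteq> []" using 1(1) 2(1) le len by auto
    then have "hd y = hd c" using 1(1) 2(1) eq by (metis hd_append2)
    moreover have "r \<noteq> []" using len 3 by auto
    then have "hd y = (fst (last c), \<not> snd (last c))"
      using 2(1,2) by (cases r rule: rev_cases) (auto simp: inv_word_append inv_word_Cons)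
    ultimately show ?thesis using c(3) by simp
  qed
qed

lemma (in group) inv_mult_cancel:
  assumes "a \<in> carrier G" "z \<in> carrier G"
  shows "inv a \<otimes> (a \<otimes> z) = z" and "a \<otimes> (inv a \<otimes> z) = z"
  using assms by (simp_all add: m_assoc[symmetric])

lemma (in group) conj_hom:
  assumes "p \<in> carrier G"
  shows "(\<lambda>a. p \<otimes> a \<otimes> inv p) \<in> hom G G"
  using assms by (auto intro!: homI simp: m_assoc inv_mult_cancel)

lemma (in group) int_pow_conj:
  assumes "p \<in> carrier G" "a \<in> carrier G"
  shows "(p \<otimes> a \<otimes> inv p) [^] (k::int) = p \<otimes> a [^] k \<otimes> inv p"
proof -
  interpret h: group_hom G G "\<lambda>a. p \<otimes> a \<otimes> inv p"
    using conj_hom[OF assms(1)] by unfold_locales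
  show ?thesis using h.hom_int_pow[OF assms(2)] by simp
qed

text \<open>
  Modulo powers of a cyclically reduced \<open>c\<close>, an element of the centralizer of \<open>c\<close> is shorter
  than \<open>c\<close>; hence two powers of it coincide modulo powers of \<open>c\<close>.
\<close>
lemma centralizer_cyclically_reduced:
  assumes S: "finite S" and z: "z \<in> carrier (free_group S)"
    and c: "c \<in> carrier (free_group S)" "c \<noteq> []" "hd c \<noteq> (fst (last c), \<not> snd (last c))"
    and comm: "z \<otimes>\<^bsub>free_group S\<^esub> c = c \<otimes>\<^bsub>free_group S\<^esub> z"
  shows "\<exists>k::nat. k \<ge> 1 \<and> (\<exists>m::int. z [^]\<^bsub>free_group S\<^esub> k = c [^]\<^bsub>free_group S\<^esub> m)"
proof -
  interpret group "free_group S" by (rule group_free_group)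
  have short: "\<exists>m::int. length (y \<otimes>\<^bsub>free_group S\<^esub> c [^]\<^bsub>free_group S\<^esub> m) < length c"
    if "y \<in> carrier (free_group S)" "y \<otimes>\<^bsub>free_group S\<^esub> c = c \<otimes>\<^bsub>free_group S\<^esub> y" for y
    using that
  proof (induction "length y" arbitrary: y rule: less_induct)
    case less
    show ?case
    proof (cases "length y < length c")
      case True
      then show ?thesis using less.prems by (intro exI[of _ 0]) simp
    next
      case False
      have "length (y \<otimes>\<^bsub>free_group S\<^esub> c) < length y \<or> (\<exists>y'. y = c @ y')"
        using shorten_commuting_word[of y c] less.prems c False
        by (simp add: carrier_free_group mult_free_group)
      then show ?thesis
      proof
        assume "length (y \<otimes>\<^bsub>free_group S\<^esub> c) < length y"
        moreover have "(y \<otimes>\<^bsub>free_group S\<^esub> c) \<otimes>\<^bsub>free_group S\<^esub> c = c \<otimes>\<^bsub>free_group S\<^esub> (y \<otimes>\<^bsub>free_group S\<^esub> c)"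
          using less.prems c(1) by (metis m_assoc)
        ultimately obtain m :: int where
          "length (y \<otimes>\<^bsub>free_group S\<^esub> c \<otimes>\<^bsub>free_group S\<^esub> c [^]\<^bsub>free_group S\<^esub> m) < length c"
          using less.hyps[of "y \<otimes>\<^bsub>free_group S\<^esub> c"] less.prems c(1) by blast
        moreover have "y \<otimes>\<^bsub>free_group S\<^esub> c \<otimes>\<^bsub>free_group S\<^esub> c [^]\<^bsub>free_group S\<^esub> m =
            y \<otimes>\<^bsub>free_group S\<^esub> c [^]\<^bsub>free_group S\<^esub> (1 + m)"
          using less.prems(1) c(1) by (simp add: m_assoc int_pow_mult)
        ultimately show ?thesis by metis
      next
        assume "\<exists>y'. y = c @ y'"
        then obtain y' where y': "y = c @ y'" by blast
        have y'c: "y' \<in> carrier (free_group S)"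
          using less.prems(1) y' by (auto simp: carrier_free_group reduced_append)
        have y: "y = c \<otimes>\<^bsub>free_group S\<^esub> y'"
          using less.prems(1) y' by (simp add: carrier_free_group mult_free_group foldr_push_append)
        have "c \<otimes>\<^bsub>free_group S\<^esub> (y' \<otimes>\<^bsub>free_group S\<^esub> c) = c \<otimes>\<^bsub>free_group S\<^esub> (c \<otimes>\<^bsub>free_group S\<^esub> y')"
          using less.prems(2) c(1) y'c unfolding y by (simp add: m_assoc)
        then have comm': "y' \<otimes>\<^bsub>free_group S\<^esub> c = c \<otimes>\<^bsub>free_group S\<^esub> y'"
          using c(1) y'c by simp
        moreover have "length y' < length y" using y' c(2) by simp
        ultimately obtain m :: int where
          m: "length (y' \<otimes>\<^bsub>free_group S\<^esub> c [^]\<^bsub>free_group S\<^esub> m) < length c"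
          using less.hyps y'c by blast
        \<comment> \<open>Since y = c y' and c commutes with y', lowering the exponent by one
          absorbs the factor c.\<close>
        have "y \<otimes>\<^bsub>free_group S\<^esub> c [^]\<^bsub>free_group S\<^esub> (- 1 + m) =
            y' \<otimes>\<^bsub>free_group S\<^esub> (c \<otimes>\<^bsub>free_group S\<^esub> c [^]\<^bsub>free_group S\<^esub> (- 1 + m))"
          using c(1) y'c comm' unfolding y by (metis m_assoc int_pow_closed)
        also have "c \<otimes>\<^bsub>free_group S\<^esub> c [^]\<^bsub>free_group S\<^esub> (- 1 + m) = c [^]\<^bsub>free_group S\<^esub> m"
          using c(1) int_pow_mult[of c 1 "- 1 + m"] by simp
        finally show ?thesis using m by metis
      qed
    qed
  qed
  let ?E = "{w. set w \<subseteq> S \<times> (UNIV :: bool set) \<and> length w \<le> length c}"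
  have zk: "z [^]\<^bsub>free_group S\<^esub> k \<otimes>\<^bsub>free_group S\<^esub> c = c \<otimes>\<^bsub>free_group S\<^esub> z [^]\<^bsub>free_group S\<^esub> k" for k :: nat
    using group_commutes_pow[OF comm z c(1)] .
  have "\<forall>k::nat. \<exists>m::int. length (z [^]\<^bsub>free_group S\<^esub> k \<otimes>\<^bsub>free_group S\<^esub> c [^]\<^bsub>free_group S\<^esub> m) < length c"
    using short zk z by simp
  then obtain m :: "nat \<Rightarrow> int" where
    m: "\<And>k. length (z [^]\<^bsub>free_group S\<^esub> k \<otimes>\<^bsub>free_group S\<^esub> c [^]\<^bsub>free_group S\<^esub> m k) < length c"
    by metis
  let ?f = "\<lambda>k. z [^]\<^bsub>free_group S\<^esub> k \<otimes>\<^bsub>free_group S\<^esub> c [^]\<^bsub>free_group S\<^esub> m k"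
  have fc: "?f k \<in> carrier (free_group S)" for k using z c(1) by simp
  have "range ?f \<subseteq> ?E"
  proof
    fix w assume "w \<in> range ?f"
    then obtain k where "w = ?f k" by blast
    then have "fst ` set w \<subseteq> S" "length w \<le> length c"
      using fc[of k] m[of k] by (auto simp: carrier_free_group)
    then show "w \<in> ?E" by force
  qed
  moreover have "finite ?E" using S by (intro finite_lists_length_le finite_cartesian_product) auto
  ultimately have "\<not> inj ?f" using finite_imageD finite_subset infinite_UNIV_nat by blast
  then obtain i j where ij: "i < j" "?f i = ?f j"
    unfolding inj_on_def by (metis linorder_neqE_nat)
  define k where "k = j - i"
  have j: "j = i + k" "k \<ge> 1" using ij by (auto simp: k_def)
  have "z [^]\<^bsub>free_group S\<^esub> i \<otimes>\<^bsub>free_group S\<^esub> c [^]\<^bsub>free_group S\<^esub> m i =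
     z [^]\<^bsub>free_group S\<^esub> i \<otimes>\<^bsub>free_group S\<^esub> (z [^]\<^bsub>free_group S\<^esub> k \<otimes>\<^bsub>free_group S\<^esub> c [^]\<^bsub>free_group S\<^esub> m j)"
    using ij(2) z c(1) unfolding j(1) by (simp add: nat_pow_mult[symmetric] m_assoc)
  then have "c [^]\<^bsub>free_group S\<^esub> m i = z [^]\<^bsub>free_group S\<^esub> k \<otimes>\<^bsub>free_group S\<^esub> c [^]\<^bsub>free_group S\<^esub> m j"
    using z c(1) by simp
  then have "z [^]\<^bsub>free_group S\<^esub> k = c [^]\<^bsub>free_group S\<^esub> m i \<otimes>\<^bsub>free_group S\<^esub> inv\<^bsub>free_group S\<^esub> (c [^]\<^bsub>free_group S\<^esub> m j)"
    using z c(1) by (metis inv_solve_right int_pow_closed nat_pow_closed)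
  also have "\<dots> = c [^]\<^bsub>free_group S\<^esub> (m i - m j)"
    using c(1) by (simp add: int_pow_diff)
  finally show ?thesis using j(2) by blast
qed

text \<open>A word that is not cyclically reduced becomes shorter by two when conjugated by its
  first letter, and the claim is invariant under conjugating both elements. It is only about a
  common power; the root is extracted later by primitivity.\<close>

lemma free_group_centralizer:
  assumes S: "finite S" and "z \<in> carrier (free_group S)" "u \<in> carrier (free_group S)"
    and "u \<noteq> \<one>\<^bsub>free_group S\<^esub>" "z \<otimes>\<^bsub>free_group S\<^esub> u = u \<otimes>\<^bsub>free_group S\<^esub> z"
  shows "\<exists>k::nat. k \<ge> 1 \<and> (\<exists>m::int. z [^]\<^bsub>free_group S\<^esub> k = u [^]\<^bsub>free_group S\<^esub> m)"
  using assms(2-)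
proof (induction "length u" arbitrary: u z rule: less_induct)
  case less
  interpret group "free_group S" by (rule group_free_group)
  have ne: "u \<noteq> []" using less.prems by (simp add: one_free_group)
  show ?case
  proof (cases "hd u = (fst (last u), \<not> snd (last u))")
    case False
    then show ?thesis using centralizer_cyclically_reduced[OF S] less.prems ne by blast
  next
    case True
    obtain q u1 where u1: "u = u1 @ [q]" using ne by (cases u rule: rev_cases) auto
    with True obtain v where v: "u1 = (fst q, \<not> snd q) # v"
      by (cases u1) (auto simp: prod_eq_iff)
    let ?p = "(fst q, \<not> snd q)"
    have u: "u = [?p] @ v @ [q]" using u1 v by simp
    have cl: "[?p] \<in> carrier (free_group S)" "v \<in> carrier (free_group S)" "[q] \<in> carrier (free_group S)"
      using less.prems(2) unfolding u carrier_free_group reduced_append by auto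
    have invp: "inv\<^bsub>free_group S\<^esub> [?p] = [q]"
      using cl by (intro inv_equality) (auto simp: mult_free_group one_free_group)
    have red: "reduced ([?p] @ v @ [q])" using less.prems(2) u by (simp add: carrier_free_group)
    have "v \<otimes>\<^bsub>free_group S\<^esub> [q] = v @ [q]"
      using reduced_ConsD[of ?p "v @ [q]"] red by (subst mult_free_group, intro foldr_push_append) simp
    moreover have "[?p] \<otimes>\<^bsub>free_group S\<^esub> (v @ [q]) = [?p] @ v @ [q]"
      by (subst mult_free_group, intro foldr_push_append red)
    ultimately have uc: "u = [?p] \<otimes>\<^bsub>free_group S\<^esub> v \<otimes>\<^bsub>free_group S\<^esub> inv\<^bsub>free_group S\<^esub> [?p]"
      using cl u invp by (simp add: m_assoc)
    define y where "y = inv\<^bsub>free_group S\<^esub> [?p] \<otimes>\<^bsub>free_group S\<^esub> z \<otimes>\<^bsub>free_group S\<^esub> [?p]"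
    have yc: "y \<in> carrier (free_group S)" using less.prems cl by (simp add: y_def)
    have zc: "z = [?p] \<otimes>\<^bsub>free_group S\<^esub> y \<otimes>\<^bsub>free_group S\<^esub> inv\<^bsub>free_group S\<^esub> [?p]"
      using less.prems(1) cl(1) unfolding y_def by (simp add: m_assoc inv_mult_cancel)
    have conj: "([?p] \<otimes>\<^bsub>free_group S\<^esub> a \<otimes>\<^bsub>free_group S\<^esub> inv\<^bsub>free_group S\<^esub> [?p]) \<otimes>\<^bsub>free_group S\<^esub>
         ([?p] \<otimes>\<^bsub>free_group S\<^esub> b \<otimes>\<^bsub>free_group S\<^esub> inv\<^bsub>free_group S\<^esub> [?p])
       = [?p] \<otimes>\<^bsub>free_group S\<^esub> (a \<otimes>\<^bsub>free_group S\<^esub> b) \<otimes>\<^bsub>free_group S\<^esub> inv\<^bsub>free_group S\<^esub> [?p]"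
      if "a \<in> carrier (free_group S)" "b \<in> carrier (free_group S)" for a b
      using that cl(1) by (simp add: m_assoc inv_mult_cancel)
    have "[?p] \<otimes>\<^bsub>free_group S\<^esub> (y \<otimes>\<^bsub>free_group S\<^esub> v) \<otimes>\<^bsub>free_group S\<^esub> inv\<^bsub>free_group S\<^esub> [?p]
        = [?p] \<otimes>\<^bsub>free_group S\<^esub> (v \<otimes>\<^bsub>free_group S\<^esub> y) \<otimes>\<^bsub>free_group S\<^esub> inv\<^bsub>free_group S\<^esub> [?p]"
      using less.prems(4) conj[OF yc cl(2)] conj[OF cl(2) yc] zc uc by metis
    then have "y \<otimes>\<^bsub>free_group S\<^esub> v = v \<otimes>\<^bsub>free_group S\<^esub> y"
      using cl yc by simp
    \<comment> \<open>With \<open>v\<close> trivial, \<open>u\<close> would consist of a letter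
      followed by its inverse and not be reduced.\<close>
    moreover have "v \<noteq> \<one>\<^bsub>free_group S\<^esub>"
      using red by (auto simp: one_free_group reduced_def)
    moreover have "length v < length u" using u by simp
    ultimately obtain k :: nat and m :: int where
      km: "k \<ge> 1" "y [^]\<^bsub>free_group S\<^esub> k = v [^]\<^bsub>free_group S\<^esub> m"
      using less.hyps yc cl(2) by blast
    have "z [^]\<^bsub>free_group S\<^esub> k = u [^]\<^bsub>free_group S\<^esub> m"
      using int_pow_conj[OF cl(1) yc, of "int k"] int_pow_conj[OF cl(1,2), of m] km(2) zc uc
      by (simp add: int_pow_int)
    then show ?thesis using km(1) by blast
  qed
qed

section \<open>The boundary word and the Heisenberg group\<close>

text \<open>The upper unitriangular integer 3 x 3 matrices: \<open>p\<close> and \<open>q\<close>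
  are the entries next to the diagonal, \<open>r\<close> is the corner entry.\<close>

definition heisenberg :: "(int \<times> int \<times> int) monoid" where
  "heisenberg = \<lparr>carrier = UNIV,
     monoid.mult = (\<lambda>(p, q, r) (p', q', r'). (p + p', q + q', r + r' + p * q')),
     one = (0, 0, 0)\<rparr>"

lemma heisenberg_simps [simp]:
  "carrier heisenberg = UNIV"
  "(p, q, r) \<otimes>\<^bsub>heisenberg\<^esub> (p', q', r') = (p + p', q + q', r + r' + p * q')"
  "\<one>\<^bsub>heisenberg\<^esub> = (0, 0, 0)"
  by (simp_all add: heisenberg_def)

lemma group_heisenberg: "group heisenberg"
proof (rule groupI)
  fix u :: "int \<times> int \<times> int"
  obtain p q r where u: "u = (p, q, r)" by (cases u)
  have "(- p, - q, p * q - r) \<otimes>\<^bsub>heisenberg\<^esub> u = \<one>\<^bsub>heisenberg\<^esub>"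
    by (simp add: u)
  then show "\<exists>v\<in>carrier heisenberg. v \<otimes>\<^bsub>heisenberg\<^esub> u = \<one>\<^bsub>heisenberg\<^esub>" by auto
qed (auto simp: algebra_simps)

lemma inv_heisenberg [simp]: "inv\<^bsub>heisenberg\<^esub> (p, q, r) = (- p, - q, p * q - r)"
  using group.inv_equality[OF group_heisenberg, of "(- p, - q, p * q - r)" "(p, q, r)"] by simp

text \<open>Commutators are central, so a product of commutators becomes a sum of 2 x 2
  determinants: the boundary word evaluates the standard symplectic form on the first two
  coordinates.\<close>

lemma commutator_heisenberg:
  "commutator heisenberg u v = (0, 0, fst u * fst (snd v) - fst v * fst (snd u))"
  by (cases u; cases v) (simp add: commutator_def algebra_simps)

lemma free_gen_Hgrp_closed:
  "i \<in> {1..g} \<Longrightarrow> free_gen (Agen i) \<in> carrier (Hgrp g)"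
  "i \<in> {1..g} \<Longrightarrow> free_gen (Bgen i) \<in> carrier (Hgrp g)"
  by (simp_all add: Hgrp_def free_gen_closed)

lemma (in group) commutator_closed:
  "a \<in> carrier G \<Longrightarrow> b \<in> carrier G \<Longrightarrow> commutator G a b \<in> carrier G"
  by (simp add: commutator_def)

lemma (in group_hom) hom_commutator:
  "a \<in> carrier G \<Longrightarrow> b \<in> carrier G \<Longrightarrow> h (commutator G a b) = commutator H (h a) (h b)"
  by (simp add: commutator_def)

lemma bdry_hom:
  assumes "group K" "h \<in> hom (Hgrp g) K"
  shows "bdry g \<in> carrier (Hgrp g)"
    and "h (bdry g) = foldr (\<lambda>i w. commutator K (h (free_gen (Agen i))) (h (free_gen (Bgen i))) \<otimes>\<^bsub>K\<^esub> w)
      [1..<Suc g] \<one>\<^bsub>K\<^esub>"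
proof -
  interpret group_hom "Hgrp g" K h
    using assms by (simp add: group_hom_def group_hom_axioms_def group_Hgrp)
  let ?f = "\<lambda>i w. commutator (Hgrp g) (free_gen (Agen i)) (free_gen (Bgen i)) \<otimes>\<^bsub>Hgrp g\<^esub> w"
  have "foldr ?f is \<one>\<^bsub>Hgrp g\<^esub> \<in> carrier (Hgrp g) \<and> h (foldr ?f is \<one>\<^bsub>Hgrp g\<^esub>) =
    foldr (\<lambda>i w. commutator K (h (free_gen (Agen i))) (h (free_gen (Bgen i))) \<otimes>\<^bsub>K\<^esub> w) is \<one>\<^bsub>K\<^esub>"
    if "set is \<subseteq> {1..g}" for "is"
    using that
    by (induction "is") (simp_all add: G.commutator_closed hom_commutator free_gen_Hgrp_closed)
  moreover have "set [1..<Suc g] \<subseteq> {1..g}" by auto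
  note calculation[OF this]
  then
  show "bdry g \<in> carrier (Hgrp g)"
    "h (bdry g) = foldr (\<lambda>i w. commutator K (h (free_gen (Agen i))) (h (free_gen (Bgen i))) \<otimes>\<^bsub>K\<^esub> w)
      [1..<Suc g] \<one>\<^bsub>K\<^esub>"
    unfolding bdry_def by blast+
qed

lemma bdry_closed: "bdry g \<in> carrier (Hgrp g)"
proof (rule bdry_hom(1))
  show "(\<lambda>w. w) \<in> hom (Hgrp g) (Hgrp g)" by (simp add: hom_def)
qed (rule group_Hgrp)

lemma additive_imp_hom:
  fixes \<beta> :: "'a \<Rightarrow> int"
  assumes "\<And>u v. u \<in> carrier G \<Longrightarrow> v \<in> carrier G \<Longrightarrow> \<beta> (u \<otimes>\<^bsub>G\<^esub> v) = \<beta> u + \<beta> v"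
  shows "\<beta> \<in> hom G integer_group"
  using assms by (auto simp: hom_def integer_group_def)

text \<open>
  The boundary word represents a nondegenerate symplectic form: if \<open>\<beta>\<close> does not vanish on the
  generator \<open>a\<^sub>i\<close>, say, pair it with the coordinate \<open>\<alpha>\<close> dual to \<open>b\<^sub>i\<close>.  The
  corresponding homomorphism to the Heisenberg group maps the boundary word to a nontrivial central
  element, but it is trivial on the boundary word of any subgroup where \<open>\<beta>\<close> vanishes.
\<close>
lemma bdry_test:
  assumes r: "r \<in> hom (Hgrp g) (Hgrp g)" "r (bdry g) = bdry g"
    and \<beta>: "\<beta> \<in> hom (Hgrp g) integer_group"
    and zero: "\<And>w. w \<in> carrier (Hgrp g) \<Longrightarrow> \<beta> (r w) = 0"
    and w: "w \<in> carrier (Hgrp g)"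
  shows "\<beta> w = 0"
proof (rule ccontr)
  assume "\<beta> w \<noteq> 0"
  let ?S = "Agen ` {1..g} \<union> Bgen ` {1..g}"
  have "\<exists>x\<in>?S. \<beta> (free_gen x) \<noteq> 0"
  proof (rule ccontr)
    assume "\<not> ?thesis"
    then have "\<beta> w = (\<lambda>_. 0) w"
      using \<beta> w by (intro free_group_hom_eqI[OF group_integer_group, of \<beta> ?S "\<lambda>_. 0" w])
        (auto simp: Hgrp_def intro: additive_imp_hom)
    then show False using \<open>\<beta> w \<noteq> 0\<close> by simp
  qed
  then obtain j where j: "j \<in> {1..g}" "\<beta> (free_gen (Agen j)) \<noteq> 0 \<or> \<beta> (free_gen (Bgen j)) \<noteq> 0"
    by blast
  define \<alpha> :: "sgen \<Rightarrow> int" where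
    "\<alpha> = (if \<beta> (free_gen (Agen j)) \<noteq> 0 then (\<lambda>y. if y = Bgen j then 1 else 0)
           else (\<lambda>y. if y = Agen j then 1 else 0))"
  define \<rho> where "\<rho> = free_ext heisenberg (\<lambda>y. (\<alpha> y, \<beta> (free_gen y), 0))"
  interpret K: group heisenberg by (rule group_heisenberg)
  have \<rho>: "\<rho> \<in> hom (Hgrp g) heisenberg"
    unfolding \<rho>_def Hgrp_def by (rule K.free_ext_hom) auto
  have \<rho>_gen: "\<rho> (free_gen y) = (\<alpha> y, \<beta> (free_gen y), 0)" for y
    unfolding \<rho>_def by (rule K.free_ext_free_gen) auto
  have fs\<rho>: "fst (snd (\<rho> v)) = \<beta> v" if "v \<in> carrier (Hgrp g)" for v
  proof (rule free_group_hom_eqI[of integer_group _ ?S])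
    show "(\<lambda>v. fst (snd (\<rho> v))) \<in> hom (free_group ?S) integer_group"
    proof (rule additive_imp_hom)
      fix u v assume "u \<in> carrier (free_group ?S)" "v \<in> carrier (free_group ?S)"
      then have "\<rho> (u \<otimes>\<^bsub>free_group ?S\<^esub> v) = \<rho> u \<otimes>\<^bsub>heisenberg\<^esub> \<rho> v"
        using \<rho> by (simp add: hom_def Hgrp_def)
      then show "fst (snd (\<rho> (u \<otimes>\<^bsub>free_group ?S\<^esub> v))) = fst (snd (\<rho> u)) + fst (snd (\<rho> v))"
        by (cases "\<rho> u"; cases "\<rho> v") simp
    qed
  qed (use \<beta> that in \<open>auto simp: Hgrp_def \<rho>_gen\<close>)
  have rc: "r v \<in> carrier (Hgrp g)" if "v \<in> carrier (Hgrp g)" for v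
    using r(1) that by (auto simp: hom_def)
  have "\<rho> (r (bdry g)) = foldr (\<lambda>i w. commutator heisenberg (\<rho> (r (free_gen (Agen i))))
     (\<rho> (r (free_gen (Bgen i)))) \<otimes>\<^bsub>heisenberg\<^esub> w) [1..<Suc g] \<one>\<^bsub>heisenberg\<^esub>"
    using bdry_hom(2)[OF group_heisenberg hom_compose[OF r(1) \<rho>]] by (simp del: upt_Suc)
  also have "\<dots> = (0, 0, 0)"
  proof -
    have "foldr (\<lambda>i w. commutator heisenberg (\<rho> (r (free_gen (Agen i))))
       (\<rho> (r (free_gen (Bgen i)))) \<otimes>\<^bsub>heisenberg\<^esub> w) is \<one>\<^bsub>heisenberg\<^esub> = (0, 0, 0)"
      if "set is \<subseteq> {1..g}" for "is"
      using that
      by (induction "is") (simp_all add: commutator_heisenberg fs\<rho> rc zero free_gen_Hgrp_closed)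
    moreover have "set [1..<Suc g] \<subseteq> {1..g}" by auto
    ultimately show ?thesis by blast
  qed
  finally have 1: "\<rho> (bdry g) = (0, 0, 0)" using r(2) by simp
  let ?c = "\<lambda>i. \<alpha> (Agen i) * \<beta> (free_gen (Bgen i)) - \<alpha> (Bgen i) * \<beta> (free_gen (Agen i))"
  have "foldr (\<lambda>i w. commutator heisenberg (\<rho> (free_gen (Agen i)))
     (\<rho> (free_gen (Bgen i))) \<otimes>\<^bsub>heisenberg\<^esub> w) is \<one>\<^bsub>heisenberg\<^esub> = (0, 0, \<Sum>i\<leftarrow>is. ?c i)" for "is"
    by (induction "is") (simp_all add: commutator_heisenberg \<rho>_gen)
  then have "\<rho> (bdry g) = (0, 0, \<Sum>i\<leftarrow>[1..<Suc g]. ?c i)"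
    using bdry_hom(2)[OF group_heisenberg \<rho>] by (simp del: upt_Suc)
  then have "(\<Sum>i\<in>{1..<Suc g}. ?c i) = 0"
    using 1 by (simp add: interv_sum_list_conv_sum_set_nat del: upt_Suc)
  moreover have "(\<Sum>i\<in>{1..<Suc g}. ?c i) = (\<Sum>i\<in>{1..<Suc g}. if i = j then ?c j else 0)"
    by (rule sum.cong) (auto simp: \<alpha>_def)
  ultimately have "?c j = 0" using j(1) by (simp del: sum.op_ivl_Suc)
  then show False using j(2) by (auto simp: \<alpha>_def split: if_splits)
qed

section \<open>Splittings over the trivial group\<close>

lemma (in group) conj_hom_subgroup:
  assumes "p \<in> carrier G" "B \<subseteq> carrier G"
  shows "(\<lambda>b. p \<otimes> b \<otimes> inv p) \<in> hom (G\<lparr>carrier := B\<rparr>) G"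
  using conj_hom[OF assms(1)] assms(2) by (auto simp: hom_def)

lemma hom_restrict_carrier: "h \<in> hom G K \<Longrightarrow> B \<subseteq> carrier G \<Longrightarrow> h \<in> hom (G\<lparr>carrier := B\<rparr>) K"
  by (auto simp: hom_def subset_iff)

lemma id_hom_subgroup: "B \<subseteq> carrier G \<Longrightarrow> (\<lambda>b. b) \<in> hom (G\<lparr>carrier := B\<rparr>) G"
  by (auto simp: hom_def)

lemma trivial_hom: "group K \<Longrightarrow> (\<lambda>_. \<one>\<^bsub>K\<^esub>) \<in> hom G K"
  by (auto simp: hom_def group.is_monoid)

lemma restrict_ext_hom:
  assumes "group G" "h \<in> hom G K"
  shows "restrict h (carrier G) \<in> ext_hom G K"
proof -
  interpret group G by fact
  show ?thesis using assms(2) by (auto simp: ext_hom_def hom_def)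
qed

lemma is_amalgam_obtain_hom:
  fixes G K :: "'a monoid"
  assumes "is_amalgam G A B C" "group K" "f1 \<in> hom (G\<lparr>carrier := A\<rparr>) K"
    "f2 \<in> hom (G\<lparr>carrier := B\<rparr>) K" "\<And>c. c \<in> C \<Longrightarrow> f1 c = f2 c"
  obtains k where "k \<in> hom G K" "\<And>a. a \<in> A \<Longrightarrow> k a = f1 a" "\<And>b. b \<in> B \<Longrightarrow> k b = f2 b"
proof -
  have "\<exists>!k. k \<in> ext_hom G K \<and> (\<forall>a\<in>A. k a = f1 a) \<and> (\<forall>b\<in>B. k b = f2 b)"
    using assms unfolding is_amalgam_def by blast
  then show thesis using that by (auto simp: ext_hom_def)
qed

lemma is_amalgam_hom_eqI:
  fixes G K :: "'a monoid"
  assumes am: "is_amalgam G A B C" and G: "group G" and K: "group K"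
    and h: "h \<in> hom G K" "k \<in> hom G K"
    and eq: "\<And>a. a \<in> A \<Longrightarrow> h a = k a" "\<And>b. b \<in> B \<Longrightarrow> h b = k b"
    and w: "w \<in> carrier G"
  shows "h w = k w"
proof -
  have sub: "A \<subseteq> carrier G" "B \<subseteq> carrier G"
    using am by (auto simp: is_amalgam_def dest: subgroup.subset)
  have "h \<in> hom (G\<lparr>carrier := A\<rparr>) K" "h \<in> hom (G\<lparr>carrier := B\<rparr>) K"
    using h(1) sub by (auto intro: hom_restrict_carrier)
  then have "\<exists>!j. j \<in> ext_hom G K \<and> (\<forall>a\<in>A. j a = h a) \<and> (\<forall>b\<in>B. j b = h b)"
    using am K unfolding is_amalgam_def by blast
  moreover have "restrict h (carrier G) \<in> ext_hom G K \<and>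
      (\<forall>a\<in>A. restrict h (carrier G) a = h a) \<and> (\<forall>b\<in>B. restrict h (carrier G) b = h b)"
    using restrict_ext_hom[OF G h(1)] sub by auto
  moreover have "restrict k (carrier G) \<in> ext_hom G K \<and>
      (\<forall>a\<in>A. restrict k (carrier G) a = h a) \<and> (\<forall>b\<in>B. restrict k (carrier G) b = h b)"
    using restrict_ext_hom[OF G h(2)] sub eq by auto
  ultimately have "restrict h (carrier G) = restrict k (carrier G)" by blast
  then show ?thesis using w by (metis restrict_apply')
qed

lemma is_HNN_obtain_hom:
  fixes G K :: "'a monoid"
  assumes "is_HNN G A t C C' \<phi>" "group K" "f \<in> hom (G\<lparr>carrier := A\<rparr>) K" "s \<in> carrier K"
    "\<And>c. c \<in> C \<Longrightarrow> inv\<^bsub>K\<^esub> s \<otimes>\<^bsub>K\<^esub> f c \<otimes>\<^bsub>K\<^esub> s = f (\<phi> c)"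
  obtains k where "k \<in> hom G K" "\<And>a. a \<in> A \<Longrightarrow> k a = f a" "k t = s"
proof -
  have "\<exists>!k. k \<in> ext_hom G K \<and> (\<forall>a\<in>A. k a = f a) \<and> k t = s"
    using assms unfolding is_HNN_def by blast
  then show thesis using that by (auto simp: ext_hom_def)
qed

lemma is_HNN_hom_eqI:
  fixes G K :: "'a monoid"
  assumes hnn: "is_HNN G A t C C' \<phi>" and G: "group G" and K: "group K"
    and h: "h \<in> hom G K" "k \<in> hom G K"
    and eq: "\<And>a. a \<in> A \<Longrightarrow> h a = k a" "h t = k t"
    and w: "w \<in> carrier G"
  shows "h w = k w"
proof -
  interpret h: group_hom G K h
    using G K h(1) by (simp add: group_hom_def group_hom_axioms_def)
  have sub: "A \<subseteq> carrier G" "t \<in> carrier G" "C \<subseteq> carrier G"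
    and \<phi>: "\<And>c. c \<in> C \<Longrightarrow> inv\<^bsub>G\<^esub> t \<otimes>\<^bsub>G\<^esub> c \<otimes>\<^bsub>G\<^esub> t = \<phi> c"
    using hnn by (auto simp: is_HNN_def dest: subgroup.subset)
  have "h \<in> hom (G\<lparr>carrier := A\<rparr>) K" "h t \<in> carrier K"
    using h(1) sub by (auto intro: hom_restrict_carrier)
  moreover have "inv\<^bsub>K\<^esub> (h t) \<otimes>\<^bsub>K\<^esub> h c \<otimes>\<^bsub>K\<^esub> h t = h (\<phi> c)" if "c \<in> C" for c
    using that sub by (subst \<phi>[OF that, symmetric]) (auto simp: subset_iff)
  ultimately have "\<exists>!j. j \<in> ext_hom G K \<and> (\<forall>a\<in>A. j a = h a) \<and> j t = h t"
    using hnn K unfolding is_HNN_def by blast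
  moreover have "restrict h (carrier G) \<in> ext_hom G K \<and>
      (\<forall>a\<in>A. restrict h (carrier G) a = h a) \<and> restrict h (carrier G) t = h t"
    using restrict_ext_hom[OF G h(1)] sub by auto
  moreover have "restrict k (carrier G) \<in> ext_hom G K \<and>
      (\<forall>a\<in>A. restrict k (carrier G) a = h a) \<and> restrict k (carrier G) t = h t"
    using restrict_ext_hom[OF G h(2)] sub eq by auto
  ultimately have "restrict h (carrier G) = restrict k (carrier G)" by blast
  then show ?thesis using w by (metis restrict_apply')
qed

text \<open>The group is now the free product of \<open>A\<close> and \<open>B\<close>. The
  projection \<open>r\<close> to \<open>A\<close> fixes the boundary word, and the projection
  \<open>s\<close> to \<open>B\<close> kills the image of \<open>r\<close>. If \<open>B\<close> is
  nontrivial, a nonzero additive map on the image of \<open>s\<close>, composed with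
  \<open>s\<close>, vanishes on the image of \<open>r\<close> but not everywhere, which
  \<open>bdry_test\<close> excludes.\<close>

lemma amalgam_trivial_edge:
  assumes am: "is_amalgam (Hgrp g) A B C" and C: "C \<subseteq> {\<one>\<^bsub>Hgrp g\<^esub>}" and bd: "bdry g \<in> A"
  shows "B = {\<one>\<^bsub>Hgrp g\<^esub>}"
proof -
  interpret H: group "Hgrp g" by (rule group_Hgrp)
  have sub: "subgroup A (Hgrp g)" "subgroup B (Hgrp g)" using am by (auto simp: is_amalgam_def)
  note subs = sub[THEN subgroup.subset]
  obtain r where r: "r \<in> hom (Hgrp g) (Hgrp g)" "\<And>a. a \<in> A \<Longrightarrow> r a = a"
      "\<And>b. b \<in> B \<Longrightarrow> r b = \<one>\<^bsub>Hgrp g\<^esub>"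
    using is_amalgam_obtain_hom[OF am group_Hgrp id_hom_subgroup[OF subs(1)] trivial_hom[OF group_Hgrp]]
      C by blast
  obtain s where s: "s \<in> hom (Hgrp g) (Hgrp g)" "\<And>a. a \<in> A \<Longrightarrow> s a = \<one>\<^bsub>Hgrp g\<^esub>"
      "\<And>b. b \<in> B \<Longrightarrow> s b = b"
    using is_amalgam_obtain_hom[OF am group_Hgrp trivial_hom[OF group_Hgrp] id_hom_subgroup[OF subs(2)]]
      C by blast
  interpret s: group_hom "Hgrp g" "Hgrp g" s
    using s(1) by unfold_locales
  have sr: "s (r w) = \<one>\<^bsub>Hgrp g\<^esub>" if "w \<in> carrier (Hgrp g)" for w
    using is_amalgam_hom_eqI[OF am group_Hgrp group_Hgrp hom_compose[OF r(1) s(1)]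
        trivial_hom[OF group_Hgrp] _ _ that]
    by (simp add: r s s.hom_one)
  have "b = \<one>\<^bsub>Hgrp g\<^esub>" if "b \<in> B" for b
  proof (rule ccontr)
    assume ne: "b \<noteq> \<one>\<^bsub>Hgrp g\<^esub>"
    have img: "b \<in> s ` carrier (Hgrp g)" using s(3) that subs by force
    have sc: "s ` carrier (Hgrp g) \<subseteq> carrier (Hgrp g)" by auto
    have mult: "u \<otimes>\<^bsub>Hgrp g\<^esub> v \<in> s ` carrier (Hgrp g)"
      if "u \<in> s ` carrier (Hgrp g)" "v \<in> s ` carrier (Hgrp g)" for u v
      using that by (auto simp: s.hom_mult[symmetric] simp del: s.hom_mult)
    obtain \<beta> :: "sgen word \<Rightarrow> int" and c where
      \<beta>: "\<And>u v. u \<in> s ` carrier (Hgrp g) \<Longrightarrow> v \<in> s ` carrier (Hgrp g) \<Longrightarrow>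
          \<beta> (u \<otimes>\<^bsub>Hgrp g\<^esub> v) = \<beta> u + \<beta> v"
        "c \<in> s ` carrier (Hgrp g)" "\<beta> c \<noteq> 0"
      using free_group_nonzero_additive[of _ "Agen ` {1..g} \<union> Bgen ` {1..g}",
          folded Hgrp_def, OF sc mult img ne] by blast
    have h: "(\<lambda>w. \<beta> (s w)) \<in> hom (Hgrp g) integer_group"
      by (rule additive_imp_hom) (simp add: \<beta>(1))
    have "\<beta> \<one>\<^bsub>Hgrp g\<^esub> = 0"
      using group_hom.hom_one[of "Hgrp g" integer_group "\<lambda>w. \<beta> (s w)"] h
      by (simp add: group_hom_def group_hom_axioms_def group_Hgrp s.hom_one)
    then have "\<beta> (s w) = 0" if "w \<in> carrier (Hgrp g)" for w
      using bdry_test[OF r(1) r(2)[OF bd] h _ that] sr by simp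
    then show False using \<beta>(2,3) by auto
  qed
  then show ?thesis using subgroup.one_closed[OF sub(2)] by blast
qed

text \<open>Over the trivial group the HNN extension is the free product of \<open>A\<close> and the
  infinite cyclic group on \<open>t\<close>, so the argument for amalgams applies with this group as
  the second factor; here it excludes the splitting altogether.\<close>

lemma HNN_nontrivial_edge:
  assumes hnn: "is_HNN (Hgrp g) A t C C' \<phi>" and bd: "bdry g \<in> A" and g: "g \<ge> 1"
  shows "\<not> C \<subseteq> {\<one>\<^bsub>Hgrp g\<^esub>}"
proof
  assume C: "C \<subseteq> {\<one>\<^bsub>Hgrp g\<^esub>}"
  interpret H: group "Hgrp g" by (rule group_Hgrp)
  interpret Z: group integer_group by simp
  have subA: "A \<subseteq> carrier (Hgrp g)" and t: "t \<in> carrier (Hgrp g)"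
    and \<phi>: "\<And>c. c \<in> C \<Longrightarrow> inv\<^bsub>Hgrp g\<^esub> t \<otimes>\<^bsub>Hgrp g\<^esub> c \<otimes>\<^bsub>Hgrp g\<^esub> t = \<phi> c"
    using hnn by (auto simp: is_HNN_def dest: subgroup.subset)
  have \<phi>1: "\<phi> c = \<one>\<^bsub>Hgrp g\<^esub>" "c = \<one>\<^bsub>Hgrp g\<^esub>" if "c \<in> C" for c
    using \<phi>[OF that] that C t by auto
  \<comment> \<open>The stable letter may be sent to any element. This one has total exponent sum 1,
    and it exists because \<open>g \<ge> 1\<close>.\<close>
  let ?a = "free_gen (Agen 1)"
  have a: "?a \<in> carrier (Hgrp g)" using g by (simp add: free_gen_Hgrp_closed)
  have "inv\<^bsub>Hgrp g\<^esub> \<one>\<^bsub>Hgrp g\<^esub> \<otimes>\<^bsub>Hgrp g\<^esub> c \<otimes>\<^bsub>Hgrp g\<^esub> \<one>\<^bsub>Hgrp g\<^esub> = \<phi> c" if "c \<in> C" for c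
    using \<phi>1[OF that] by simp
  then obtain r where r: "r \<in> hom (Hgrp g) (Hgrp g)" "\<And>a. a \<in> A \<Longrightarrow> r a = a" "r t = \<one>\<^bsub>Hgrp g\<^esub>"
    using is_HNN_obtain_hom[OF hnn group_Hgrp id_hom_subgroup[OF subA] H.one_closed] by blast
  have "inv\<^bsub>Hgrp g\<^esub> ?a \<otimes>\<^bsub>Hgrp g\<^esub> \<one>\<^bsub>Hgrp g\<^esub> \<otimes>\<^bsub>Hgrp g\<^esub> ?a = \<one>\<^bsub>Hgrp g\<^esub>" using a by simp
  note hom_s = is_HNN_obtain_hom[OF hnn group_Hgrp trivial_hom[OF group_Hgrp] a this]
  obtain s where s: "s \<in> hom (Hgrp g) (Hgrp g)" "\<And>a. a \<in> A \<Longrightarrow> s a = \<one>\<^bsub>Hgrp g\<^esub>" "s t = ?a"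
    using hom_s by blast
  interpret s: group_hom "Hgrp g" "Hgrp g" s
    using s(1) by unfold_locales
  have sr: "s (r w) = \<one>\<^bsub>Hgrp g\<^esub>" if "w \<in> carrier (Hgrp g)" for w
    using is_HNN_hom_eqI[OF hnn group_Hgrp group_Hgrp hom_compose[OF r(1) s(1)]
        trivial_hom[OF group_Hgrp] _ _ that]
    by (simp add: r s s.hom_one)
  define \<epsilon> where "\<epsilon> = free_ext integer_group (\<lambda>_ :: sgen. 1)"
  have \<epsilon>: "\<epsilon> \<in> hom (Hgrp g) integer_group"
    unfolding \<epsilon>_def Hgrp_def by (rule Z.free_ext_hom) simp
  have "(\<epsilon> \<circ> s) t = 0"
  proof (rule bdry_test[OF r(1) r(2)[OF bd] _ _ t])
    show "\<epsilon> \<circ> s \<in> hom (Hgrp g) integer_group"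
      by (rule hom_compose[OF s(1) \<epsilon>])
    fix w assume "w \<in> carrier (Hgrp g)"
    then show "(\<epsilon> \<circ> s) (r w) = 0"
      by (simp add: sr \<epsilon>_def free_ext_def Hgrp_def one_free_group)
  qed
  moreover have "(\<epsilon> \<circ> s) t = 1"
    using Z.free_ext_free_gen[of "\<lambda>_. 1" "Agen 1"] by (simp add: s \<epsilon>_def)
  ultimately show False by simp
qed

section \<open>Admissible representations under fractional Dehn twists\<close>

lemma (in group) inv_commute:
  assumes "y \<in> carrier G" "c \<in> carrier G" "y \<otimes> c = c \<otimes> y"
  shows "inv y \<otimes> c = c \<otimes> inv y"
proof -
  have "inv y \<otimes> c = inv y \<otimes> (c \<otimes> y) \<otimes> inv y" using assms(1,2) by (simp add: m_assoc)
  also have "\<dots> = c \<otimes> inv y" using assms by (simp add: inv_mult_cancel flip: assms(3))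
  finally show ?thesis .
qed

lemma (in group) id_hom: "(\<lambda>x. x) \<in> hom G G"
  by (simp add: hom_def)

text \<open>The universal properties of the splittings speak only about target groups on words in
  \<open>sgen\<close>. Homomorphisms into \<open>F\<close> are therefore compared after embedding
  \<open>F\<close> in a free group on this type; as its basis is finite, the result on centralizers
  carries over as well.\<close>

locale free_embedding = F: group F for F :: "('f, 'm) monoid_scheme" (structure) +
  fixes e :: "'f \<Rightarrow> sgen word" and T :: "sgen set"
  assumes fin: "finite T" and e: "e \<in> hom F (free_group T)" and inj: "inj_on e (carrier F)"
begin

lemma e_hom: "group_hom F (free_group T) e"
  using e by (simp add: group_hom_def group_hom_axioms_def group_free_group F.is_group)

lemma centralizer:
  assumes "z \<in> carrier F" "u \<in> carrier F" "u \<noteq> \<one>" "z \<otimes> u = u \<otimes> z"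
  obtains k :: nat and m :: int where "k \<ge> 1" "z [^] k = u [^] m"
proof -
  interpret e: group_hom F "free_group T" e by (rule e_hom)
  have "e z \<otimes>\<^bsub>free_group T\<^esub> e u = e u \<otimes>\<^bsub>free_group T\<^esub> e z"
    using assms by (metis e.hom_mult)
  moreover have "e u \<noteq> \<one>\<^bsub>free_group T\<^esub>"
    using assms(2,3) inj by (metis F.one_closed e.hom_one inj_onD)
  ultimately obtain k :: nat and m :: int where
    km: "k \<ge> 1" "e z [^]\<^bsub>free_group T\<^esub> k = e u [^]\<^bsub>free_group T\<^esub> m"
    using free_group_centralizer[OF fin, of "e z" "e u"] assms(1,2) by auto
  then have "e (z [^] k) = e (u [^] m)"
    using assms(1,2) by (simp add: e.hom_nat_pow e.hom_int_pow)
  then have "z [^] k = u [^] m"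
    using inj assms(1,2) by (metis F.int_pow_closed F.nat_pow_closed inj_onD)
  then show thesis using that km(1) by blast
qed

text \<open>A power of \<open>z\<close> equals a power of some nontrivial \<open>h c\<close>, so
  primitivity gives \<open>z = h y\<close>, and injectivity pulls the commutation relations back. A
  power of \<open>y\<close> is then a power of \<open>c\<close>, and an endomorphism fixing
  \<open>C\<close> fixes \<open>y\<close> by uniqueness of roots; this last conclusion is what makes
  twists invertible.\<close>

lemma centralizes_imageE:
  assumes h: "h \<in> hom (Hgrp g) F" "inj_on h (carrier (Hgrp g))"
    and prim: "primitive_subgroup (h ` carrier (Hgrp g)) F"
    and z: "centralizes F z (h ` C)" and C: "C \<subseteq> carrier (Hgrp g)" "\<not> C \<subseteq> {\<one>\<^bsub>Hgrp g\<^esub>}"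
  obtains y where "y \<in> carrier (Hgrp g)" "z = h y"
    "\<And>c. c \<in> C \<Longrightarrow> y \<otimes>\<^bsub>Hgrp g\<^esub> c = c \<otimes>\<^bsub>Hgrp g\<^esub> y"
    "\<And>\<tau>. \<tau> \<in> hom (Hgrp g) (Hgrp g) \<Longrightarrow> (\<And>c. c \<in> C \<Longrightarrow> \<tau> c = c) \<Longrightarrow> \<tau> y = y"
proof -
  interpret h: group_hom "Hgrp g" F h
    using h(1) by (simp add: group_hom_def group_hom_axioms_def group_Hgrp F.is_group)
  obtain c where c: "c \<in> C" "c \<noteq> \<one>\<^bsub>Hgrp g\<^esub>" using C(2) by blast
  have cc: "c \<in> carrier (Hgrp g)" using c C by blast
  have zc: "z \<in> carrier F" and comm: "\<And>d. d \<in> C \<Longrightarrow> z \<otimes> h d = h d \<otimes> z"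
    using z by (auto simp: centralizes_def)
  have "h c \<noteq> \<one>" using c cc h(2) by (metis h.G.one_closed h.hom_one inj_onD)
  then obtain k :: nat and m :: int where "k \<ge> 1" "z [^] k = h c [^] m"
    using centralizer[OF zc _ _ comm[OF c(1)]] cc by auto
  then have km: "k \<ge> 1" "z [^] k = h (c [^]\<^bsub>Hgrp g\<^esub> m)"
    using cc by (simp_all add: h.hom_int_pow)
  then have "z \<in> h ` carrier (Hgrp g)"
    using prim zc cc unfolding primitive_subgroup_def by blast
  then obtain y where y: "y \<in> carrier (Hgrp g)" "z = h y" by blast
  have "y \<otimes>\<^bsub>Hgrp g\<^esub> d = d \<otimes>\<^bsub>Hgrp g\<^esub> y" if "d \<in> C" for d
  proof -
    have d: "d \<in> carrier (Hgrp g)" using that C by blast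
    have "h (y \<otimes>\<^bsub>Hgrp g\<^esub> d) = h (d \<otimes>\<^bsub>Hgrp g\<^esub> y)" using comm[OF that] y d by simp
    then show ?thesis using h(2) y d by (metis h.G.m_closed inj_onD)
  qed
  moreover have "\<tau> y = y" if \<tau>: "\<tau> \<in> hom (Hgrp g) (Hgrp g)" "\<And>c. c \<in> C \<Longrightarrow> \<tau> c = c" for \<tau>
  proof -
    interpret t: group_hom "Hgrp g" "Hgrp g" \<tau> using \<tau>(1) by unfold_locales
    have "h (y [^]\<^bsub>Hgrp g\<^esub> k) = h (c [^]\<^bsub>Hgrp g\<^esub> m)"
      using km y by (simp add: h.hom_nat_pow)
    then have yk: "y [^]\<^bsub>Hgrp g\<^esub> k = c [^]\<^bsub>Hgrp g\<^esub> m"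
      using h(2) y cc by (meson h.G.int_pow_closed h.G.nat_pow_closed inj_onD)
    then have "(\<tau> y) [^]\<^bsub>Hgrp g\<^esub> k = \<tau> (c [^]\<^bsub>Hgrp g\<^esub> m)"
      using y by (metis t.hom_nat_pow)
    also have "\<dots> = y [^]\<^bsub>Hgrp g\<^esub> k"
      using \<tau>(2)[OF c(1)] cc yk by (simp add: t.hom_int_pow)
    finally show ?thesis
      using free_group_unique_roots[of "\<tau> y" _ y k, folded Hgrp_def] y km(1)
      unfolding Hgrp_def by (metis Hgrp_def t.hom_closed)
  qed
  ultimately show thesis using that y by blast
qed

lemma amalgam_hom_eqI:
  assumes am: "is_amalgam (Hgrp g) A B C"
    and h: "h \<in> hom (Hgrp g) F" "k \<in> hom (Hgrp g) F"
    and eq: "\<And>a. a \<in> A \<Longrightarrow> h a = k a" "\<And>b. b \<in> B \<Longrightarrow> h b = k b"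
    and w: "w \<in> carrier (Hgrp g)"
  shows "h w = k w"
proof -
  have "(e \<circ> h) w = (e \<circ> k) w"
    using eq by (intro is_amalgam_hom_eqI[OF am group_Hgrp group_free_group
          hom_compose[OF h(1) e] hom_compose[OF h(2) e] _ _ w]) auto
  moreover have "h w \<in> carrier F" "k w \<in> carrier F" using h w by (auto simp: hom_def)
  ultimately show ?thesis using inj by (auto dest: inj_onD)
qed

lemma HNN_hom_eqI:
  assumes hnn: "is_HNN (Hgrp g) A t C C' \<phi>"
    and h: "h \<in> hom (Hgrp g) F" "k \<in> hom (Hgrp g) F"
    and eq: "\<And>a. a \<in> A \<Longrightarrow> h a = k a" "h t = k t"
    and w: "w \<in> carrier (Hgrp g)"
  shows "h w = k w"
proof -
  have "(e \<circ> h) w = (e \<circ> k) w"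
    using eq by (intro is_HNN_hom_eqI[OF hnn group_Hgrp group_free_group
          hom_compose[OF h(1) e] hom_compose[OF h(2) e] _ _ w]) auto
  moreover have "h w \<in> carrier F" "k w \<in> carrier F" using h w by (auto simp: hom_def)
  ultimately show ?thesis using inj by (auto dest: inj_onD)
qed

text \<open>Because \<open>y\<close> centralizes \<open>C\<close>, the identity on \<open>A\<close>
  and conjugation by \<open>y\<close> on \<open>B\<close> glue to an endomorphism
  \<open>\<tau>\<close>; conjugation by the inverse of \<open>y\<close> gives the candidate
  \<open>\<tau>'\<close> for its inverse.\<close>

lemma amalgam_twist_imp_automorphism:
  assumes h: "h \<in> hom (Hgrp g) F" "inj_on h (carrier (Hgrp g))"
    and prim: "primitive_subgroup (h ` carrier (Hgrp g)) F"
    and h': "h' \<in> hom (Hgrp g) F" and tw: "amalgam_twist F g h h'"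
  obtains \<tau> where "bij_betw \<tau> (carrier (Hgrp g)) (carrier (Hgrp g))"
    "\<And>w. w \<in> carrier (Hgrp g) \<Longrightarrow> h' w = h (\<tau> w)"
proof -
  interpret H: group "Hgrp g" by (rule group_Hgrp)
  interpret h: group_hom "Hgrp g" F h
    using h(1) by (simp add: group_hom_def group_hom_axioms_def group_Hgrp F.is_group)
  interpret h': group_hom "Hgrp g" F h'
    using h' by (simp add: group_hom_def group_hom_axioms_def group_Hgrp F.is_group)
  obtain A B C z where am: "is_amalgam (Hgrp g) A B C" and bd: "bdry g \<in> A"
    and z: "centralizes F z (h ` C)" and A: "\<And>a. a \<in> A \<Longrightarrow> h' a = h a"
    and B: "\<And>b. b \<in> B \<Longrightarrow> h' b = z \<otimes> h b \<otimes> inv z"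
    using tw unfolding amalgam_twist_def by blast
  have sub: "A \<subseteq> carrier (Hgrp g)" "B \<subseteq> carrier (Hgrp g)" "C \<subseteq> carrier (Hgrp g)" "C \<subseteq> A" "C \<subseteq> B"
    using am by (auto simp: is_amalgam_def dest: subgroup.subset)
  have zc: "z \<in> carrier F" using z by (simp add: centralizes_def)
  show thesis
  proof (cases "C \<subseteq> {\<one>\<^bsub>Hgrp g\<^esub>}")
    case True
    \<comment> \<open>The group is generated by \<open>A\<close> alone, and the twist changes
      nothing.\<close>
    then have B1: "B = {\<one>\<^bsub>Hgrp g\<^esub>}" using amalgam_trivial_edge[OF am _ bd] by blast
    have "h' w = h w" if "w \<in> carrier (Hgrp g)" for w
      using zc by (intro amalgam_hom_eqI[OF am h' h(1) _ _ that]) (auto simp: A B1)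
    then show thesis using that[of "\<lambda>w. w"] by (simp add: bij_betw_def)
  next
    case False
    obtain y where y: "y \<in> carrier (Hgrp g)" "z = h y"
      and yC: "\<And>c. c \<in> C \<Longrightarrow> y \<otimes>\<^bsub>Hgrp g\<^esub> c = c \<otimes>\<^bsub>Hgrp g\<^esub> y"
      and fix_y: "\<And>\<tau>. \<tau> \<in> hom (Hgrp g) (Hgrp g) \<Longrightarrow> (\<And>c. c \<in> C \<Longrightarrow> \<tau> c = c) \<Longrightarrow> \<tau> y = y"
      using centralizes_imageE[OF h prim z sub(3) False] by blast
    have "\<exists>k\<in>hom (Hgrp g) (Hgrp g). (\<forall>a\<in>A. k a = a) \<and>
        (\<forall>b\<in>B. k b = x \<otimes>\<^bsub>Hgrp g\<^esub> b \<otimes>\<^bsub>Hgrp g\<^esub> inv\<^bsub>Hgrp g\<^esub> x)"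
      if x: "x \<in> carrier (Hgrp g)" "\<And>c. c \<in> C \<Longrightarrow> x \<otimes>\<^bsub>Hgrp g\<^esub> c = c \<otimes>\<^bsub>Hgrp g\<^esub> x" for x
    proof -
      have "c = x \<otimes>\<^bsub>Hgrp g\<^esub> c \<otimes>\<^bsub>Hgrp g\<^esub> inv\<^bsub>Hgrp g\<^esub> x" if "c \<in> C" for c
        using x that sub(3) by (auto simp: H.m_assoc)
      from is_amalgam_obtain_hom[OF am group_Hgrp id_hom_subgroup[OF sub(1)]
            H.conj_hom_subgroup[OF x(1) sub(2)] this]
      show ?thesis by metis
    qed
    note twist = this
    obtain \<tau> where \<tau>: "\<tau> \<in> hom (Hgrp g) (Hgrp g)" "\<And>a. a \<in> A \<Longrightarrow> \<tau> a = a"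
      "\<And>b. b \<in> B \<Longrightarrow> \<tau> b = y \<otimes>\<^bsub>Hgrp g\<^esub> b \<otimes>\<^bsub>Hgrp g\<^esub> inv\<^bsub>Hgrp g\<^esub> y"
      using twist[OF y(1) yC] by blast
    have "inv\<^bsub>Hgrp g\<^esub> y \<otimes>\<^bsub>Hgrp g\<^esub> c = c \<otimes>\<^bsub>Hgrp g\<^esub> inv\<^bsub>Hgrp g\<^esub> y" if "c \<in> C" for c
      using yC[OF that] that y(1) sub(3) by (intro H.inv_commute) auto
    then obtain \<tau>' where \<tau>': "\<tau>' \<in> hom (Hgrp g) (Hgrp g)" "\<And>a. a \<in> A \<Longrightarrow> \<tau>' a = a"
      "\<And>b. b \<in> B \<Longrightarrow> \<tau>' b = inv\<^bsub>Hgrp g\<^esub> y \<otimes>\<^bsub>Hgrp g\<^esub> b \<otimes>\<^bsub>Hgrp g\<^esub> y"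
      using twist[of "inv\<^bsub>Hgrp g\<^esub> y"] y(1) by auto
    interpret t: group_hom "Hgrp g" "Hgrp g" \<tau> using \<tau>(1) by unfold_locales
    interpret t': group_hom "Hgrp g" "Hgrp g" \<tau>' using \<tau>'(1) by unfold_locales
    \<comment> \<open>The element \<open>y\<close> may lie outside \<open>A\<close>, but it is a
      root of an element of \<open>C\<close>, and \<open>C\<close> is fixed as a part of
      \<open>A\<close>. On \<open>B\<close> the composites then conjugate by \<open>y\<close> and
      back.\<close>
    have \<tau>y: "\<tau> y = y" and \<tau>'y: "\<tau>' y = y"
      using \<tau>(2) \<tau>'(2) sub(4) by (auto intro!: fix_y \<tau>(1) \<tau>'(1))
    have "(\<tau> \<circ> \<tau>') w = w" if "w \<in> carrier (Hgrp g)" for w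
      using sub y(1)
      by (intro is_amalgam_hom_eqI[OF am group_Hgrp group_Hgrp hom_compose[OF \<tau>'(1) \<tau>(1)]
            H.id_hom _ _ that])
        (auto simp: \<tau> \<tau>' \<tau>y H.m_assoc H.inv_mult_cancel subset_iff)
    moreover have "(\<tau>' \<circ> \<tau>) w = w" if "w \<in> carrier (Hgrp g)" for w
      using sub y(1)
      by (intro is_amalgam_hom_eqI[OF am group_Hgrp group_Hgrp hom_compose[OF \<tau>(1) \<tau>'(1)]
            H.id_hom _ _ that])
        (auto simp: \<tau> \<tau>' \<tau>'y H.m_assoc H.inv_mult_cancel subset_iff)
    ultimately have "bij_betw \<tau> (carrier (Hgrp g)) (carrier (Hgrp g))"
      by (intro bij_betwI[where g = \<tau>']) auto
    moreover have "h' w = (h \<circ> \<tau>) w" if "w \<in> carrier (Hgrp g)" for w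
      using sub y
      by (intro amalgam_hom_eqI[OF am h' hom_compose[OF \<tau>(1) h(1)] _ _ that])
        (auto simp: \<tau> A B subset_iff)
    ultimately show thesis using that by simp
  qed
qed

text \<open>The automorphism is the identity on \<open>A\<close> and multiplies \<open>t\<close> by
  \<open>y\<close> from the left. No trivial case arises, since the edge group is nontrivial by
  \<open>HNN_nontrivial_edge\<close>.\<close>

lemma HNN_twist_imp_automorphism:
  assumes g: "g \<ge> 1"
    and h: "h \<in> hom (Hgrp g) F" "inj_on h (carrier (Hgrp g))"
    and prim: "primitive_subgroup (h ` carrier (Hgrp g)) F"
    and h': "h' \<in> hom (Hgrp g) F" and tw: "HNN_twist F g h h'"
  obtains \<tau> where "bij_betw \<tau> (carrier (Hgrp g)) (carrier (Hgrp g))"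
    "\<And>w. w \<in> carrier (Hgrp g) \<Longrightarrow> h' w = h (\<tau> w)"
proof -
  interpret H: group "Hgrp g" by (rule group_Hgrp)
  interpret h: group_hom "Hgrp g" F h
    using h(1) by (simp add: group_hom_def group_hom_axioms_def group_Hgrp F.is_group)
  obtain A t C C' \<phi> z where hnn: "is_HNN (Hgrp g) A t C C' \<phi>" and bd: "bdry g \<in> A"
    and z: "centralizes F z (h ` C)" and A: "\<And>a. a \<in> A \<Longrightarrow> h' a = h a"
    and t: "h' t = z \<otimes> h t"
    using tw unfolding HNN_twist_def by blast
  have sub: "A \<subseteq> carrier (Hgrp g)" "C \<subseteq> carrier (Hgrp g)" "C \<subseteq> A" "t \<in> carrier (Hgrp g)"
    and \<phi>: "\<And>c. c \<in> C \<Longrightarrow> inv\<^bsub>Hgrp g\<^esub> t \<otimes>\<^bsub>Hgrp g\<^esub> c \<otimes>\<^bsub>Hgrp g\<^esub> t = \<phi> c"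
    using hnn by (auto simp: is_HNN_def dest: subgroup.subset)
  obtain y where y: "y \<in> carrier (Hgrp g)" "z = h y"
    and yC: "\<And>c. c \<in> C \<Longrightarrow> y \<otimes>\<^bsub>Hgrp g\<^esub> c = c \<otimes>\<^bsub>Hgrp g\<^esub> y"
    and fix_y: "\<And>\<tau>. \<tau> \<in> hom (Hgrp g) (Hgrp g) \<Longrightarrow> (\<And>c. c \<in> C \<Longrightarrow> \<tau> c = c) \<Longrightarrow> \<tau> y = y"
    using centralizes_imageE[OF h prim z sub(2) HNN_nontrivial_edge[OF hnn bd g]] by blast
  have twist: "\<exists>k\<in>hom (Hgrp g) (Hgrp g). (\<forall>a\<in>A. k a = a) \<and> k t = x \<otimes>\<^bsub>Hgrp g\<^esub> t"
    if x: "x \<in> carrier (Hgrp g)" "\<And>c. c \<in> C \<Longrightarrow> x \<otimes>\<^bsub>Hgrp g\<^esub> c = c \<otimes>\<^bsub>Hgrp g\<^esub> x" for x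
  proof -
    \<comment> \<open>The new stable letter acts on \<open>C\<close> exactly as \<open>t\<close>
      does, because \<open>x\<close> centralizes \<open>C\<close>.\<close>
    have "inv\<^bsub>Hgrp g\<^esub> (x \<otimes>\<^bsub>Hgrp g\<^esub> t) \<otimes>\<^bsub>Hgrp g\<^esub> c \<otimes>\<^bsub>Hgrp g\<^esub> (x \<otimes>\<^bsub>Hgrp g\<^esub> t) = \<phi> c"
      if c: "c \<in> C" for c
    proof -
      have cc: "c \<in> carrier (Hgrp g)" using c sub by blast
      have "inv\<^bsub>Hgrp g\<^esub> (x \<otimes>\<^bsub>Hgrp g\<^esub> t) \<otimes>\<^bsub>Hgrp g\<^esub> c \<otimes>\<^bsub>Hgrp g\<^esub> (x \<otimes>\<^bsub>Hgrp g\<^esub> t)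
        = inv\<^bsub>Hgrp g\<^esub> t \<otimes>\<^bsub>Hgrp g\<^esub> (inv\<^bsub>Hgrp g\<^esub> x \<otimes>\<^bsub>Hgrp g\<^esub> (c \<otimes>\<^bsub>Hgrp g\<^esub> x)) \<otimes>\<^bsub>Hgrp g\<^esub> t"
        using x(1) sub(4) cc by (simp add: H.inv_mult_group H.m_assoc)
      also have "\<dots> = \<phi> c"
        using x(1) cc \<phi>[OF c] by (simp add: H.inv_mult_cancel flip: x(2)[OF c])
      finally show ?thesis .
    qed
    from is_HNN_obtain_hom[OF hnn group_Hgrp id_hom_subgroup[OF sub(1)]
          H.m_closed[OF x(1) sub(4)] this]
    show ?thesis by metis
  qed
  obtain \<tau> where \<tau>: "\<tau> \<in> hom (Hgrp g) (Hgrp g)" "\<And>a. a \<in> A \<Longrightarrow> \<tau> a = a"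
    "\<tau> t = y \<otimes>\<^bsub>Hgrp g\<^esub> t"
    using twist[OF y(1) yC] by blast
  have "inv\<^bsub>Hgrp g\<^esub> y \<otimes>\<^bsub>Hgrp g\<^esub> c = c \<otimes>\<^bsub>Hgrp g\<^esub> inv\<^bsub>Hgrp g\<^esub> y" if "c \<in> C" for c
    using yC[OF that] that y(1) sub(2) by (intro H.inv_commute) auto
  then obtain \<tau>' where \<tau>': "\<tau>' \<in> hom (Hgrp g) (Hgrp g)" "\<And>a. a \<in> A \<Longrightarrow> \<tau>' a = a"
    "\<tau>' t = inv\<^bsub>Hgrp g\<^esub> y \<otimes>\<^bsub>Hgrp g\<^esub> t"
    using twist[OF H.inv_closed[OF y(1)]] by blast
  interpret t: group_hom "Hgrp g" "Hgrp g" \<tau> using \<tau>(1) by unfold_locales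
  interpret t': group_hom "Hgrp g" "Hgrp g" \<tau>' using \<tau>'(1) by unfold_locales
  have \<tau>y: "\<tau> y = y" and \<tau>'y: "\<tau>' y = y"
    using \<tau>(2) \<tau>'(2) sub(3) by (auto intro!: fix_y \<tau>(1) \<tau>'(1))
  have "(\<tau> \<circ> \<tau>') w = w" if "w \<in> carrier (Hgrp g)" for w
    using sub y(1)
    by (intro is_HNN_hom_eqI[OF hnn group_Hgrp group_Hgrp hom_compose[OF \<tau>'(1) \<tau>(1)]
          H.id_hom _ _ that])
      (auto simp: \<tau> \<tau>' \<tau>y H.inv_mult_cancel subset_iff)
  moreover have "(\<tau>' \<circ> \<tau>) w = w" if "w \<in> carrier (Hgrp g)" for w
    using sub y(1)
    by (intro is_HNN_hom_eqI[OF hnn group_Hgrp group_Hgrp hom_compose[OF \<tau>(1) \<tau>'(1)]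
          H.id_hom _ _ that])
      (auto simp: \<tau> \<tau>' \<tau>'y H.inv_mult_cancel subset_iff)
  ultimately have "bij_betw \<tau> (carrier (Hgrp g)) (carrier (Hgrp g))"
    by (intro bij_betwI[where g = \<tau>']) auto
  moreover have "h' w = (h \<circ> \<tau>) w" if "w \<in> carrier (Hgrp g)" for w
    using sub y
    by (intro HNN_hom_eqI[OF hnn h' hom_compose[OF \<tau>(1) h(1)] _ _ that])
      (auto simp: \<tau> A t subset_iff)
  ultimately show thesis using that by simp
qed

lemma dehn_related_admissible:
  assumes g: "g \<ge> 1" and h: "h \<in> admissible_reps F g x" and rel: "dehn_related F g x h h'"
  shows "h' \<in> admissible_reps F g x \<and> h' ` carrier (Hgrp g) = h ` carrier (Hgrp g)"
proof -
  have hom: "h \<in> hom (Hgrp g) F" "h' \<in> hom (Hgrp g) F"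
    and inj: "inj_on h (carrier (Hgrp g))"
    and prim: "primitive_subgroup (h ` carrier (Hgrp g)) F"
    and h': "h' \<in> genus_reps F g x"
    using h rel by (auto simp: admissible_reps_def genus_reps_def ext_hom_def dehn_related_def)
  obtain \<tau> where \<tau>: "bij_betw \<tau> (carrier (Hgrp g)) (carrier (Hgrp g))"
    "\<And>w. w \<in> carrier (Hgrp g) \<Longrightarrow> h' w = h (\<tau> w)"
    using rel amalgam_twist_imp_automorphism[OF hom(1) inj prim hom(2)]
      HNN_twist_imp_automorphism[OF g hom(1) inj prim hom(2)]
    unfolding dehn_related_def by metis
  have "h' ` carrier (Hgrp g) = h ` \<tau> ` carrier (Hgrp g)"
    using \<tau>(2) by (auto simp: image_iff)
  then have img: "h' ` carrier (Hgrp g) = h ` carrier (Hgrp g)"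
    using \<tau>(1) by (simp add: bij_betw_imp_surj_on)
  have "inj_on (h \<circ> \<tau>) (carrier (Hgrp g))"
    using \<tau>(1) inj by (auto simp: bij_betw_def intro: comp_inj_on)
  then have "inj_on h' (carrier (Hgrp g))"
    using \<tau>(2) by (simp cong: inj_on_cong)
  then show ?thesis using img prim h' by (simp add: admissible_reps_def)
qed

text \<open>The generated equivalence relation also runs through twists backwards, while
  admissibility is carried forwards only. The inverse is the twist by \<open>inv z\<close>, which
  centralizes the same elements since \<open>h\<close> and \<open>h'\<close> agree on
  \<open>C\<close>.\<close>

lemma dehn_related_sym:
  assumes "dehn_related F g x h h'"
  shows "dehn_related F g x h' h"
proof -
  have hom: "h \<in> hom (Hgrp g) F" using assms
    by (auto simp: genus_reps_def ext_hom_def dehn_related_def)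
  have hc: "h w \<in> carrier F" if "w \<in> carrier (Hgrp g)" for w
    using hom that by (auto simp: hom_def)
  have cent: "centralizes F (inv z) (h' ` C)"
    if "centralizes F z (h ` C)" "C \<subseteq> A" "\<forall>a\<in>A. h' a = h a" "C \<subseteq> carrier (Hgrp g)" for z A C
    using that hc unfolding centralizes_def by (auto intro!: F.inv_commute simp: subset_iff)
  have "amalgam_twist F g h' h" if tw: "amalgam_twist F g h h'"
  proof -
    obtain A B C z where am: "is_amalgam (Hgrp g) A B C"
      and cyc: "cyclic_group (Hgrp g\<lparr>carrier := C\<rparr>)" and bd: "bdry g \<in> A"
      and z: "centralizes F z (h ` C)" and A: "\<forall>a\<in>A. h' a = h a"
      and B: "\<forall>b\<in>B. h' b = z \<otimes> h b \<otimes> inv z"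
      using tw unfolding amalgam_twist_def by blast
    have sub: "C \<subseteq> A" "B \<subseteq> carrier (Hgrp g)" "C \<subseteq> carrier (Hgrp g)"
      using am by (auto simp: is_amalgam_def dest: subgroup.subset)
    have "h b = inv z \<otimes> h' b \<otimes> inv (inv z)" if "b \<in> B" for b
    proof -
      have "h b \<in> carrier F" "z \<in> carrier F" using z hc that sub by (auto simp: centralizes_def)
      then show ?thesis using bspec[OF B that] by (simp add: F.m_assoc F.inv_mult_cancel)
    qed
    then show ?thesis
      unfolding amalgam_twist_def using am cyc bd cent[OF z sub(1) A sub(3)] A by metis
  qed
  moreover have "HNN_twist F g h' h" if tw: "HNN_twist F g h h'"
  proof -
    obtain A t C C' \<phi> z where hnn: "is_HNN (Hgrp g) A t C C' \<phi>"
      and cyc: "cyclic_group (Hgrp g\<lparr>carrier := C\<rparr>)" "cyclic_group (Hgrp g\<lparr>carrier := C'\<rparr>)"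
      and bd: "bdry g \<in> A"
      and z: "centralizes F z (h ` C)" and A: "\<forall>a\<in>A. h' a = h a" and t: "h' t = z \<otimes> h t"
      using tw unfolding HNN_twist_def by blast
    have sub: "C \<subseteq> A" "t \<in> carrier (Hgrp g)" "C \<subseteq> carrier (Hgrp g)"
      using hnn by (auto simp: is_HNN_def dest: subgroup.subset)
    have "h t = inv z \<otimes> h' t"
      using hc[OF sub(2)] z t by (simp add: F.inv_mult_cancel centralizes_def)
    then show ?thesis
      unfolding HNN_twist_def using hnn cyc bd cent[OF z sub(1) A sub(3)] A by metis
  qed
  ultimately show ?thesis using assms by (auto simp: dehn_related_def)
qed

section \<open>Counting classes by their images\<close>

lemma dehn_equiv_admissible:
  assumes g: "g \<ge> 1" and h: "h \<in> admissible_reps F g x" and eq: "(h, h') \<in> dehn_equiv F g x"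
  shows "h' \<in> admissible_reps F g x \<and> h' ` carrier (Hgrp g) = h ` carrier (Hgrp g)"
proof -
  have "equivclp (dehn_related F g x) h h'" using eq by (simp add: dehn_equiv_def)
  then show ?thesis
  proof (induction rule: equivclp_induct)
    case base
    then show ?case using h by simp
  next
    case (step h1 h2)
    then show ?case using dehn_related_admissible[OF g] dehn_related_sym by metis
  qed
qed

text \<open>A class with an admissible member consists of admissible representations with one common
  image, so the class determines the subgroup.\<close>

lemma num'_le_num:
  assumes g: "g \<ge> 1"
  shows "num' F g x \<le> num F g x"
proof (cases "finite (sim_injective_reps F g x // dehn_equiv F g x)")
  case False
  then show ?thesis by (simp add: num_def ecount_def)
next
  case True
  let ?Q = "sim_injective_reps F g x // dehn_equiv F g x"
  let ?I = "(\<lambda>h. h ` carrier (Hgrp g)) ` admissible_reps F g x"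
  \<comment> \<open>On a class without admissible members this value depends on the choice; only the
    inclusion of \<open>?I\<close> in the image of \<open>f\<close> is claimed.\<close>
  define f where "f = (\<lambda>q. (SOME h :: sgen word \<Rightarrow> 'f. h \<in> q) ` carrier (Hgrp g))"
  have "?I \<subseteq> f ` ?Q"
  proof
    fix S assume "S \<in> ?I"
    then obtain h where h: "h \<in> admissible_reps F g x" "S = h ` carrier (Hgrp g)" by blast
    have hg: "h \<in> genus_reps F g x" using h(1) by (simp add: admissible_reps_def)
    have "inj_on h' (carrier (Hgrp g))" if "(h, h') \<in> dehn_equiv F g x" for h'
      using dehn_equiv_admissible[OF g h(1) that] by (simp add: admissible_reps_def)
    then have "h \<in> sim_injective_reps F g x" using hg by (simp add: sim_injective_reps_def)
    then have q: "dehn_equiv F g x `` {h} \<in> ?Q" by (rule quotientI)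
    have "h \<in> dehn_equiv F g x `` {h}" using hg by (simp add: dehn_equiv_def)
    then have "(SOME h'. h' \<in> dehn_equiv F g x `` {h}) \<in> dehn_equiv F g x `` {h}"
      by (rule someI[of "\<lambda>h'. h' \<in> dehn_equiv F g x `` {h}"])
    then have "f (dehn_equiv F g x `` {h}) = S"
      using dehn_equiv_admissible[OF g h(1)] unfolding f_def h(2) by blast
    then show "S \<in> f ` ?Q" using q by blast
  qed
  then have "finite ?I" "card ?I \<le> card ?Q"
    using True by (auto intro: finite_subset[OF _ finite_imageI] surj_card_le)
  then show ?thesis using True by (simp add: num'_def num_def ecount_def)
qed

lemma fF'_le_fF: "g \<ge> 1 \<Longrightarrow> fF' F g \<le> fF F g"
  unfolding fF'_def fF_def by (intro SUP_mono') (rule num'_le_num)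

end

section \<open>Comparison with a solid bound\<close>

lemma (in group) free_ext_gen_hom:
  assumes "f \<in> S \<rightarrow> carrier G"
  shows "free_ext G f \<in> hom (free_group S) G"
    and "\<And>x. x \<in> S \<Longrightarrow> free_ext G f (free_gen x) = f x"
  using assms by (auto intro: free_ext_hom free_ext_free_gen)

lemma free_group_left_inverse:
  assumes "k \<in> hom (free_group S) G" "l \<in> hom G (free_group S)"
    and "\<And>x. x \<in> S \<Longrightarrow> l (k (free_gen x)) = free_gen x" and "w \<in> carrier (free_group S)"
  shows "l (k w) = w"
proof -
  have "(l \<circ> k) w = w"
    using assms(3) by (intro free_group_hom_eqI[OF group_free_group hom_compose[OF assms(1,2)]
          group.id_hom[OF group_free_group] _ assms(4)]) simp
  then show ?thesis by simp
qed

lemma free_embedding_exists: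
  fixes F :: "('f, 'm) monoid_scheme"
  assumes F: "group F" and iso: "F \<cong> free_group {..<n::nat}"
  obtains e T where "free_embedding F e T"
proof -
  obtain i where i: "i \<in> iso F (free_group {..<n})" using iso by (auto simp: is_iso_def)
  let ?T = "Agen ` {..<n}"
  define j where "j = free_ext (free_group ?T) (\<lambda>x. free_gen (Agen x))"
  \<comment> \<open>The value on \<open>Bgen\<close> is a default, as \<open>?T\<close> contains no
    such generator.\<close>
  define l where "l = free_ext (free_group {..<n}) (\<lambda>y. case y of Agen x \<Rightarrow> free_gen x | Bgen x \<Rightarrow> free_gen x)"
  interpret T: group "free_group ?T" by (rule group_free_group)
  interpret N: group "free_group {..<n}" by (rule group_free_group)
  have "(\<lambda>x. free_gen (Agen x)) \<in> {..<n} \<rightarrow> carrier (free_group ?T)"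
    by (auto intro: free_gen_closed)
  note j = T.free_ext_gen_hom[OF this, folded j_def]
  have "(\<lambda>y. case y of Agen x \<Rightarrow> free_gen x | Bgen x \<Rightarrow> free_gen x) \<in> ?T \<rightarrow> carrier (free_group {..<n})"
    by (auto intro: free_gen_closed)
  note l = N.free_ext_gen_hom[OF this, folded l_def]
  have "l (j w) = w" if "w \<in> carrier (free_group {..<n})" for w
    by (rule free_group_left_inverse[OF j(1) l(1) _ that]) (auto simp: j l)
  then have "inj_on j (carrier (free_group {..<n}))" by (rule inj_on_inverseI)
  moreover have "i ` carrier F = carrier (free_group {..<n})" "inj_on i (carrier F)"
    using i by (auto simp: iso_def bij_betw_def)
  ultimately have "inj_on (j \<circ> i) (carrier F)" by (intro comp_inj_on) auto
  moreover have "j \<circ> i \<in> hom F (free_group ?T)"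
    using i j(1) by (auto simp: iso_def intro: hom_compose)
  ultimately have "free_embedding F (j \<circ> i) ?T"
    using F by (simp add: free_embedding_def free_embedding_axioms_def)
  then show thesis by (rule that)
qed

lemma generate_subset_hom_eqI:
  assumes "group G" "group K" "h \<in> hom G K" "k \<in> hom G K" "Y \<subseteq> carrier G"
    and "\<And>x. x \<in> Y \<Longrightarrow> h x = k x" and "w \<in> generate G Y"
  shows "h w = k w"
proof -
  interpret h: group_hom G K h using assms by (simp add: group_hom_def group_hom_axioms_def)
  interpret k: group_hom G K k using assms by (simp add: group_hom_def group_hom_axioms_def)
  have sub: "generate G Y \<subseteq> carrier G" using h.G.generate_incl[OF assms(5)] .
  show ?thesis using assms(7)
  proof (induction w rule: generate.induct)
    case one
    show ?case using h.hom_one k.hom_one by simp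
  next
    case (incl x)
    then show ?case by (rule assms(6))
  next
    case (inv x)
    then show ?case using assms(5,6) by (auto simp: subset_iff)
  next
    case (eng u v)
    then have "u \<in> carrier G" "v \<in> carrier G" using sub by auto
    then show ?case using eng.IH by simp
  qed
qed

lemma num_le_solid_bound:
  assumes F: "group F" and sb: "solid_bound F g N"
  shows "num F g x \<le> enat N"
proof (cases "sim_injective_reps F g x = {}")
  case True
  then show ?thesis by (simp add: num_def ecount_def quotient_def)
next
  case False
  interpret H: group "Hgrp g" by (rule group_Hgrp)
  \<comment> \<open>The bound is about a homomorphism from \<open>Pgrp g\<close>. The one that sends
    the boundary word to \<open>x\<close> is obtained by restricting a representation, and in this
    case there is one.\<close>
  obtain h0 where "h0 \<in> sim_injective_reps F g x" using False by blast
  then have h0: "h0 \<in> hom (Hgrp g) F" "h0 (bdry g) = x"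
    by (auto simp: sim_injective_reps_def genus_reps_def ext_hom_def)
  have P: "Pgrp g \<subseteq> carrier (Hgrp g)"
    unfolding Pgrp_def by (rule H.generate_incl) (simp add: bdry_closed)
  obtain \<Q> :: "squot set" where \<Q>: "\<And>Q. Q \<in> \<Q> \<Longrightarrow> proper_quotient g Q"
    and bound: "\<And>p. p \<in> hom (Hgrp g\<lparr>carrier := Pgrp g\<rparr>) F \<Longrightarrow>
           ecount ({h \<in> extensions F g p.
                      \<forall>h'. (h, h') \<in> dehn_equiv F g (p (bdry g)) \<longrightarrow>
                        (\<forall>Q\<in>\<Q>. \<not> factors_through F g h' Q)}
                   // dehn_equiv F g (p (bdry g))) \<le> enat N"
    using sb unfolding solid_bound_def by blast
  let ?E = "{h \<in> extensions F g h0. \<forall>h'. (h, h') \<in> dehn_equiv F g x \<longrightarrow>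
                        (\<forall>Q\<in>\<Q>. \<not> factors_through F g h' Q)}"
  have le: "ecount (?E // dehn_equiv F g x) \<le> enat N"
    using bound[OF hom_restrict_carrier[OF h0(1) P]] h0(2) by simp
  have "sim_injective_reps F g x \<subseteq> ?E"
  proof
    fix h assume h: "h \<in> sim_injective_reps F g x"
    then have hr: "h \<in> ext_hom (Hgrp g) F" "h (bdry g) = x"
      by (auto simp: sim_injective_reps_def genus_reps_def)
    have "h w = h0 w" if "w \<in> Pgrp g" for w
      by (rule generate_subset_hom_eqI[OF group_Hgrp F, of h g h0 "{bdry g}"])
        (use hr h0 that in \<open>simp_all add: ext_hom_def bdry_closed Pgrp_def\<close>)
    then have "h \<in> extensions F g h0" using hr(1) by (simp add: extensions_def)
    moreover have "\<not> factors_through F g h' Q" if "(h, h') \<in> dehn_equiv F g x" "Q \<in> \<Q>" for h' Q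
    proof
      assume "factors_through F g h' Q"
      then obtain k where k: "\<And>w. w \<in> carrier (Hgrp g) \<Longrightarrow> h' w = k (snd Q w)"
        unfolding factors_through_def by blast
      have "inj_on h' (carrier (Hgrp g))"
        using h that(1) by (simp add: sim_injective_reps_def)
      then have "inj_on (snd Q) (carrier (Hgrp g))"
        by (intro inj_onI) (simp add: inj_on_def k)
      then show False using \<Q>[OF that(2)] by (simp add: proper_quotient_def)
    qed
    ultimately show "h \<in> ?E" by blast
  qed
  then have "sim_injective_reps F g x // dehn_equiv F g x \<subseteq> ?E // dehn_equiv F g x"
    by (auto simp: quotient_def)
  moreover have "finite (?E // dehn_equiv F g x)" "card (?E // dehn_equiv F g x) \<le> N"
    using le by (auto simp: ecount_def split: if_splits)
  ultimately have "finite (sim_injective_reps F g x // dehn_equiv F g x)"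
    "card (sim_injective_reps F g x // dehn_equiv F g x) \<le> N"
    by (blast intro: finite_subset, blast intro: card_mono order_trans)
  then show ?thesis by (simp add: num_def ecount_def)
qed

lemma fF_le_solid_bound:
  assumes "group F" "solid_bound F g N"
  shows "fF F g \<le> enat N"
  unfolding fF_def using num_le_solid_bound[OF assms] by (rule SUP_least)

section \<open>Primitive embeddings\<close>

definition primitive_embedding ::
  "('a \<Rightarrow> 'b) \<Rightarrow> ('a, 'm) monoid_scheme \<Rightarrow> ('b, 'n) monoid_scheme \<Rightarrow> bool" where
  "primitive_embedding h G K \<longleftrightarrow>
     h \<in> hom G K \<and> inj_on h (carrier G) \<and> primitive_subgroup (h ` carrier G) K"

lemma primitive_embeddingI:
  assumes G: "group G" and K: "group K" and h: "h \<in> hom G K" "inj_on h (carrier G)"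
    and prim: "\<And>t n w. t \<in> carrier K \<Longrightarrow> n \<ge> 1 \<Longrightarrow> w \<in> carrier G \<Longrightarrow>
      t [^]\<^bsub>K\<^esub> (n::nat) = h w \<Longrightarrow> \<exists>v\<in>carrier G. t = h v"
  shows "primitive_embedding h G K"
proof -
  interpret group_hom G K h using assms by (simp add: group_hom_def group_hom_axioms_def)
  have "subgroup (h ` carrier G) K" by (rule img_is_subgroup)
  then show ?thesis
    using h prim unfolding primitive_embedding_def primitive_subgroup_def by blast
qed

lemma primitive_embedding_compose:
  assumes G: "group G" and K: "group K" and L: "group L"
    and h: "primitive_embedding h G K" and k: "primitive_embedding k K L"
  shows "primitive_embedding (k \<circ> h) G L"
proof -
  have hom: "h \<in> hom G K" "k \<in> hom K L" and inj: "inj_on h (carrier G)" "inj_on k (carrier K)"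
    using h k by (auto simp: primitive_embedding_def)
  interpret k: group_hom K L k using K L hom by (simp add: group_hom_def group_hom_axioms_def)
  have hc: "h ` carrier G \<subseteq> carrier K" using hom(1) by (auto simp: hom_def)
  show ?thesis
  proof (rule primitive_embeddingI[OF G L])
    show "k \<circ> h \<in> hom G L" by (rule hom_compose[OF hom])
    show "inj_on (k \<circ> h) (carrier G)"
      using inj hc by (auto intro: comp_inj_on inj_on_subset)
    fix t n w assume t: "t \<in> carrier L" "n \<ge> (1::nat)" "w \<in> carrier G" "t [^]\<^bsub>L\<^esub> n = (k \<circ> h) w"
    then have hw: "h w \<in> carrier K" using hc by blast
    then have "t \<in> k ` carrier K"
      using k t unfolding primitive_embedding_def primitive_subgroup_def by fastforce
    then obtain u where u: "u \<in> carrier K" "t = k u" by blast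
    then have "k (u [^]\<^bsub>K\<^esub> n) = k (h w)" using t(4) by (simp add: k.hom_nat_pow)
    then have "u [^]\<^bsub>K\<^esub> n = h w"
      using inj(2) u(1) hw by (meson inj_onD k.G.nat_pow_closed)
    then have "u \<in> h ` carrier G"
      using h t(2,3) u(1) unfolding primitive_embedding_def primitive_subgroup_def by blast
    then show "\<exists>v\<in>carrier G. t = (k \<circ> h) v" using u(2) by auto
  qed
qed

text \<open>If t^n is in the image, the idempotent h r fixes it, so h (r t) and t are roots of the
  same element and coincide.\<close>

lemma primitive_embedding_retract:
  assumes G: "group G" and h: "h \<in> hom G (free_group S)" and r: "r \<in> hom (free_group S) G"
    and rh: "\<And>w. w \<in> carrier G \<Longrightarrow> r (h w) = w"
  shows "primitive_embedding h G (free_group S)"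
proof -
  interpret h: group_hom G "free_group S" h
    using G h by (simp add: group_hom_def group_hom_axioms_def group_free_group)
  interpret r: group_hom "free_group S" G r
    using G r by (simp add: group_hom_def group_hom_axioms_def group_free_group)
  show ?thesis
  proof (rule primitive_embeddingI[OF G group_free_group h])
    show "inj_on h (carrier G)" using rh by (rule inj_on_inverseI)
    fix t n w assume t: "t \<in> carrier (free_group S)" "n \<ge> (1::nat)" "w \<in> carrier G"
      "t [^]\<^bsub>free_group S\<^esub> n = h w"
    have "h (r t) [^]\<^bsub>free_group S\<^esub> n = h (r (t [^]\<^bsub>free_group S\<^esub> n))"
      using t(1) by (simp add: h.hom_nat_pow r.hom_nat_pow)
    also have "\<dots> = t [^]\<^bsub>free_group S\<^esub> n"
      using t(3,4) rh by simp
    finally have "h (r t) = t"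
      using free_group_unique_roots t(1,2) by (metis h.hom_closed r.hom_closed)
    then show "\<exists>v\<in>carrier G. t = h v" using t(1) by (metis r.hom_closed)
  qed
qed

lemma primitive_embedding_bij:
  assumes G: "group G" and K: "group K" and h: "h \<in> hom G K"
    and bij: "bij_betw h (carrier G) (carrier K)"
  shows "primitive_embedding h G K"
  by (rule primitive_embeddingI[OF G K h]) (use bij in \<open>auto simp: bij_betw_def\<close>)

section \<open>The kernel of a retraction between free groups\<close>

definition semidirect ::
  "('a, 'm) monoid_scheme \<Rightarrow> ('b, 'n) monoid_scheme \<Rightarrow> ('b \<Rightarrow> 'a \<Rightarrow> 'a) \<Rightarrow> ('a \<times> 'b) monoid" where
  "semidirect K Q act = \<lparr>carrier = carrier K \<times> carrier Q,
     monoid.mult = (\<lambda>(k, q) (k', q'). (k \<otimes>\<^bsub>K\<^esub> act q k', q \<otimes>\<^bsub>Q\<^esub> q')),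
     one = (\<one>\<^bsub>K\<^esub>, \<one>\<^bsub>Q\<^esub>)\<rparr>"

lemma semidirect_simps [simp]:
  "carrier (semidirect K Q act) = carrier K \<times> carrier Q"
  "(k, q) \<otimes>\<^bsub>semidirect K Q act\<^esub> (k', q') = (k \<otimes>\<^bsub>K\<^esub> act q k', q \<otimes>\<^bsub>Q\<^esub> q')"
  "\<one>\<^bsub>semidirect K Q act\<^esub> = (\<one>\<^bsub>K\<^esub>, \<one>\<^bsub>Q\<^esub>)"
  by (simp_all add: semidirect_def)

lemma group_semidirect:
  assumes "group K" "group Q" and hom: "\<And>q. q \<in> carrier Q \<Longrightarrow> act q \<in> hom K K"
    and mult: "\<And>q q' k. q \<in> carrier Q \<Longrightarrow> q' \<in> carrier Q \<Longrightarrow> k \<in> carrier K \<Longrightarrow>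
      act (q \<otimes>\<^bsub>Q\<^esub> q') k = act q (act q' k)"
    and one: "\<And>k. k \<in> carrier K \<Longrightarrow> act \<one>\<^bsub>Q\<^esub> k = k"
  shows "group (semidirect K Q act)"
proof -
  interpret K: group K by fact
  interpret Q: group Q by fact
  have cl: "act q k \<in> carrier K" if "q \<in> carrier Q" "k \<in> carrier K" for q k
    using hom[OF that(1)] that(2) by (auto simp: hom_def)
  have hm: "act q (k \<otimes>\<^bsub>K\<^esub> k') = act q k \<otimes>\<^bsub>K\<^esub> act q k'"
    if "q \<in> carrier Q" "k \<in> carrier K" "k' \<in> carrier K" for q k k'
    using hom[OF that(1)] that(2,3) by (auto simp: hom_def)
  have h1: "act q \<one>\<^bsub>K\<^esub> = \<one>\<^bsub>K\<^esub>" if "q \<in> carrier Q" for q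
    using hom_one[OF hom[OF that]] assms(1) by simp
  show ?thesis
  proof (rule groupI)
    fix u assume "u \<in> carrier (semidirect K Q act)"
    then obtain k q where u: "u = (k, q)" "k \<in> carrier K" "q \<in> carrier Q" by auto
    let ?v = "(act (inv\<^bsub>Q\<^esub> q) (inv\<^bsub>K\<^esub> k), inv\<^bsub>Q\<^esub> q)"
    have "?v \<otimes>\<^bsub>semidirect K Q act\<^esub> u = \<one>\<^bsub>semidirect K Q act\<^esub>"
      using u by (simp add: h1 flip: hm)
    moreover have "?v \<in> carrier (semidirect K Q act)" using u by (simp add: cl)
    ultimately show "\<exists>v\<in>carrier (semidirect K Q act).
      v \<otimes>\<^bsub>semidirect K Q act\<^esub> u = \<one>\<^bsub>semidirect K Q act\<^esub>" by blast
  qed (auto simp: cl hm mult one K.m_assoc Q.m_assoc)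
qed

lemma free_group_subset_hom: "Y \<subseteq> S \<Longrightarrow> (\<lambda>w. w) \<in> hom (free_group Y) (free_group S)"
  by (fastforce simp: hom_def carrier_free_group mult_free_group)

text \<open>
  The kernel of the retraction of \<open>F(X \<union> Y)\<close> to \<open>F(Y)\<close> is free on the conjugates
  \<open>u x u\<^sup>-\<^sup>1\<close>, since \<open>F(X \<union> Y)\<close> is isomorphic to the semidirect product
  \<open>F(X \<times> F(Y)) \<rtimes> F(Y)\<close>; it is primitive because \<open>F(Y)\<close> is torsion-free.
\<close>
lemma primitive_embedding_conjugates:
  fixes Y Z :: "'x set"
  assumes disj: "Z \<inter> Y = {}"
  defines "\<theta> \<equiv> free_ext (free_group (Z \<union> Y))
    (\<lambda>(x, u). u \<otimes>\<^bsub>free_group (Z \<union> Y)\<^esub> free_gen x \<otimes>\<^bsub>free_group (Z \<union> Y)\<^esub> inv\<^bsub>free_group (Z \<union> Y)\<^esub> u)"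
  shows "primitive_embedding \<theta> (free_group (Z \<times> carrier (free_group Y))) (free_group (Z \<union> Y))"
proof -
  let ?G = "free_group (Z \<union> Y)" and ?Q = "free_group Y"
  let ?K = "free_group (Z \<times> carrier ?Q)"
  interpret G: group ?G by (rule group_free_group)
  interpret Q: group ?Q by (rule group_free_group)
  interpret K: group ?K by (rule group_free_group)
  have QG: "u \<in> carrier ?G" if "u \<in> carrier ?Q" for u
    using that by (auto simp: carrier_free_group)
  have mQG: "u \<otimes>\<^bsub>?G\<^esub> v = u \<otimes>\<^bsub>?Q\<^esub> v" for u v by (simp add: mult_free_group)
  \<comment> \<open>Translating the index \<open>u\<close> by \<open>q\<close> corresponds under
    \<open>\<theta>\<close> to conjugation by \<open>q\<close>, as \<open>\<theta>_act\<close>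
    confirms; this is why \<open>\<mu>\<close> below is multiplicative.\<close>
  define act where "act q = free_ext ?K (\<lambda>(x, u). free_gen (x, q \<otimes>\<^bsub>?Q\<^esub> u))" for q
  have act: "act q \<in> hom ?K ?K"
    "\<And>z. z \<in> Z \<times> carrier ?Q \<Longrightarrow> act q (free_gen z) = free_gen (fst z, q \<otimes>\<^bsub>?Q\<^esub> snd z)"
    if "q \<in> carrier ?Q" for q
  proof -
    have "(\<lambda>(x, u). free_gen (x, q \<otimes>\<^bsub>?Q\<^esub> u)) \<in> Z \<times> carrier ?Q \<rightarrow> carrier ?K"
      using that by (auto intro!: free_gen_closed)
    note K.free_ext_gen_hom[OF this, folded act_def]
    then show "act q \<in> hom ?K ?K"
      "\<And>z. z \<in> Z \<times> carrier ?Q \<Longrightarrow> act q (free_gen z) = free_gen (fst z, q \<otimes>\<^bsub>?Q\<^esub> snd z)"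
      by (auto simp: split_beta)
  qed
  have act_mult: "act (q \<otimes>\<^bsub>?Q\<^esub> q') k = act q (act q' k)"
    if "q \<in> carrier ?Q" "q' \<in> carrier ?Q" "k \<in> carrier ?K" for q q' k
  proof -
    have "act (q \<otimes>\<^bsub>?Q\<^esub> q') k = (act q \<circ> act q') k"
      by (rule free_group_hom_eqI[OF group_free_group act(1) hom_compose[OF act(1) act(1)] _ that(3)])
        (use that in \<open>auto simp: act Q.m_assoc\<close>)
    then show ?thesis by simp
  qed
  have act_one: "act \<one>\<^bsub>?Q\<^esub> k = k" if "k \<in> carrier ?K" for k
    by (rule free_group_hom_eqI[OF group_free_group act(1) K.id_hom _ that]) (auto simp: act)
  let ?M = "semidirect ?K ?Q act"
  interpret M: group ?M
    by (rule group_semidirect[OF group_free_group group_free_group act(1) act_mult act_one])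
  \<comment> \<open>This is the map to the semidirect product, with left inverse
    \<open>\<mu>\<close>; together they write each t as \<open>\<theta>\<close> of its first
    component times its second component.\<close>
  define \<rho> where "\<rho> = free_ext ?M (\<lambda>z. if z \<in> Z then (free_gen (z, \<one>\<^bsub>?Q\<^esub>), \<one>\<^bsub>?Q\<^esub>) else (\<one>\<^bsub>?K\<^esub>, free_gen z))"
  have "(\<lambda>z. if z \<in> Z then (free_gen (z, \<one>\<^bsub>?Q\<^esub>), \<one>\<^bsub>?Q\<^esub>) else (\<one>\<^bsub>?K\<^esub>, free_gen z))
      \<in> Z \<union> Y \<rightarrow> carrier ?M"
    by (auto intro!: free_gen_closed)
  note \<rho> = M.free_ext_gen_hom[OF this, folded \<rho>_def]
  interpret \<rho>: group_hom ?G ?M \<rho> using \<rho>(1) by unfold_locales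
  have "(\<lambda>(x, u). u \<otimes>\<^bsub>?G\<^esub> free_gen x \<otimes>\<^bsub>?G\<^esub> inv\<^bsub>?G\<^esub> u) \<in> Z \<times> carrier ?Q \<rightarrow> carrier ?G"
    by (auto simp: free_gen_closed QG)
  note \<theta> = G.free_ext_gen_hom[OF this, folded \<theta>_def]
  interpret \<theta>: group_hom ?K ?G \<theta> using \<theta>(1) by unfold_locales
  have act1: "act q \<one>\<^bsub>?K\<^esub> = \<one>\<^bsub>?K\<^esub>" if "q \<in> carrier ?Q" for q
    using hom_one[OF act(1)[OF that]] K.is_group by simp
  have \<rho>Q: "\<rho> u = (\<one>\<^bsub>?K\<^esub>, u)" if "u \<in> carrier ?Q" for u
  proof -
    have "(\<rho> \<circ> (\<lambda>w. w)) u = (\<one>\<^bsub>?K\<^esub>, u)"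
    proof (rule free_group_hom_eqI[OF M.is_group hom_compose[OF free_group_subset_hom \<rho>(1)] _ _ that])
      show "(\<lambda>u. (\<one>\<^bsub>?K\<^esub>, u)) \<in> hom ?Q ?M" by (auto simp: hom_def act1)
      show "(\<rho> \<circ> (\<lambda>w. w)) (free_gen x) = (\<one>\<^bsub>?K\<^esub>, free_gen x)" if "x \<in> Y" for x
        using disj that by (auto simp: \<rho>)
    qed auto
    then show ?thesis by simp
  qed
  have \<rho>\<theta>: "\<rho> (\<theta> k) = (k, \<one>\<^bsub>?Q\<^esub>)" if "k \<in> carrier ?K" for k
  proof -
    have "(\<rho> \<circ> \<theta>) k = (k, \<one>\<^bsub>?Q\<^esub>)"
    proof (rule free_group_hom_eqI[OF M.is_group hom_compose[OF \<theta>(1) \<rho>(1)] _ _ that])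
      show "(\<lambda>k. (k, \<one>\<^bsub>?Q\<^esub>)) \<in> hom ?K ?M" by (auto simp: hom_def act_one)
      fix z assume z: "z \<in> Z \<times> carrier ?Q"
      then obtain x u where xu: "z = (x, u)" "x \<in> Z" "u \<in> carrier ?Q" by auto
      have gx: "free_gen x \<in> carrier ?G" using xu by (simp add: free_gen_closed)
      have "inv\<^bsub>?M\<^esub> (\<rho> u) = (\<one>\<^bsub>?K\<^esub>, inv\<^bsub>?Q\<^esub> u)"
        by (rule M.inv_equality) (use xu in \<open>auto simp: \<rho>Q act1\<close>)
      moreover have "\<rho> (free_gen x) = (free_gen (x, \<one>\<^bsub>?Q\<^esub>), \<one>\<^bsub>?Q\<^esub>)" using \<rho>(2)[of x] xu by simp
      moreover have "(\<rho> \<circ> \<theta>) (free_gen z) = \<rho> u \<otimes>\<^bsub>?M\<^esub> \<rho> (free_gen x) \<otimes>\<^bsub>?M\<^esub> inv\<^bsub>?M\<^esub> (\<rho> u)"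
        using \<theta>(2)[OF z] xu(1) gx QG[OF xu(3)] by simp
      moreover have "free_gen (x, u) \<in> carrier ?K" using xu by (simp add: free_gen_closed)
      ultimately show "(\<rho> \<circ> \<theta>) (free_gen z) = (free_gen z, \<one>\<^bsub>?Q\<^esub>)"
        using xu by (simp add: \<rho>Q act act1)
    qed
    then show ?thesis by simp
  qed
  have \<theta>_act: "\<theta> (act q k) = q \<otimes>\<^bsub>?G\<^esub> \<theta> k \<otimes>\<^bsub>?G\<^esub> inv\<^bsub>?G\<^esub> q" if "q \<in> carrier ?Q" "k \<in> carrier ?K" for q k
  proof -
    have "(\<theta> \<circ> act q) k = ((\<lambda>w. q \<otimes>\<^bsub>?G\<^esub> w \<otimes>\<^bsub>?G\<^esub> inv\<^bsub>?G\<^esub> q) \<circ> \<theta>) k"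
    proof (rule free_group_hom_eqI[OF group_free_group hom_compose[OF act(1) \<theta>(1)]
          hom_compose[OF \<theta>(1) G.conj_hom] _ that(2)])
      fix z assume z: "z \<in> Z \<times> carrier ?Q"
      then obtain x u where xu: "z = (x, u)" "x \<in> Z" "u \<in> carrier ?Q" by auto
      have gx: "free_gen x \<in> carrier ?G" using xu by (simp add: free_gen_closed)
      have "\<theta> (act q (free_gen z)) = \<theta> (free_gen (x, q \<otimes>\<^bsub>?Q\<^esub> u))" using act(2)[OF that(1) z] xu(1) by simp
      also have "\<dots> = (q \<otimes>\<^bsub>?G\<^esub> u) \<otimes>\<^bsub>?G\<^esub> free_gen x \<otimes>\<^bsub>?G\<^esub> inv\<^bsub>?G\<^esub> (q \<otimes>\<^bsub>?G\<^esub> u)"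
        using \<theta>(2)[of "(x, q \<otimes>\<^bsub>?Q\<^esub> u)"] xu that(1) by (simp add: mQG)
      also have "\<dots> = q \<otimes>\<^bsub>?G\<^esub> \<theta> (free_gen z) \<otimes>\<^bsub>?G\<^esub> inv\<^bsub>?G\<^esub> q"
        using \<theta>(2)[OF z] xu gx QG[OF that(1)] QG[OF xu(3)] by (simp add: G.m_assoc G.inv_mult_group)
      finally show "(\<theta> \<circ> act q) (free_gen z) = ((\<lambda>w. q \<otimes>\<^bsub>?G\<^esub> w \<otimes>\<^bsub>?G\<^esub> inv\<^bsub>?G\<^esub> q) \<circ> \<theta>) (free_gen z)"
        by simp
    qed (use that QG in auto)
    then show ?thesis by simp
  qed
  define \<mu> where "\<mu> = (\<lambda>(k, q). \<theta> k \<otimes>\<^bsub>?G\<^esub> q)"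
  have \<mu>: "\<mu> \<in> hom ?M ?G"
  proof (rule homI)
    fix m m' assume "m \<in> carrier ?M" "m' \<in> carrier ?M"
    then obtain k q k' q' where m: "m = (k, q)" "m' = (k', q')" "k \<in> carrier ?K" "k' \<in> carrier ?K"
      "q \<in> carrier ?Q" "q' \<in> carrier ?Q" by auto
    have "act q k' \<in> carrier ?K" using act(1)[OF m(5)] m(4) by (auto simp: hom_def)
    then show "\<mu> (m \<otimes>\<^bsub>?M\<^esub> m') = \<mu> m \<otimes>\<^bsub>?G\<^esub> \<mu> m'"
      using m QG[OF m(5)] QG[OF m(6)]
      by (simp add: \<mu>_def \<theta>_act G.m_assoc G.inv_mult_cancel flip: mQG)
  qed (auto simp: \<mu>_def QG)
  have \<mu>\<rho>: "\<mu> (\<rho> t) = t" if "t \<in> carrier ?G" for t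
  proof (rule free_group_left_inverse[OF \<rho>(1) \<mu> _ that])
    fix z assume z: "z \<in> Z \<union> Y"
    show "\<mu> (\<rho> (free_gen z)) = free_gen z"
    proof (cases "z \<in> Z")
      case True
      then have "\<theta> (free_gen (z, \<one>\<^bsub>?Q\<^esub>)) = free_gen z"
        using \<theta>(2)[of "(z, \<one>\<^bsub>?Q\<^esub>)"] free_gen_closed[of z "Z \<union> Y"] Q.one_closed
        by (simp add: one_free_group[of Y] flip: one_free_group[of "Z \<union> Y"])
      then show ?thesis
        using True z free_gen_closed[of z "Z \<union> Y"] \<rho>(2)[of z]
        by (simp add: \<mu>_def one_free_group[of Y] flip: one_free_group[of "Z \<union> Y"])
    next
      case False
      then show ?thesis
        using z free_gen_closed[of z "Z \<union> Y"] \<rho>(2)[of z] by (simp add: \<mu>_def)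
    qed
  qed
  show ?thesis
  proof (rule primitive_embeddingI[OF group_free_group group_free_group \<theta>(1)])
    show "inj_on \<theta> (carrier ?K)"
      using \<rho>\<theta> by (intro inj_on_inverseI[of _ "\<lambda>w. fst (\<rho> w)"]) simp
    fix t n k assume t: "t \<in> carrier ?G" "n \<ge> (1::nat)" "k \<in> carrier ?K" "t [^]\<^bsub>?G\<^esub> n = \<theta> k"
    have "(\<lambda>m. snd m) \<in> hom ?M ?Q" by (auto simp: hom_def)
    then interpret s: group_hom ?M ?Q "\<lambda>m. snd m" by unfold_locales
    \<comment> \<open>The second component of \<open>t\<close> is a root of 1, hence trivial by
      uniqueness of roots.\<close>
    have "snd (\<rho> t) [^]\<^bsub>?Q\<^esub> n = snd (\<rho> (t [^]\<^bsub>?G\<^esub> n))"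
      using t(1) by (simp add: \<rho>.hom_nat_pow s.hom_nat_pow del: semidirect_simps(1))
    also have "\<dots> = \<one>\<^bsub>?Q\<^esub> [^]\<^bsub>?Q\<^esub> n"
      using \<rho>\<theta>[OF t(3)] t(4) by simp
    finally have s1: "snd (\<rho> t) = \<one>\<^bsub>?Q\<^esub>"
      using free_group_unique_roots[OF _ _ t(2)] s.hom_closed[OF \<rho>.hom_closed[OF t(1)]] by blast
    have fk: "fst (\<rho> t) \<in> carrier ?K" using \<rho>.hom_closed[OF t(1)] by (auto simp: mem_Times_iff)
    have "t = \<theta> (fst (\<rho> t)) \<otimes>\<^bsub>?G\<^esub> snd (\<rho> t)"
      using \<mu>\<rho>[OF t(1)] by (simp add: \<mu>_def split_beta)
    also have "\<dots> = \<theta> (fst (\<rho> t))"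
      using s1 \<theta>.hom_closed[OF fk] by (simp add: one_free_group[of Y] flip: one_free_group[of "Z \<union> Y"])
    finally show "\<exists>v\<in>carrier ?K. t = \<theta> v" using fk by blast
  qed
qed

section \<open>Representations with different images\<close>

lemma inv_free_group:
  assumes "w \<in> carrier (free_group S)"
  shows "inv\<^bsub>free_group S\<^esub> w = inv_word w"
proof -
  interpret group "free_group S" by (rule group_free_group)
  have r: "reduced w" using assms by (simp add: carrier_free_group)
  have "reduced (inv_word w)"
  proof -
    have "reduced (rev w)" using r
      by (auto simp: reduced_def successively_rev intro: successively_mono)
    then show ?thesis
      by (auto simp: reduced_def inv_word_def successively_map rev_map intro: successively_mono)
  qed
  then have "inv_word w \<in> carrier (free_group S)"
    using assms by (fastforce simp: carrier_free_group inv_word_def)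
  moreover have "inv_word w \<otimes>\<^bsub>free_group S\<^esub> w = \<one>\<^bsub>free_group S\<^esub>"
    using foldr_push_inverse[of "[]" w] foldr_push_Nil[OF r]
    by (simp add: mult_free_group one_free_group inv_word_def)
  ultimately show ?thesis using assms by (simp add: inv_equality)
qed

section \<open>A primitive copy of \<open>H\<^sub>g\<close> in a nonabelian free group\<close>

lemma comm_group_iso:
  assumes "group F" "F \<cong> K" "comm_group K"
  shows "comm_group F"
proof -
  interpret F: group F by fact
  interpret K: comm_group K by fact
  obtain i where i: "i \<in> iso F K" using assms(2) by (auto simp: is_iso_def)
  interpret i: group_hom F K i
    using i assms(1) K.is_group by (simp add: group_hom_def group_hom_axioms_def iso_def)
  show ?thesis
  proof (rule F.group_comm_groupI)
    fix u v assume uv: "u \<in> carrier F" "v \<in> carrier F"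
    then have "i (u \<otimes>\<^bsub>F\<^esub> v) = i (v \<otimes>\<^bsub>F\<^esub> u)" by (simp add: K.m_comm)
    moreover have "inj_on i (carrier F)" using i by (simp add: iso_def bij_betw_def)
    ultimately show "u \<otimes>\<^bsub>F\<^esub> v = v \<otimes>\<^bsub>F\<^esub> u"
      using uv by (meson F.m_closed inj_onD)
  qed
qed

text \<open>An element commuting with all generators commutes with everything, since conjugation by
  it is a homomorphism that fixes the generators. This is applied to the single generator and then,
  by symmetry, to an arbitrary element.\<close>

lemma comm_group_free_group_singleton:
  assumes "S \<subseteq> {a}"
  shows "comm_group (free_group S)"
proof -
  interpret group "free_group S" by (rule group_free_group)
  have eq: "u \<otimes>\<^bsub>free_group S\<^esub> v = v \<otimes>\<^bsub>free_group S\<^esub> u"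
    if u: "u \<in> carrier (free_group S)" and v: "v \<in> carrier (free_group S)"
      and g: "\<And>x. x \<in> S \<Longrightarrow> u \<otimes>\<^bsub>free_group S\<^esub> free_gen x = free_gen x \<otimes>\<^bsub>free_group S\<^esub> u" for u v
  proof -
    have conj: "u \<otimes>\<^bsub>free_group S\<^esub> v \<otimes>\<^bsub>free_group S\<^esub> inv\<^bsub>free_group S\<^esub> u = v"
      by (rule free_group_hom_eqI[OF group_free_group conj_hom[OF u] id_hom _ v])
        (use u g in \<open>simp add: free_gen_closed m_assoc\<close>)
    have "u \<otimes>\<^bsub>free_group S\<^esub> v = u \<otimes>\<^bsub>free_group S\<^esub> v \<otimes>\<^bsub>free_group S\<^esub> inv\<^bsub>free_group S\<^esub> u \<otimes>\<^bsub>free_group S\<^esub> u"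
      using u v by (simp add: m_assoc)
    then show ?thesis by (simp only: conj)
  qed
  have "u \<otimes>\<^bsub>free_group S\<^esub> free_gen x = free_gen x \<otimes>\<^bsub>free_group S\<^esub> u"
    if "u \<in> carrier (free_group S)" "x \<in> S" for u x
    by (rule eq[symmetric, OF free_gen_closed[OF that(2)] that(1)]) (use that assms in auto)
  then show ?thesis using group_comm_groupI eq by blast
qed

text \<open>The normal closure of generator 0 is free on infinitely many conjugates. Any 2g of them
  span a retract, which is primitive in the closure, and the closure is primitive in the whole
  group.\<close>

lemma primitive_embedding_Hgrp_free_group:
  assumes "n \<ge> 2"
  shows "\<exists>\<phi>. primitive_embedding \<phi> (Hgrp g) (free_group {..<n::nat})"
proof -
  let ?S = "Agen ` {1..g} \<union> Bgen ` {1..g}" and ?Q = "free_group {1..<n}"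
  let ?K = "free_group ({0 :: nat} \<times> carrier ?Q)"
  interpret H: group "Hgrp g" by (rule group_Hgrp)
  interpret K: group ?K by (rule group_free_group)
  define y :: "nat \<Rightarrow> nat word" where "y j = replicate j (1, True)" for j
  have y: "y j \<in> carrier ?Q" for j
  proof -
    have "reduced (y j)" unfolding y_def
    proof (induction j)
      case (Suc j)
      then show ?case by (cases j) (auto simp: reduced_def)
    qed simp
    then show ?thesis using assms by (auto simp: carrier_free_group y_def)
  qed
  \<comment> \<open>The conjugators are powers of generator 1, which exists as
    \<open>n \<ge> 2\<close>: even exponents for \<open>a\<^sub>i\<close>, odd ones for
    \<open>b\<^sub>i\<close>.\<close>
  define \<eta> where "\<eta> = free_ext ?K (\<lambda>z. case z of Agen i \<Rightarrow> free_gen (0 :: nat, y (2 * i))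
      | Bgen i \<Rightarrow> free_gen (0, y (2 * i + 1)))"
  have "(\<lambda>z. case z of Agen i \<Rightarrow> free_gen (0 :: nat, y (2 * i)) | Bgen i \<Rightarrow> free_gen (0, y (2 * i + 1)))
      \<in> ?S \<rightarrow> carrier ?K"
    using y by (auto simp: free_gen_closed)
  note \<eta> = K.free_ext_gen_hom[OF this, folded \<eta>_def Hgrp_def]
  \<comment> \<open>The index and the kind of generator are read off from the length of the
    conjugator. Other conjugators of the same length get the same value, which is harmless:
    \<open>r\<close> only has to invert \<open>\<eta>\<close>.\<close>
  define r where "r = free_ext (Hgrp g) (\<lambda>(x :: nat, u :: nat word). let i = length u div 2 in
      if i \<in> {1..g} then free_gen (if even (length u) then Agen i else Bgen i) else \<one>\<^bsub>Hgrp g\<^esub>)"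
  have "(\<lambda>(x :: nat, u :: nat word). let i = length u div 2 in
      if i \<in> {1..g} then free_gen (if even (length u) then Agen i else Bgen i) else \<one>\<^bsub>Hgrp g\<^esub>)
      \<in> {0} \<times> carrier ?Q \<rightarrow> carrier (Hgrp g)"
    by (auto simp: Let_def free_gen_Hgrp_closed)
  note r = H.free_ext_gen_hom[OF this, folded r_def]
  have len: "length (y j) = j" for j by (simp add: y_def)
  have "r (\<eta> w) = w" if "w \<in> carrier (Hgrp g)" for w
  proof -
    have "r (\<eta> (free_gen z)) = free_gen z" if "z \<in> ?S" for z
      using \<eta>(2)[OF that] that y by (auto simp: r(2) len Let_def)
    then show ?thesis
      using free_group_left_inverse[OF \<eta>(1)[unfolded Hgrp_def] r(1)[unfolded Hgrp_def]] that
      unfolding Hgrp_def by blast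
  qed
  then have 1: "primitive_embedding \<eta> (Hgrp g) ?K"
    by (rule primitive_embedding_retract[OF group_Hgrp \<eta>(1) r(1)])
  have "{0} \<union> {1..<n} = {..<n}" using assms by auto
  then obtain \<theta> where "primitive_embedding \<theta> ?K (free_group {..<n})"
    using primitive_embedding_conjugates[of "{0}" "{1..<n}"] by auto
  from primitive_embedding_compose[OF group_Hgrp group_free_group group_free_group 1 this]
  show ?thesis by blast
qed

lemma carrier_Hgrp:
  "w \<in> carrier (Hgrp g) \<longleftrightarrow> fst ` set w \<subseteq> Agen ` {1..g} \<union> Bgen ` {1..g} \<and> reduced w"
  by (simp add: Hgrp_def carrier_free_group)

lemma mult_Hgrp: "u \<otimes>\<^bsub>Hgrp g\<^esub> v = foldr push u v"
  by (simp add: Hgrp_def mult_free_group)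

lemma one_Hgrp: "\<one>\<^bsub>Hgrp g\<^esub> = []"
  by (simp add: Hgrp_def one_free_group)

lemma inv_Hgrp: "w \<in> carrier (Hgrp g) \<Longrightarrow> inv\<^bsub>Hgrp g\<^esub> w = inv_word w"
  by (simp add: Hgrp_def inv_free_group)

lemmas Hgrp_simps = carrier_Hgrp mult_Hgrp inv_Hgrp reduced_def inv_word_def

section \<open>Explicit endomorphisms of \<open>H\<^sub>g\<close>\<close>

definition Hgrp_end :: "nat \<Rightarrow> (nat \<Rightarrow> sgen word) \<Rightarrow> (nat \<Rightarrow> sgen word) \<Rightarrow> sgen word \<Rightarrow> sgen word" where
  "Hgrp_end g a b = free_ext (Hgrp g) (case_sgen a b)"

lemma Hgrp_end:
  assumes "\<And>i. i \<in> {1..g} \<Longrightarrow> a i \<in> carrier (Hgrp g)" "\<And>i. i \<in> {1..g} \<Longrightarrow> b i \<in> carrier (Hgrp g)"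
  shows "Hgrp_end g a b \<in> hom (Hgrp g) (Hgrp g)"
    and "i \<in> {1..g} \<Longrightarrow> Hgrp_end g a b (free_gen (Agen i)) = a i"
    and "i \<in> {1..g} \<Longrightarrow> Hgrp_end g a b (free_gen (Bgen i)) = b i"
proof -
  interpret H: group "Hgrp g" by (rule group_Hgrp)
  have "case_sgen a b \<in> Agen ` {1..g} \<union> Bgen ` {1..g} \<rightarrow> carrier (Hgrp g)" using assms by auto
  note * = H.free_ext_gen_hom[OF this, folded Hgrp_def Hgrp_end_def]
  show "Hgrp_end g a b \<in> hom (Hgrp g) (Hgrp g)" by (rule *(1))
  show "Hgrp_end g a b (free_gen (Agen i)) = a i" if "i \<in> {1..g}"
    using *(2)[of "Agen i"] that by auto
  show "Hgrp_end g a b (free_gen (Bgen i)) = b i" if "i \<in> {1..g}"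
    using *(2)[of "Bgen i"] that by auto
qed

text \<open>
  With \<open>x = a\<^sub>i\<close> and \<open>y = b\<^sub>i\<close>, the pair \<open>(x, c x y\<^sup>-\<^sup>1)\<close> of the introduction is the value of
  \<open>base_rep\<close> on the generators.  The involution maps it to \<open>(c, x c y)\<close>, which is the second pair in
  the wrong order; \<open>swap_gens\<close> corrects this.
\<close>
definition base_rep :: "nat \<Rightarrow> sgen word \<Rightarrow> sgen word" where
  "base_rep g = Hgrp_end g (\<lambda>i. free_gen (Agen i))
     (\<lambda>i. [(Bgen i, False), (Agen i, True), (Bgen i, True), (Bgen i, True), (Agen i, True), (Bgen i, False)])"

definition swap_gens :: "nat \<Rightarrow> nat set \<Rightarrow> sgen word \<Rightarrow> sgen word" where
  "swap_gens g E = Hgrp_end g (\<lambda>i. free_gen (if i \<in> E then Bgen i else Agen i))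
     (\<lambda>i. free_gen (if i \<in> E then Agen i else Bgen i))"

definition involution :: "nat \<Rightarrow> nat set \<Rightarrow> sgen word \<Rightarrow> sgen word" where
  "involution g E = Hgrp_end g
     (\<lambda>i. if i \<in> E then [(Bgen i, False), (Agen i, True), (Bgen i, True), (Bgen i, True)]
          else [(Agen i, True)])
     (\<lambda>i. [(Bgen i, i \<notin> E)])"

lemma base_rep:
  shows "base_rep g \<in> hom (Hgrp g) (Hgrp g)"
    and "\<And>i. i \<in> {1..g} \<Longrightarrow> base_rep g (free_gen (Agen i)) = free_gen (Agen i)"
    and "\<And>i. i \<in> {1..g} \<Longrightarrow> base_rep g (free_gen (Bgen i)) =
      [(Bgen i, False), (Agen i, True), (Bgen i, True), (Bgen i, True), (Agen i, True), (Bgen i, False)]"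
  unfolding base_rep_def
  by (rule Hgrp_end; auto simp: Hgrp_simps free_gen_def)+

lemma swap_gens:
  shows "swap_gens g E \<in> hom (Hgrp g) (Hgrp g)"
    and "\<And>i. i \<in> {1..g} \<Longrightarrow> swap_gens g E (free_gen (Agen i)) = free_gen (if i \<in> E then Bgen i else Agen i)"
    and "\<And>i. i \<in> {1..g} \<Longrightarrow> swap_gens g E (free_gen (Bgen i)) = free_gen (if i \<in> E then Agen i else Bgen i)"
  unfolding swap_gens_def
  by (rule Hgrp_end; auto simp: Hgrp_simps free_gen_def)+

lemma involution:
  shows "involution g E \<in> hom (Hgrp g) (Hgrp g)"
    and "\<And>i. i \<in> {1..g} \<Longrightarrow> involution g E (free_gen (Agen i)) =
       (if i \<in> E then [(Bgen i, False), (Agen i, True), (Bgen i, True), (Bgen i, True)]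
        else [(Agen i, True)])"
    and "\<And>i. i \<in> {1..g} \<Longrightarrow> involution g E (free_gen (Bgen i)) = [(Bgen i, i \<notin> E)]"
  unfolding involution_def
  by (rule Hgrp_end; auto simp: Hgrp_simps free_gen_def)+

lemma primitive_embedding_involutive:
  assumes "h \<in> hom (Hgrp g) (Hgrp g)"
    and "\<And>i. i \<in> {1..g} \<Longrightarrow> h (h (free_gen (Agen i))) = free_gen (Agen i)"
    and "\<And>i. i \<in> {1..g} \<Longrightarrow> h (h (free_gen (Bgen i))) = free_gen (Bgen i)"
  shows "primitive_embedding h (Hgrp g) (Hgrp g)"
proof (rule primitive_embedding_bij[OF group_Hgrp group_Hgrp assms(1)])
  have "h (h w) = w" if "w \<in> carrier (Hgrp g)" for w
    using free_group_left_inverse[OF assms(1,1)[unfolded Hgrp_def]] assms(2,3) that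
    unfolding Hgrp_def by blast
  then show "bij_betw h (carrier (Hgrp g)) (carrier (Hgrp g))"
    using assms(1) by (intro bij_betwI[where g = h]) (auto simp: hom_def)
qed

lemma primitive_embedding_swap_gens: "primitive_embedding (swap_gens g E) (Hgrp g) (Hgrp g)"
  by (rule primitive_embedding_involutive) (auto simp: swap_gens)

text \<open>Rewrite rules that evaluate an endomorphism on an explicit word letter by letter. The
  last one asks for at least two letters, so that it does not apply to \<open>[p]\<close> again and
  rewriting terminates.\<close>

lemma hom_Hgrp_letters:
  assumes "h \<in> hom (Hgrp g) (Hgrp g)" "i \<in> {1..g}"
  shows "h [(Agen i, True)] = h (free_gen (Agen i))" "h [(Bgen i, True)] = h (free_gen (Bgen i))"
    "h [(Agen i, False)] = inv_word (h (free_gen (Agen i)))"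
    "h [(Bgen i, False)] = inv_word (h (free_gen (Bgen i)))"
    "p # q # w \<in> carrier (Hgrp g) \<Longrightarrow> h (p # q # w) = foldr push (h [p]) (h (q # w))"
proof -
  interpret h: group_hom "Hgrp g" "Hgrp g" h
    using assms(1) by (simp add: group_hom_def group_hom_axioms_def group_Hgrp)
  let ?S = "Agen ` {1..g} \<union> Bgen ` {1..g}"
  note c = free_gen_Hgrp_closed[OF assms(2)]
  have inv: "inv\<^bsub>Hgrp g\<^esub> w = inv_word w" if "w \<in> carrier (Hgrp g)" for w
    using inv_free_group that by (simp add: Hgrp_def)
  show "h [(Agen i, True)] = h (free_gen (Agen i))" "h [(Bgen i, True)] = h (free_gen (Bgen i))"
    by (simp_all add: free_gen_def)
  have "h (inv_word (free_gen (Agen i))) = inv_word (h (free_gen (Agen i)))"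
       "h (inv_word (free_gen (Bgen i))) = inv_word (h (free_gen (Bgen i)))"
    using h.hom_inv[OF c(1)] h.hom_inv[OF c(2)] c h.hom_closed by (simp_all add: inv)
  then show "h [(Agen i, False)] = inv_word (h (free_gen (Agen i)))"
    "h [(Bgen i, False)] = inv_word (h (free_gen (Bgen i)))"
    by (simp_all add: free_gen_def inv_word_def)
  assume "p # q # w \<in> carrier (Hgrp g)"
  then have "p # q # w \<in> carrier (free_group ?S)" by (simp add: Hgrp_def)
  note d = Cons_free_group_closedD[OF this]
  have "h (p # q # w) = h ([p] \<otimes>\<^bsub>Hgrp g\<^esub> (q # w))" using d(3) by (simp add: Hgrp_def)
  also have "\<dots> = h [p] \<otimes>\<^bsub>Hgrp g\<^esub> h (q # w)"
    using d(1,2) singleton_free_group_closed[of p ?S] by (intro h.hom_mult) (simp_all add: Hgrp_def)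
  finally show "h (p # q # w) = foldr push (h [p]) (h (q # w))" by (simp add: Hgrp_def mult_free_group)
qed

lemma primitive_embedding_involution: "primitive_embedding (involution g E) (Hgrp g) (Hgrp g)"
proof (rule primitive_embedding_involutive[OF involution(1)])
  fix i assume i: "i \<in> {1..g}"
  note l = hom_Hgrp_letters[OF involution(1)[of g E] i]
  have "involution g E (involution g E (free_gen (Agen i))) = [(Agen i, True)]"
    "involution g E (involution g E (free_gen (Bgen i))) = [(Bgen i, True)]"
    using i by (cases "i \<in> E"; simp add: involution l Hgrp_simps)+
  then show "involution g E (involution g E (free_gen (Agen i))) = free_gen (Agen i)"
    "involution g E (involution g E (free_gen (Bgen i))) = free_gen (Bgen i)"
    by (simp_all add: free_gen_def)
qed

text \<open>The value on \<open>b\<^sub>i\<close> is the product of the conjugates of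
  \<open>a\<^sub>i\<close> by the inverse of \<open>b\<^sub>i\<close> and by
  \<open>b\<^sub>i\<close>. Thus \<open>base_rep\<close> factors through the free group on the
  conjugates, where \<open>a\<^sub>i\<close> goes to one basis element and \<open>b\<^sub>i\<close>
  to the product of two others. Killing the first of these two and reading \<open>b\<^sub>i\<close>
  off the second gives a retraction.\<close>

lemma primitive_embedding_base_rep: "primitive_embedding (base_rep g) (Hgrp g) (Hgrp g)"
proof -
  let ?Z = "Agen ` {1..g}" and ?Y = "Bgen ` {1..g}"
  let ?Q = "free_group ?Y"
  let ?K = "free_group (?Z \<times> carrier ?Q)"
  interpret H: group "Hgrp g" by (rule group_Hgrp)
  interpret K: group ?K by (rule group_free_group)
  define f where "f = (\<lambda>z. case z of Agen i \<Rightarrow> [((Agen i, [] :: sgen word), True)]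
     | Bgen i \<Rightarrow> [((Agen i, [(Bgen i, False)]), True), ((Agen i, [(Bgen i, True)]), True)])"
  define \<eta> where "\<eta> = free_ext ?K f"
  have "f \<in> ?Z \<union> ?Y \<rightarrow> carrier ?K" by (auto simp: f_def carrier_free_group reduced_def)
  note \<eta> = K.free_ext_gen_hom[OF this, folded \<eta>_def Hgrp_def]
  define e where "e = (\<lambda>(z, u). case z of
      Agen i \<Rightarrow> if u = [] then free_gen (Agen i)
        else if u = [(Bgen i, True)] then free_gen (Bgen i) else \<one>\<^bsub>Hgrp g\<^esub>
    | Bgen i \<Rightarrow> \<one>\<^bsub>Hgrp g\<^esub>)"
  define r where "r = free_ext (Hgrp g) e"
  have "e \<in> ?Z \<times> carrier ?Q \<rightarrow> carrier (Hgrp g)"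
    by (auto simp: e_def free_gen_Hgrp_closed)
  note r = H.free_ext_gen_hom[OF this, folded r_def]
  have "r (\<eta> w) = w" if "w \<in> carrier (Hgrp g)" for w
  proof -
    have "r (\<eta> (free_gen z)) = free_gen z" if "z \<in> ?Z \<union> ?Y" for z
      using \<eta>(2)[OF that] that
      by (auto simp: f_def r_def free_ext_def e_def free_gen_Hgrp_closed)
    then show ?thesis
      using free_group_left_inverse[OF \<eta>(1)[unfolded Hgrp_def] r(1)[unfolded Hgrp_def]] that
      unfolding Hgrp_def by blast
  qed
  then have 1: "primitive_embedding \<eta> (Hgrp g) ?K"
    by (rule primitive_embedding_retract[OF group_Hgrp \<eta>(1) r(1)])
  define c where "c = (\<lambda>(x, u). u \<otimes>\<^bsub>Hgrp g\<^esub> free_gen x \<otimes>\<^bsub>Hgrp g\<^esub> inv\<^bsub>Hgrp g\<^esub> u)"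
  define \<theta> where "\<theta> = free_ext (Hgrp g) c"
  have "primitive_embedding \<theta> ?K (Hgrp g)"
    using primitive_embedding_conjugates[of ?Z ?Y] by (auto simp: \<theta>_def c_def Hgrp_def)
  then have emb: "primitive_embedding (\<theta> \<circ> \<eta>) (Hgrp g) (Hgrp g)"
    by (rule primitive_embedding_compose[OF group_Hgrp group_free_group group_Hgrp 1])
  have eq: "(\<theta> \<circ> \<eta>) w = base_rep g w" if "w \<in> carrier (Hgrp g)" for w
  proof (rule free_group_hom_eqI[where K = "Hgrp g" and S = "?Z \<union> ?Y" and h = "\<theta> \<circ> \<eta>", OF group_Hgrp])
    show "\<theta> \<circ> \<eta> \<in> hom (free_group (?Z \<union> ?Y)) (Hgrp g)"
      using emb by (simp add: primitive_embedding_def Hgrp_def)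
    show "base_rep g \<in> hom (free_group (?Z \<union> ?Y)) (Hgrp g)"
      using base_rep(1) by (simp add: Hgrp_def)
    fix z assume z: "z \<in> ?Z \<union> ?Y"
    then show "(\<theta> \<circ> \<eta>) (free_gen z) = base_rep g (free_gen z)"
      using \<eta>(2)[OF z]
      by (auto simp: base_rep f_def \<theta>_def free_ext_def c_def)
        (auto simp: free_gen_def Hgrp_simps one_Hgrp)
  qed (use that in \<open>simp add: Hgrp_def\<close>)
  have "inj_on (\<theta> \<circ> \<eta>) (carrier (Hgrp g)) = inj_on (base_rep g) (carrier (Hgrp g))"
    by (rule inj_on_cong) (rule eq)
  moreover have "(\<theta> \<circ> \<eta>) ` carrier (Hgrp g) = base_rep g ` carrier (Hgrp g)"
    by (rule image_cong) (simp_all only: eq)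
  ultimately show ?thesis
    using emb base_rep(1) by (simp add: primitive_embedding_def)
qed

section \<open>The representations indexed by subsets of \<open>{1..g}\<close>\<close>

definition twisted_rep :: "nat \<Rightarrow> nat set \<Rightarrow> sgen word \<Rightarrow> sgen word" where
  "twisted_rep g E = involution g E \<circ> (base_rep g \<circ> swap_gens g E)"

lemma primitive_embedding_twisted_rep: "primitive_embedding (twisted_rep g E) (Hgrp g) (Hgrp g)"
  unfolding twisted_rep_def
  by (rule primitive_embedding_compose[OF group_Hgrp group_Hgrp group_Hgrp
        primitive_embedding_compose[OF group_Hgrp group_Hgrp group_Hgrp
          primitive_embedding_swap_gens primitive_embedding_base_rep] primitive_embedding_involution])

lemma twisted_rep_gens:
  assumes i: "i \<in> {1..g}"
  shows "twisted_rep g E (free_gen (Agen i)) =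
      (if i \<in> E then [(Agen i, True), (Bgen i, False), (Agen i, True), (Bgen i, True), (Bgen i, True), (Bgen i, True)]
       else [(Agen i, True)])"
    "twisted_rep g E (free_gen (Bgen i)) =
      (if i \<in> E then [(Bgen i, False), (Agen i, True), (Bgen i, True), (Bgen i, True)]
       else [(Bgen i, False), (Agen i, True), (Bgen i, True), (Bgen i, True), (Agen i, True), (Bgen i, False)])"
proof -
  note l = hom_Hgrp_letters[OF involution(1)[of g E] i]
  show "twisted_rep g E (free_gen (Agen i)) =
      (if i \<in> E then [(Agen i, True), (Bgen i, False), (Agen i, True), (Bgen i, True), (Bgen i, True), (Bgen i, True)]
       else [(Agen i, True)])"
    "twisted_rep g E (free_gen (Bgen i)) =
      (if i \<in> E then [(Bgen i, False), (Agen i, True), (Bgen i, True), (Bgen i, True)]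
       else [(Bgen i, False), (Agen i, True), (Bgen i, True), (Bgen i, True), (Agen i, True), (Bgen i, False)])"
    using i by (auto simp: twisted_rep_def swap_gens base_rep involution l Hgrp_simps)
qed

text \<open>In each block the two commutators are x c [x, y^-1] (c x)^-1 and x c [y, c] (c x)^-1,
  and both inner commutators equal x y^-1 x^-1 y. In the proof free reduction does this
  computation.\<close>

lemma twisted_rep_bdry: "twisted_rep g E (bdry g) = twisted_rep g {} (bdry g)"
proof -
  have hom: "twisted_rep g E \<in> hom (Hgrp g) (Hgrp g)" for E
    using primitive_embedding_twisted_rep by (simp add: primitive_embedding_def)
  have "commutator (Hgrp g) (twisted_rep g E (free_gen (Agen i))) (twisted_rep g E (free_gen (Bgen i)))
     = commutator (Hgrp g) (twisted_rep g {} (free_gen (Agen i))) (twisted_rep g {} (free_gen (Bgen i)))"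
    if "i \<in> {1..g}" for i
    using that by (auto simp: twisted_rep_gens commutator_def Hgrp_simps)
  then show ?thesis
    unfolding bdry_hom(2)[OF group_Hgrp hom] by (intro foldr_cong) auto
qed

text \<open>The exponent sum in \<open>b\<^sub>j\<close> detects whether \<open>j\<close> belongs to
  the index set: it vanishes on the whole image if \<open>j\<close> does not, and it is 2 on the
  image of \<open>a\<^sub>j\<close> if \<open>j\<close> does.\<close>

lemma twisted_rep_image_inj:
  "inj_on (\<lambda>E. twisted_rep g E ` carrier (Hgrp g)) (Pow {1..g})"
proof -
  have "j \<in> E'" if j: "j \<in> E" "E \<subseteq> {1..g}"
    and eq: "twisted_rep g E ` carrier (Hgrp g) = twisted_rep g E' ` carrier (Hgrp g)" for j E E'
  proof (rule ccontr)
    assume "j \<notin> E'"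
    interpret Z: group integer_group by simp
    have jg: "j \<in> {1..g}" using j by blast
    define \<epsilon> where "\<epsilon> = free_ext integer_group (\<lambda>z. if z = Bgen j then 1 else 0 :: int)"
    have \<epsilon>: "\<epsilon> \<in> hom (Hgrp g) integer_group"
      unfolding \<epsilon>_def Hgrp_def by (rule Z.free_ext_hom) simp
    have hom: "twisted_rep g E \<in> hom (Hgrp g) (Hgrp g)" for E
      using primitive_embedding_twisted_rep by (simp add: primitive_embedding_def)
    have zero: "(\<epsilon> \<circ> twisted_rep g E') w = 0" if "w \<in> carrier (Hgrp g)" for w
    proof (rule free_group_hom_eqI[OF group_integer_group, of _ "Agen ` {1..g} \<union> Bgen ` {1..g}" "\<lambda>_. 0"])
      show "\<epsilon> \<circ> twisted_rep g E' \<in> hom (free_group (Agen ` {1..g} \<union> Bgen ` {1..g})) integer_group"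
        using hom_compose[OF hom \<epsilon>] by (simp add: Hgrp_def)
      show "(\<lambda>_. 0) \<in> hom (free_group (Agen ` {1..g} \<union> Bgen ` {1..g})) integer_group"
        by (rule additive_imp_hom) simp
      fix z assume "z \<in> Agen ` {1..g} \<union> Bgen ` {1..g}"
      then show "(\<epsilon> \<circ> twisted_rep g E') (free_gen z) = 0"
        using \<open>j \<notin> E'\<close> by (auto simp: twisted_rep_gens \<epsilon>_def free_ext_def)
    qed (use that in \<open>simp add: Hgrp_def\<close>)
    have "twisted_rep g E (free_gen (Agen j)) \<in> twisted_rep g E ` carrier (Hgrp g)"
      using free_gen_Hgrp_closed(1)[OF jg] by blast
    then have "\<epsilon> (twisted_rep g E (free_gen (Agen j))) = 0"
      using zero unfolding eq by auto
    then show False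
      using j(1) jg by (simp add: twisted_rep_gens \<epsilon>_def free_ext_def)
  qed
  note sub = this
  show ?thesis
  proof (rule inj_onI)
    fix E E' assume E: "E \<in> Pow {1..g}" "E' \<in> Pow {1..g}"
      and eq: "twisted_rep g E ` carrier (Hgrp g) = twisted_rep g E' ` carrier (Hgrp g)"
    show "E = E'"
      using sub[OF _ _ eq] sub[OF _ _ eq[symmetric]] E by auto
  qed
qed

section \<open>Transport to \<open>F\<close>\<close>

lemma num'_ge_power:
  fixes F :: "('f, 'm) monoid_scheme"
  assumes F: "group F" and \<psi>: "primitive_embedding \<psi> (Hgrp g) F"
  shows "\<exists>x\<in>carrier F. num' F g x \<ge> 2 ^ g"
proof
  define x where "x = \<psi> (twisted_rep g {} (bdry g))"
  have \<psi>h: "\<psi> \<in> hom (Hgrp g) F" "inj_on \<psi> (carrier (Hgrp g))"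
    using \<psi> by (auto simp: primitive_embedding_def)
  have th: "twisted_rep g E \<in> hom (Hgrp g) (Hgrp g)" for E
    using primitive_embedding_twisted_rep by (simp add: primitive_embedding_def)
  have tc: "twisted_rep g E w \<in> carrier (Hgrp g)" if "w \<in> carrier (Hgrp g)" for E w
    using th[of E] that by (auto simp: hom_def)
  show "x \<in> carrier F" using \<psi>h(1) tc[OF bdry_closed] by (auto simp: x_def hom_def)
  \<comment> \<open>Restricting to the carrier makes the composite extensional, so that it counts as
    a representation; the image stays the same.\<close>
  define h where "h E = restrict (\<psi> \<circ> twisted_rep g E) (carrier (Hgrp g))" for E
  have img: "h E ` carrier (Hgrp g) = \<psi> ` twisted_rep g E ` carrier (Hgrp g)" for E
    by (auto simp: h_def image_iff)
  have "h E \<in> admissible_reps F g x" for E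
  proof -
    have pe: "primitive_embedding (\<psi> \<circ> twisted_rep g E) (Hgrp g) F"
      by (rule primitive_embedding_compose[OF group_Hgrp group_Hgrp F
            primitive_embedding_twisted_rep \<psi>])
    have "h E \<in> ext_hom (Hgrp g) F"
      unfolding h_def using pe by (intro restrict_ext_hom group_Hgrp) (simp add: primitive_embedding_def)
    moreover have "h E (bdry g) = x"
      by (simp add: h_def bdry_closed x_def twisted_rep_bdry[of g E])
    moreover have "inj_on (h E) (carrier (Hgrp g))"
      using pe by (simp add: h_def primitive_embedding_def inj_on_restrict_eq)
    moreover have "primitive_subgroup (h E ` carrier (Hgrp g)) F"
      using pe by (simp add: img primitive_embedding_def image_comp)
    ultimately show ?thesis by (simp add: admissible_reps_def genus_reps_def)
  qed
  then have sub: "(\<lambda>E. h E ` carrier (Hgrp g)) ` Pow {1..g}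
      \<subseteq> (\<lambda>h. h ` carrier (Hgrp g)) ` admissible_reps F g x" by blast
  have "inj_on (\<lambda>E. h E ` carrier (Hgrp g)) (Pow {1..g})"
  proof (rule inj_onI)
    fix E E' assume E: "E \<in> Pow {1..g}" "E' \<in> Pow {1..g}"
      and "h E ` carrier (Hgrp g) = h E' ` carrier (Hgrp g)"
    then have "twisted_rep g E ` carrier (Hgrp g) = twisted_rep g E' ` carrier (Hgrp g)"
      using inj_on_image_eq_iff[OF \<psi>h(2)] tc by (simp add: img image_subset_iff)
    then show "E = E'" using inj_onD[OF twisted_rep_image_inj[of g], of E E'] E by simp
  qed
  then have "card ((\<lambda>E. h E ` carrier (Hgrp g)) ` Pow {1..g}) = 2 ^ g"
    by (simp add: card_image card_Pow)
  then have "card ((\<lambda>h. h ` carrier (Hgrp g)) ` admissible_reps F g x) \<ge> 2 ^ g"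
    if "finite ((\<lambda>h. h ` carrier (Hgrp g)) ` admissible_reps F g x)"
    using card_mono[OF that sub] by simp
  moreover have "(2 :: enat) ^ g = enat (2 ^ g)"
    by (induction g) (simp_all add: one_enat_def numeral_eq_enat)
  ultimately show "num' F g x \<ge> 2 ^ g" by (simp add: num'_def ecount_def)
qed

lemma fF'_ge_power:
  fixes F :: "('f, 'm) monoid_scheme"
  assumes F: "group F" and iso: "F \<cong> free_group {..<n::nat}" and nc: "\<not> comm_group F"
  shows "fF' F g \<ge> 2 ^ g"
proof -
  have n: "n \<ge> 2"
  proof (rule ccontr)
    assume "\<not> n \<ge> 2"
    then have "{..<n} \<subseteq> {0}" by auto
    then show False
      using nc comm_group_iso[OF F iso comm_group_free_group_singleton] by blast
  qed
  obtain \<phi> where \<phi>: "primitive_embedding \<phi> (Hgrp g) (free_group {..<n})"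
    using primitive_embedding_Hgrp_free_group[OF n] by blast
  obtain i where "i \<in> iso (free_group {..<n}) F"
    using group.iso_sym[OF F iso] by (auto simp: is_iso_def)
  then have "primitive_embedding i (free_group {..<n}) F"
    by (intro primitive_embedding_bij group_free_group F) (auto simp: iso_def)
  from primitive_embedding_compose[OF group_Hgrp group_free_group F \<phi> this]
  obtain x where "x \<in> carrier F" "num' F g x \<ge> 2 ^ g"
    using num'_ge_power[OF F] by blast
  then show ?thesis unfolding fF'_def by (meson SUP_upper2)
qed

theorem corollary1p10:
  fixes F :: "('f, 'm) monoid_scheme" and n g N :: nat
  assumes "group F"
    and "F \<cong> free_group {..<n}"
    and "\<not> comm_group F"
    and "g \<ge> 1"
    and "solid_bound F g N"
  shows "enat N \<ge> fF F g \<and> fF F g \<ge> fF' F g \<and> fF' F g \<ge> 2 ^ g"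
proof -
  obtain e T where "free_embedding F e T" using free_embedding_exists[OF assms(1,2)] .
  then show ?thesis
    using fF_le_solid_bound[OF assms(1,5)] free_embedding.fF'_le_fF assms(4)
      fF'_ge_power[OF assms(1-3)] by blast
qed

end
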